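(* Let $(X,d,m)$ be a $\mathrm{CD}(0,N)$ space for some $N\in(1,\infty)$ with Euclidean volume growth. Then, for every $p\in(1,N)$, setting $p^*:=\frac{pN}{N-p}$, it holds $$\|u\|_{L^{p^*}(m)}\le \mathrm{Eucl}(N,p)\,\mathsf{AVR}(X)^{-\frac1N}\,\||Du|\|_{L^p(m)},\qquad\forall u\in\mathrm{LIP}_c(X).$$ Moreover this inequality is sharp, i.e. it fails if the constant $\mathrm{Eucl}(N,p)\mathsf{AVR}(X)^{-1/N}$ is replaced by any strictly smaller one.
   Context: A metric measure space $(X,d,m)$ is a complete separable metric space with a nonzero, nonnegative Borel measure $m$ finite on bounded sets; it is assumed that $\mathrm{supp}(m)=X$. $\mathrm{LIP}_c(X)$ is the set of compactly supported Lipschitz functions. Sobolev spaces: for locally Lipschitz $f$, $\mathrm{lip} f(x):=\limsup_{y\to x}\frac{|f(y)-f(x)|}{d(x,y)}$ ($0$ at isolated points). For $p\in(1,\infty)$, $\mathrm{Ch}_p(f):=\inf\{\liminf_n\int(\mathrm{lip} f_n)^p\,dm: f_n\in L^p(m)\cap \mathrm{LIP}(X),\ f_n\to f\text{ in }L^p(m)\}$, $W^{1,p}(X):=\{f\in L^p(m):\mathrm{Ch}_p(f)<\infty\}$, and $|Df|\in L^p(m)$ is the minimal $p$-weak upper gradient, with $\mathrm{Ch}_p(f)=\int|Df|^p\,dm$ (on $\mathrm{CD}(K,N)$ spaces it does not depend on $p$). $\mathrm{CD}(0,N)$ condition: for all $m$-absolutely continuous probability measures $\mu_0=\rho_0m,\mu_1=\rho_1m$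 with bounded support there is an optimal dynamical plan $\pi$ (a probability measure on constant speed geodesics $\gamma:[0,1]\to X$ with $(e_0,e_1)_\sharp\pi$ a $W_2$-optimal coupling of $\mu_0,\mu_1$, where $e_t(\gamma)=\gamma_t$) such that for all $t\in[0,1]$, $N'\ge N$ one has $(e_t)_\sharp\pi=\rho_t m$ and $-\int\rho_t^{1-1/N'}dm\le-\int\big((1-t)\rho_0(\gamma_0)^{-1/N'}+t\rho_1(\gamma_1)^{-1/N'}\big)d\pi(\gamma)$. Constants: $\omega_N:=\frac{\pi^{N/2}}{\Gamma(N/2+1)}$ and $$\mathrm{Eucl}(N,p):=\frac1N\Big(\frac{N(p-1)}{N-p}\Big)^{\frac{p-1}{p}}\Big(\frac{\Gamma(N+1)}{N\omega_N\Gamma(N/p)\Gamma(N+1-N/p)}\Big)^{\frac1N}.$$ $\mathsf{AVR}(X):=\lim_{R\to+\infty}\frac{m(B_R(x_0))}{\omega_NR^N}$, which exists and does not depend on $x_0\in X$; $X$ has Euclidean volume growth if $\mathsf{AVR}(X)>0$. *)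

theory Defs
  imports "HOL-Probability.Probability"
begin

section \<open>Metric measure spaces\<close>

text \<open>The metric space \<open>(X,d)\<close> is the whole of a type of class \<^class>\<open>polish_space\<close>, that is, a
  complete separable metric space; the reference measure is a measure on its Borel sets.\<close>

definition measure_supp :: "'a::topological_space measure \<Rightarrow> 'a set" where
  "measure_supp \<mu> = {x. \<forall>U. open U \<longrightarrow> x \<in> U \<longrightarrow> emeasure \<mu> U > 0}"

definition metric_measure_space :: "'a::polish_space measure \<Rightarrow> bool" where
  "metric_measure_space m \<longleftrightarrow>
     sets m = sets borel \<and>
     emeasure m UNIV \<noteq> 0 \<and>
     (\<forall>B\<in>sets borel. bounded B \<longrightarrow> emeasure m B < \<infinity>) \<and>
     measure_supp m = UNIV"


section \<open>Lipschitz functions and Lebesgue spaces\<close>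

definition LIP :: "('a::metric_space \<Rightarrow> real) set" where
  "LIP = {f. \<exists>L. L-lipschitz_on UNIV f}"

definition LIP_c :: "('a::metric_space \<Rightarrow> real) set" where
  "LIP_c = {f \<in> LIP. compact (closure {x. f x \<noteq> 0})}"

text \<open>For locally Lipschitz \<open>f\<close> the upper limit is finite, so \<^const>\<open>enn2real\<close> loses nothing.\<close>

definition lip :: "('a::metric_space \<Rightarrow> real) \<Rightarrow> 'a \<Rightarrow> real" where
  "lip f x = (if open {x} then 0
     else enn2real (Limsup (at x) (\<lambda>y. ennreal (\<bar>f y - f x\<bar> / dist x y))))"

definition Lp :: "'a measure \<Rightarrow> real \<Rightarrow> ('a \<Rightarrow> real) set" where
  "Lp m p = {f \<in> borel_measurable m. integrable m (\<lambda>x. \<bar>f x\<bar> powr p)}"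

definition Lp_norm :: "'a measure \<Rightarrow> real \<Rightarrow> ('a \<Rightarrow> real) \<Rightarrow> real" where
  "Lp_norm m p f = (\<integral>x. \<bar>f x\<bar> powr p \<partial>m) powr (1 / p)"

definition Lp_tendsto :: "'a measure \<Rightarrow> real \<Rightarrow> (nat \<Rightarrow> 'a \<Rightarrow> real) \<Rightarrow> ('a \<Rightarrow> real) \<Rightarrow> bool" where
  "Lp_tendsto m p fs f \<longleftrightarrow>
     (\<lambda>n. \<integral>\<^sup>+x. ennreal (\<bar>fs n x - f x\<bar> powr p) \<partial>m) \<longlonglongrightarrow> 0"


section \<open>Cheeger energy and minimal weak upper gradient\<close>

definition Cheeger_energy :: "'a::metric_space measure \<Rightarrow> real \<Rightarrow> ('a \<Rightarrow> real) \<Rightarrow> ennreal" where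
  "Cheeger_energy m p f =
     Inf {liminf (\<lambda>n. \<integral>\<^sup>+x. ennreal (lip (fs n) x powr p) \<partial>m) | fs.
            (\<forall>n. fs n \<in> Lp m p \<inter> LIP) \<and> Lp_tendsto m p fs f}"

text \<open>Weak upper gradients in the relaxed sense of Cheeger and of Ambrosio, Gigli and
  Savare, which is the one underlying \<^const>\<open>Cheeger_energy\<close>: \<open>L\<^sup>p\<close> limits of functions
  dominating the local Lipschitz constants of Lipschitz functions that converge to \<open>f\<close> in \<open>L\<^sup>p\<close>.\<close>

definition weak_upper_gradient ::
    "'a::metric_space measure \<Rightarrow> real \<Rightarrow> ('a \<Rightarrow> real) \<Rightarrow> ('a \<Rightarrow> real) \<Rightarrow> bool" where
  "weak_upper_gradient m p f G \<longleftrightarrow>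
     G \<in> Lp m p \<and> (\<forall>x. 0 \<le> G x) \<and>
     (\<exists>fs gs. (\<forall>n. fs n \<in> Lp m p \<inter> LIP) \<and> Lp_tendsto m p fs f \<and>
              (\<forall>n. gs n \<in> Lp m p \<and> (AE x in m. lip (fs n) x \<le> gs n x)) \<and>
              Lp_tendsto m p gs G)"

text \<open>Every weak upper gradient \<open>G\<close> satisfies \<open>Ch\<^sub>p(f) \<le> \<integral> G\<^sup>p dm\<close>. The minimal one is the one
  with equality; by strict convexity of the \<open>L\<^sup>p\<close> norm it is unique up to null sets when
  \<open>1 < p < \<infinity>\<close>, and it exists whenever \<open>f \<in> L\<^sup>p\<close> and \<open>Ch\<^sub>p(f) < \<infinity>\<close>.\<close>

definition is_minimal_wug ::
    "'a::metric_space measure \<Rightarrow> real \<Rightarrow> ('a \<Rightarrow> real) \<Rightarrow> ('a \<Rightarrow> real) \<Rightarrow> bool" where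
  "is_minimal_wug m p f G \<longleftrightarrow>
     weak_upper_gradient m p f G \<and>
     Cheeger_energy m p f = (\<integral>\<^sup>+x. ennreal (G x powr p) \<partial>m)"

definition minimal_wug ::
    "'a::metric_space measure \<Rightarrow> real \<Rightarrow> ('a \<Rightarrow> real) \<Rightarrow> 'a \<Rightarrow> real" where
  "minimal_wug m p f = (SOME G. is_minimal_wug m p f G)"


section \<open>The curvature-dimension condition \<open>CD(0,N)\<close>\<close>

text \<open>A curve \<open>[0,1] \<rightarrow> X\<close> is represented by its extension to the real line that is constant on
  either side of \<open>[0,1]\<close>. On such curves the metric of the type of bounded continuous functions
  is the supremum distance over \<open>[0,1]\<close>.\<close>

definition ev :: "real \<Rightarrow> (real \<Rightarrow>\<^sub>C 'a::metric_space) \<Rightarrow> 'a" where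
  "ev t \<gamma> = apply_bcontfun \<gamma> t"

definition geodesics :: "(real \<Rightarrow>\<^sub>C 'a::metric_space) set" where
  "geodesics = {\<gamma>.
     (\<forall>s\<in>{0..1}. \<forall>t\<in>{0..1}. dist (ev s \<gamma>) (ev t \<gamma>) = \<bar>s - t\<bar> * dist (ev 0 \<gamma>) (ev 1 \<gamma>)) \<and>
     (\<forall>t\<le>0. ev t \<gamma> = ev 0 \<gamma>) \<and> (\<forall>t\<ge>1. ev t \<gamma> = ev 1 \<gamma>)}"

definition couplings ::
    "'a::polish_space measure \<Rightarrow> 'a measure \<Rightarrow> ('a \<times> 'a) measure set" where
  "couplings \<mu> \<nu> = {\<sigma>. sets \<sigma> = sets (borel \<Otimes>\<^sub>M borel) \<and>
                       distr \<sigma> borel fst = \<mu> \<and> distr \<sigma> borel snd = \<nu>}"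

definition W2_optimal ::
    "'a::polish_space measure \<Rightarrow> 'a measure \<Rightarrow> ('a \<times> 'a) measure \<Rightarrow> bool" where
  "W2_optimal \<mu> \<nu> \<sigma> \<longleftrightarrow> \<sigma> \<in> couplings \<mu> \<nu> \<and>
     (\<forall>\<sigma>'\<in>couplings \<mu> \<nu>. (\<integral>\<^sup>+(x, y). ennreal ((dist x y)\<^sup>2) \<partial>\<sigma>)
                       \<le> (\<integral>\<^sup>+(x, y). ennreal ((dist x y)\<^sup>2) \<partial>\<sigma>'))"

definition optimal_dynamical_plan ::
    "'a::polish_space measure \<Rightarrow> 'a measure \<Rightarrow> (real \<Rightarrow>\<^sub>C 'a) measure \<Rightarrow> bool" where
  "optimal_dynamical_plan \<mu> \<nu> \<pi> \<longleftrightarrow>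
     prob_space \<pi> \<and> sets \<pi> = sets (restrict_space borel geodesics) \<and>
     W2_optimal \<mu> \<nu> (distr \<pi> (borel \<Otimes>\<^sub>M borel) (\<lambda>\<gamma>. (ev 0 \<gamma>, ev 1 \<gamma>)))"

definition bounded_prob_density :: "'a::polish_space measure \<Rightarrow> ('a \<Rightarrow> real) \<Rightarrow> bool" where
  "bounded_prob_density m \<rho> \<longleftrightarrow> \<rho> \<in> borel_measurable m \<and> (\<forall>x. 0 \<le> \<rho> x) \<and>
     prob_space (density m (\<lambda>x. ennreal (\<rho> x))) \<and> bounded (measure_supp (density m (\<lambda>x. ennreal (\<rho> x))))"

text \<open>Since the supports are bounded, all integrals below are finite. The set where
  \<open>\<rho>0 (ev 0 \<gamma>)\<close> or \<open>\<rho>1 (ev 1 \<gamma>)\<close> vanishes is negligible for the plan, so that the value of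
  \<open>0 powr (-1/N')\<close> is immaterial.\<close>

definition CD0 :: "'a::polish_space measure \<Rightarrow> real \<Rightarrow> bool" where
  "CD0 m N \<longleftrightarrow>
     (\<forall>\<rho>0 \<rho>1. bounded_prob_density m \<rho>0 \<longrightarrow> bounded_prob_density m \<rho>1 \<longrightarrow>
        (\<exists>\<pi>. optimal_dynamical_plan (density m (\<lambda>x. ennreal (\<rho>0 x)))
                                   (density m (\<lambda>x. ennreal (\<rho>1 x))) \<pi> \<and>
           (\<forall>t\<in>{0..1}. \<exists>\<rho>t :: 'a \<Rightarrow> real. \<rho>t \<in> borel_measurable m \<and> (\<forall>x. 0 \<le> \<rho>t x) \<and>
              distr \<pi> borel (ev t) = density m (\<lambda>x. ennreal (\<rho>t x)) \<and>
              (\<forall>N'\<ge>N. - (\<integral>x. \<rho>t x powr (1 - 1 / N') \<partial>m)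
                 \<le> - (\<integral>\<gamma>. (1 - t) * \<rho>0 (ev 0 \<gamma>) powr (- 1 / N')
                            + t * \<rho>1 (ev 1 \<gamma>) powr (- 1 / N') \<partial>\<pi>)))))"


section \<open>Constants\<close>

text \<open>The constant \<open>\<omega>\<^sub>N\<close> is \<^const>\<open>unit_ball_vol\<close>.\<close>

definition Eucl :: "real \<Rightarrow> real \<Rightarrow> real" where
  "Eucl N p = 1 / N * (N * (p - 1) / (N - p)) powr ((p - 1) / p) *
     (Gamma (N + 1) / (N * unit_ball_vol N * Gamma (N / p) * Gamma (N + 1 - N / p))) powr (1 / N)"

text \<open>On \<open>CD(0,N)\<close> spaces the limit exists, is finite and is the same for all centres, by the
  Bishop-Gromov inequality.\<close>

definition AVR :: "'a::metric_space measure \<Rightarrow> real \<Rightarrow> real" where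
  "AVR m N = (THE a. \<forall>x0.
     ((\<lambda>R. measure m (ball x0 R) / (unit_ball_vol N * R powr N)) \<longlongrightarrow> a) at_top)"

end

theory Submission
  imports Defs
begin

text \<open>The inequality comes directly from optimal transport, without isoperimetry or rearrangements.
  Take \<open>\<rho>0\<close> proportional to \<open>(u + e) powr p_star\<close> on a ball and differentiate the CD(0,N) inequality
  at time 0 along the transport from \<open>\<rho>0\<close> to \<open>\<rho>1\<close>. With concavity of the Renyi entropy and Hoelder's
  inequality, \<open>\<integral> \<rho>1 powr (1 - 1 / N)\<close> is at most a constant plus
  \<open>(1 - 1 / N) * (p_star / N) * \<parallel>lip u\<parallel> / \<parallel>u\<parallel> * (\<integral> d(x0, y) powr q * \<rho>1 y) powr (1 / q)\<close>, where
  \<open>q = p / (p - 1)\<close> and the norms are those of \<open>L\<^sup>p\<close> and of \<open>L\<^sup>p\<^sup>*\<close>. For \<open>\<rho>1\<close> take the Aubin-Talenti density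
  at scale \<open>l\<close>. As \<open>l\<close> tends to infinity the support of \<open>u\<close> shrinks to the point \<open>x0\<close>, the rescaled radial
  measure converges to a multiple of \<open>AVR * r powr (N - 1) dr\<close>, and the integrals become Beta integrals
  which combine to \<open>Eucl N p\<close>. Truncated Aubin-Talenti functions of large scale show sharpness. The
  passage from \<open>lip u\<close> to the minimal weak upper gradient is by Fatou's lemma, and the existence of the
  latter follows from uniform convexity of \<open>L\<^sup>p\<close>.\<close>

section \<open>The local Lipschitz constant\<close>

text \<open>A CD(0,N) space offers no transport map and no change of variables; the convexity
  inequality for the entropy is the only tool. It becomes linear in the unknown intermediate density
  once the entropy is replaced by its tangent at a fixed reference density. At time 0 only
  difference quotients of the reference along geodesics remain, and \<open>lip\<close> controls
  their upper limits. Three regularisations are forced by this. Adding e keeps the power -1/N of the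
  density bounded and Lipschitz, at the price of a jump at the boundary of the ball. Cutting the
  target at radius \<Lambda> l keeps its support bounded. Replacing the length of a geodesic by the
  distance of its end to x0 costs a term that does not depend on the target and disappears on
  division by l. Hence the order of the limits: l to infinity, e to 0, \<Lambda> to infinity. The
  Euclidean constant appears because at large scale the space enters only through volumes of balls,
  so every radial integral is the Euclidean one times the same factor, and the Aubin-Talenti profile
  is extremal there.\<close>

lemma Limsup_quotient_le:
  fixes f :: "'a::metric_space \<Rightarrow> real"
  assumes "\<And>e. e > 0 \<Longrightarrow> eventually (\<lambda>y. \<bar>f y - f x\<bar> \<le> (b + e) * dist x y) (at x)" "b \<ge> 0"
  shows "Limsup (at x) (\<lambda>y. ennreal (\<bar>f y - f x\<bar> / dist x y)) \<le> ennreal b"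
proof (rule ennreal_le_epsilon)
  fix e :: real assume "e > 0"
  have "eventually (\<lambda>y. ennreal (\<bar>f y - f x\<bar> / dist x y) \<le> ennreal (b + e)) (at x)"
    using assms(1)[OF \<open>e > 0\<close>] eventually_neq_at_within[of x x UNIV]
  proof eventually_elim
    case (elim y)
    then show ?case
      by (intro ennreal_leI) (simp add: divide_le_eq)
  qed
  then have "Limsup (at x) (\<lambda>y. ennreal (\<bar>f y - f x\<bar> / dist x y)) \<le> ennreal (b + e)"
    by (rule Limsup_bounded)
  then show "Limsup (at x) (\<lambda>y. ennreal (\<bar>f y - f x\<bar> / dist x y)) \<le> ennreal b + ennreal e"
    using \<open>e > 0\<close> assms(2) by simp
qed

lemma lip_nonneg [simp]: "0 \<le> lip f x"
  by (simp add: lip_def)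

lemma lip_le:
  assumes "\<And>e. e > 0 \<Longrightarrow> eventually (\<lambda>y. \<bar>f y - f x\<bar> \<le> (b + e) * dist x y) (at x)" "b \<ge> 0"
  shows "lip f x \<le> b"
  using Limsup_quotient_le[OF assms] assms(2) enn2real_leI by (auto simp: lip_def)

text \<open>Together with \<open>lip_le\<close> this replaces the upper limit by an inequality near
  x without division, the form in which \<open>lip\<close> is used afterwards. At an isolated point
  the filter is trivial, in accordance with the value 0.\<close>

lemma lip_eventually:
  assumes f: "L-lipschitz_on UNIV f" and "e > 0"
  shows "eventually (\<lambda>y. \<bar>f y - f x\<bar> \<le> (lip f x + e) * dist x y) (at x)"
proof (cases "open {x}")
  case True
  then show ?thesis by (auto simp: eventually_at_topological intro!: exI[of _ "{x}"])
next
  case False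
  let ?L = "Limsup (at x) (\<lambda>y. ennreal (\<bar>f y - f x\<bar> / dist x y))"
  have L: "L \<ge> 0" using f by (rule lipschitz_on_nonneg)
  \<comment> \<open>Finiteness matters here: \<open>enn2real\<close> sends infinity to 0, which
    would make \<open>lip f x\<close> too small for the claim.\<close>
  have "?L \<le> ennreal L"
  proof (rule Limsup_quotient_le[OF _ L])
    fix e :: real assume "e > 0"
    have "\<bar>f y - f x\<bar> \<le> (L + e) * dist x y" for y
    proof -
      have "\<bar>f y - f x\<bar> \<le> L * dist x y"
        using lipschitz_onD[OF f, of x y] by (simp add: dist_real_def)
      also have "\<dots> \<le> (L + e) * dist x y"
        using \<open>e > 0\<close> by (intro mult_right_mono) auto
      finally show ?thesis .
    qed
    then show "eventually (\<lambda>y. \<bar>f y - f x\<bar> \<le> (L + e) * dist x y) (at x)" by simp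
  qed
  then have fin: "?L < top" by (rule order.strict_trans1) simp
  have "?L < ennreal (lip f x + e)"
    using fin \<open>e > 0\<close> False by (cases ?L) (auto simp: lip_def ennreal_less_iff)
  then have "eventually (\<lambda>y. ennreal (\<bar>f y - f x\<bar> / dist x y) < ennreal (lip f x + e)) (at x)"
    by (rule Limsup_lessD)
  with eventually_neq_at_within[of x x UNIV] show ?thesis
  proof eventually_elim
    case (elim y)
    then show ?case
      using \<open>e > 0\<close>
      by (simp add: ennreal_less_iff divide_less_eq less_imp_le del: ennreal_plus)
  qed
qed

lemma lip_le_lipschitz:
  assumes f: "L-lipschitz_on UNIV f"
  shows "lip f x \<le> L"
proof (rule lip_le)
  show L: "L \<ge> 0" using f by (rule lipschitz_on_nonneg)
  fix e :: real assume "e > 0"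
  have "\<bar>f y - f x\<bar> \<le> (L + e) * dist x y" for y
  proof -
    have "\<bar>f y - f x\<bar> \<le> L * dist x y"
      using lipschitz_onD[OF f, of x y] by (simp add: dist_real_def)
    also have "\<dots> \<le> (L + e) * dist x y"
      using \<open>e > 0\<close> by (intro mult_right_mono) auto
    finally show ?thesis .
  qed
  then show "eventually (\<lambda>y. \<bar>f y - f x\<bar> \<le> (L + e) * dist x y) (at x)" by simp
qed

lemma lip_mono:
  assumes "L-lipschitz_on UNIV f" "\<And>y. \<bar>g y - g x\<bar> \<le> \<bar>f y - f x\<bar>"
  shows "lip g x \<le> lip f x"
proof (rule lip_le)
  fix e :: real assume "e > 0"
  from lip_eventually[OF assms(1) this, of x]
  show "eventually (\<lambda>y. \<bar>g y - g x\<bar> \<le> (lip f x + e) * dist x y) (at x)"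
    by eventually_elim (use assms(2) order_trans in blast)
qed simp

lemma lip_midpoint_le:
  assumes "L-lipschitz_on UNIV f" "M-lipschitz_on UNIV g"
  shows "lip (\<lambda>x. (f x + g x) / 2) x \<le> (lip f x + lip g x) / 2"
proof (rule lip_le)
  fix e :: real assume "e > 0"
  from lip_eventually[OF assms(1) this, of x] lip_eventually[OF assms(2) this, of x]
  show "eventually (\<lambda>y. \<bar>(f y + g y) / 2 - (f x + g x) / 2\<bar> \<le> ((lip f x + lip g x) / 2 + e) * dist x y) (at x)"
    by eventually_elim (auto simp: algebra_simps abs_le_iff field_simps)
qed simp

lemma lip_mult_le:
  assumes f: "L-lipschitz_on UNIV f" and g: "M-lipschitz_on UNIV g"
    and "\<And>x. 0 \<le> g x" "\<And>x. g x \<le> 1"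
  shows "lip (\<lambda>x. f x * g x) x \<le> lip f x + M * \<bar>f x\<bar>"
proof (rule lip_le)
  have M: "M \<ge> 0" using g by (rule lipschitz_on_nonneg)
  then show "lip f x + M * \<bar>f x\<bar> \<ge> 0" by simp
  fix e :: real assume "e > 0"
  from lip_eventually[OF f this, of x]
  show "eventually (\<lambda>y. \<bar>f y * g y - f x * g x\<bar> \<le> (lip f x + M * \<bar>f x\<bar> + e) * dist x y) (at x)"
  proof eventually_elim
    case (elim y)
    have "\<bar>f y * g y - f x * g x\<bar> = \<bar>(f y - f x) * g y + f x * (g y - g x)\<bar>"
      by (simp add: algebra_simps)
    also have "\<dots> \<le> \<bar>f y - f x\<bar> * g y + \<bar>f x\<bar> * \<bar>g y - g x\<bar>"
      using assms(3) by (metis abs_mult abs_of_nonneg abs_triangle_ineq)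
    also have "\<dots> \<le> \<bar>f y - f x\<bar> * 1 + \<bar>f x\<bar> * (M * dist x y)"
      using lipschitz_onD[OF g, of x y] assms(4)
      by (intro add_mono mult_left_mono) (auto simp: dist_real_def)
    also have "\<dots> \<le> (lip f x + M * \<bar>f x\<bar> + e) * dist x y"
      using elim by (simp add: algebra_simps)
    finally show ?case .
  qed
qed

lemma lip_chain_le:
  assumes f: "L-lipschitz_on UNIV f" and h: "(h has_real_derivative D) (at (f x))"
  shows "lip (\<lambda>x. h (f x)) x \<le> \<bar>D\<bar> * lip f x"
proof (rule lip_le)
  show "\<bar>D\<bar> * lip f x \<ge> 0" by simp
  fix e :: real assume e: "e > 0"
  define l where "l = lip f x"
  have l: "l \<ge> 0" by (simp add: l_def)
  \<comment> \<open>The product of the two perturbed factors exceeds |D| l by d (|D| + l + d). As d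
    is at most 1, the denominator dominates this bracket and the excess is at most e.\<close>
  define d where "d = min 1 (e / (2 * (l + 1) + 2 * \<bar>D\<bar> + 2))"
  have den: "2 * (l + 1) + 2 * \<bar>D\<bar> + 2 > 0" using l by simp
  have d: "d > 0" "d \<le> 1"
    using e den by (auto simp: d_def)
  have "d \<le> e / (2 * (l + 1) + 2 * \<bar>D\<bar> + 2)" by (simp add: d_def)
  then have d3: "d * (2 * (l + 1) + 2 * \<bar>D\<bar> + 2) \<le> e"
    using den by (simp only: pos_le_divide_eq)
  have "eventually (\<lambda>z. \<bar>h z - h (f x)\<bar> \<le> (\<bar>D\<bar> + d) * \<bar>z - f x\<bar>) (at (f x))"
  proof -
    have "((\<lambda>z. (h z - h (f x)) / (z - f x)) \<longlongrightarrow> D) (at (f x))"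
      using h by (simp add: has_field_derivative_iff)
    then have "eventually (\<lambda>z. dist ((h z - h (f x)) / (z - f x)) D < d) (at (f x))"
      using d(1) by (rule tendstoD)
    with eventually_neq_at_within[of "f x" "f x" UNIV] show ?thesis
    proof eventually_elim
      case (elim z)
      then have "\<bar>(h z - h (f x)) / (z - f x)\<bar> \<le> \<bar>D\<bar> + d"
        unfolding dist_real_def by linarith
      then show ?case using elim by (simp add: abs_divide divide_le_eq)
    qed
  qed
  \<comment> \<open>The centre has to be included, since f y may equal f x for y arbitrarily close
    to x.\<close>
  then have "eventually (\<lambda>z. \<bar>h z - h (f x)\<bar> \<le> (\<bar>D\<bar> + d) * \<bar>z - f x\<bar>) (nhds (f x))"
    by (auto simp: eventually_at_filter elim: eventually_mono)
  moreover have "(f \<longlongrightarrow> f x) (at x)"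
    using lipschitz_on_continuous_on[OF f] by (simp add: continuous_on_def)
  ultimately have "eventually (\<lambda>y. \<bar>h (f y) - h (f x)\<bar> \<le> (\<bar>D\<bar> + d) * \<bar>f y - f x\<bar>) (at x)"
    by (rule eventually_compose_filterlim)
  with lip_eventually[OF f d(1), of x]
  show "eventually (\<lambda>y. \<bar>h (f y) - h (f x)\<bar> \<le> (\<bar>D\<bar> * lip f x + e) * dist x y) (at x)"
  proof eventually_elim
    case (elim y)
    have "\<bar>h (f y) - h (f x)\<bar> \<le> (\<bar>D\<bar> + d) * ((l + d) * dist x y)"
      using order_trans[OF elim(2) mult_left_mono[OF elim(1)]] d(1) by (simp add: l_def)
    also have "\<dots> = (\<bar>D\<bar> * l + d * (\<bar>D\<bar> + l + d)) * dist x y"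
      by (simp add: algebra_simps)
    also have "\<dots> \<le> (\<bar>D\<bar> * l + e) * dist x y"
    proof (intro mult_right_mono add_left_mono)
      have "d * (\<bar>D\<bar> + l + d) \<le> d * (2 * (l + 1) + 2 * \<bar>D\<bar> + 2)"
        using d l by (intro mult_left_mono) auto
      with d3 show "d * (\<bar>D\<bar> + l + d) \<le> e" by simp
    qed simp
    finally show ?case by (simp add: l_def)
  qed
qed

text \<open>For fixed y, being at distance at least 1 / Suc n from y or satisfying the Lipschitz
  bound at y are both closed conditions on x. Hence the sets \<open>C n c\<close> are closed, and
  sublevel sets of \<open>lip f\<close> are countable intersections of countable unions of
  them.\<close>

lemma lip_borel_measurable [measurable]:
  assumes f: "L-lipschitz_on UNIV f"
  shows "lip f \<in> borel_measurable borel"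
proof (subst borel_measurable_iff_le, intro allI)
  fix b :: real
  define C where "C n c = {x. \<forall>y. dist x y < 1 / Suc n \<longrightarrow> \<bar>f y - f x\<bar> \<le> c * dist x y}" for n c
  have contf: "continuous_on UNIV f" using f by (rule lipschitz_on_continuous_on)
  have "closed (C n c)" for n c
  proof -
    have "C n c = (\<Inter>y. {x. dist x y \<ge> 1 / Suc n} \<union> {x. \<bar>f y - f x\<bar> \<le> c * dist x y})"
      unfolding C_def by (auto simp del: of_nat_Suc simp: not_less[symmetric])
    also have "closed \<dots>"
      by (intro closed_INT ballI closed_Un closed_Collect_le continuous_intros contf)
    finally show ?thesis .
  qed
  then have C [measurable]: "C n c \<in> sets borel" for n c by auto
  have "{x \<in> space borel. lip f x \<le> b} = (if b \<ge> 0 then (\<Inter>k. \<Union>n. C n (b + 1 / Suc k)) else {})"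
  proof (cases "b \<ge> 0")
    case True
    have "lip f x \<le> b \<longleftrightarrow> (\<forall>k. \<exists>n. x \<in> C n (b + 1 / Suc k))" for x
    proof
      assume le: "lip f x \<le> b"
      show "\<forall>k. \<exists>n. x \<in> C n (b + 1 / Suc k)"
      proof
        fix k
        have "eventually (\<lambda>y. \<bar>f y - f x\<bar> \<le> (lip f x + 1 / Suc k) * dist x y) (at x)"
          by (rule lip_eventually[OF f]) simp
        then obtain d where d: "d > 0"
          "\<And>y. y \<noteq> x \<Longrightarrow> dist y x < d \<Longrightarrow> \<bar>f y - f x\<bar> \<le> (lip f x + 1 / Suc k) * dist x y"
          unfolding eventually_at by auto
        obtain n where n: "1 / Suc n < d" using d(1) nat_approx_posE by blast
        have "x \<in> C n (b + 1 / Suc k)"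
          unfolding C_def
        proof (intro CollectI allI impI)
          fix y assume y: "dist x y < 1 / Suc n"
          show "\<bar>f y - f x\<bar> \<le> (b + 1 / Suc k) * dist x y"
          proof (cases "y = x")
            case False
            then have "\<bar>f y - f x\<bar> \<le> (lip f x + 1 / Suc k) * dist x y"
              using y n by (intro d(2)) (auto simp: dist_commute)
            also have "\<dots> \<le> (b + 1 / Suc k) * dist x y"
              using le by (intro mult_right_mono) auto
            finally show ?thesis .
          qed simp
        qed
        then show "\<exists>n. x \<in> C n (b + 1 / Suc k)" ..
      qed
    next
      assume *: "\<forall>k. \<exists>n. x \<in> C n (b + 1 / Suc k)"
      show "lip f x \<le> b"
      proof (rule lip_le[OF _ True])
        fix e :: real assume "e > 0"
        then obtain k where k: "1 / Suc k < e" using nat_approx_posE by blast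
        from * obtain n where n: "x \<in> C n (b + 1 / Suc k)" by blast
        have "eventually (\<lambda>y. dist y x < 1 / Suc n) (at x)"
          unfolding eventually_at by (intro exI[of _ "1 / Suc n"]) auto
        then show "eventually (\<lambda>y. \<bar>f y - f x\<bar> \<le> (b + e) * dist x y) (at x)"
        proof eventually_elim
          case (elim y)
          then have "\<bar>f y - f x\<bar> \<le> (b + 1 / Suc k) * dist x y"
            using n by (simp add: C_def dist_commute[of y x])
          also have "\<dots> \<le> (b + e) * dist x y"
            using k by (intro mult_right_mono) auto
          finally show ?case .
        qed
      qed
    qed
    with True show ?thesis by auto
  next
    case False
    then show ?thesis using order_trans[OF lip_nonneg] by force
  qed
  also have "\<dots> \<in> sets borel" by auto
  finally show "{x \<in> space borel. lip f x \<le> b} \<in> sets borel" .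
qed

lemma LIP_midpoint:
  "f \<in> LIP \<Longrightarrow> g \<in> LIP \<Longrightarrow> (\<lambda>x. (f x + g x) / 2) \<in> LIP"
  unfolding LIP_def
proof clarify
  fix L M assume "L-lipschitz_on UNIV f" "M-lipschitz_on UNIV g"
  then have "(\<bar>1/2\<bar> * (L + M))-lipschitz_on UNIV (\<lambda>x. (1/2) * (f x + g x))"
    by (intro lipschitz_intros)
  then show "\<exists>L. L-lipschitz_on UNIV (\<lambda>x. (f x + g x) / 2)" by (auto simp: mult.commute)
qed

lemma LIP_borel_measurable: "f \<in> LIP \<Longrightarrow> f \<in> borel_measurable borel"
  unfolding LIP_def using borel_measurable_continuous_onI lipschitz_on_continuous_on by blast

section \<open>Uniform convexity and completeness of \<open>L\<^sup>p\<close>\<close>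

text \<open>A substitute for Minkowski's inequality on p-th powers, without roots. Either b is at
  most t a, and (1 + t) powr p = 1 + e absorbs it, or a is at most b / t. The leading factor can be
  taken as close to 1 as desired, so constants survive in the limit.\<close>

lemma powr_add_le:
  fixes p e :: real
  assumes p: "p > 0" and e: "e > 0"
  obtains K where "K > 0" "\<And>a b. 0 \<le> a \<Longrightarrow> 0 \<le> b \<Longrightarrow> (a + b) powr p \<le> (1 + e) * a powr p + K * b powr p"
proof
  define t where "t = (1 + e) powr (1 / p) - 1"
  have t: "t > 0"
    using p e by (simp add: t_def)
  have t1: "(1 + t) powr p = 1 + e"
    using p e by (simp add: t_def powr_powr)
  have "1 + 1 / t > 0" using t by (simp add: add_pos_pos)
  then show "(1 + 1 / t) powr p > 0" by simp
  fix a b :: real assume ab: "0 \<le> a" "0 \<le> b"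
  show "(a + b) powr p \<le> (1 + e) * a powr p + (1 + 1 / t) powr p * b powr p"
  proof (cases "b \<le> t * a")
    case True
    then have "(a + b) powr p \<le> ((1 + t) * a) powr p"
      using ab p by (intro powr_mono2) (auto simp: algebra_simps)
    also have "\<dots> = (1 + e) * a powr p"
      using ab t by (simp add: powr_mult t1)
    finally show ?thesis by (simp add: add_increasing2)
  next
    case False
    then have "(a + b) powr p \<le> ((1 + 1 / t) * b) powr p"
      using ab p t by (intro powr_mono2) (auto simp: field_simps)
    also have "\<dots> = (1 + 1 / t) powr p * b powr p"
      using ab t by (simp add: powr_mult)
    finally show ?thesis using e by (simp add: add_increasing)
  qed
qed

text \<open>The defect vanishes at s = 1 and is strictly decreasing before it, because the midpoint
  of x and 1 exceeds x.\<close>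

lemma powr_midpoint_strict:
  fixes p s :: real
  assumes p: "p > 1" and s: "0 \<le> s" "s < 1"
  shows "((1 + s) / 2) powr p < (1 + s powr p) / 2"
proof -
  define F where "F x = (1 + x powr p) / 2 - ((1 + x) / 2) powr p" for x :: real
  have "F 1 < F s"
  proof (rule DERIV_neg_imp_decreasing_open[OF s(2)])
    fix x assume x: "s < x" "x < 1"
    then have x0: "x > 0" using s by simp
    have "(F has_real_derivative (p * x powr (p - 1)) / 2 - p * ((1 + x) / 2) powr (p - 1) * (1 / 2)) (at x)"
      unfolding F_def using x0
      by (auto intro!: derivative_eq_intros)
    moreover have "x powr (p - 1) < ((1 + x) / 2) powr (p - 1)"
      using x x0 p by (intro powr_less_mono2) auto
    then have "(p * x powr (p - 1)) / 2 - p * ((1 + x) / 2) powr (p - 1) * (1 / 2) < 0"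
      using p by simp
    ultimately show "\<exists>y. (F has_real_derivative y) (at x) \<and> y < 0" by blast
  next
    show "continuous_on {s..1} F"
      unfolding F_def using s p by (intro continuous_intros continuous_on_powr') auto
  qed
  then show ?thesis by (simp add: F_def)
qed

text \<open>The quantitative form of uniform convexity of \<open>L\<^sup>p\<close>; by homogeneity a compactness argument on
  an interval suffices.\<close>

lemma powr_uniformly_convex:
  fixes p e :: real
  assumes p: "p > 1" and e: "e > 0"
  obtains K where "K > 0" "\<And>a b. 0 \<le> a \<Longrightarrow> 0 \<le> b \<Longrightarrow>
    \<bar>a - b\<bar> powr p \<le> e * (a powr p + b powr p) + K * ((a powr p + b powr p) / 2 - ((a + b) / 2) powr p)"
proof -
  define F where "F x = (1 + x powr p) / 2 - ((1 + x) / 2) powr p" for x :: real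
  \<comment> \<open>With s = a / b: if s > 1 - t, then (1 - s) powr p is at most t powr p and the
    e-term absorbs it. On the remaining interval the convexity defect has a positive minimum d, and
    2 / d times the defect is at least 1.\<close>
  define t where "t = min 1 (e powr (1 / p))"
  have t: "t > 0" "t \<le> 1" using e by (auto simp: t_def)
  have tp: "t powr p \<le> e"
  proof -
    have "t powr p \<le> (e powr (1 / p)) powr p"
      using t p by (intro powr_mono2) (auto simp: t_def)
    then show ?thesis using p e by (simp add: powr_powr)
  qed
  have contF: "continuous_on {0..1 - t} F"
    unfolding F_def using p by (intro continuous_intros continuous_on_powr') auto
  obtain x where x: "x \<in> {0..1 - t}" "\<And>y. y \<in> {0..1 - t} \<Longrightarrow> F x \<le> F y"
    using continuous_attains_inf[OF compact_Icc _ contF] t by auto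
  define d where "d = F x"
  have d: "d > 0"
    using powr_midpoint_strict[OF p, of x] x(1) t by (simp add: d_def F_def)
  have F_nonneg: "F s \<ge> 0" if "0 \<le> s" "s \<le> 1" for s
    using powr_midpoint_strict[OF p, of s] that by (cases "s = 1") (auto simp: F_def)
  have main: "\<bar>a - b\<bar> powr p \<le> e * (a powr p + b powr p)
      + 2 / d * ((a powr p + b powr p) / 2 - ((a + b) / 2) powr p)"
    if ab: "0 \<le> a" "a \<le> b" for a b
  proof (cases "b = 0")
    case True
    then show ?thesis using ab by simp
  next
    case False
    with ab have b: "b > 0" by simp
    define s where "s = a / b"
    have s: "0 \<le> s" "s \<le> 1" "a = s * b" using ab b by (auto simp: s_def)
    have eqs: "a powr p = s powr p * b powr p" "\<bar>a - b\<bar> powr p = (1 - s) powr p * b powr p"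
      "((a + b) / 2) powr p = ((1 + s) / 2) powr p * b powr p"
    proof -
      show "a powr p = s powr p * b powr p" using s b by (simp add: powr_mult)
      have "\<bar>a - b\<bar> = (1 - s) * b" using s b ab by (simp add: algebra_simps)
      then show "\<bar>a - b\<bar> powr p = (1 - s) powr p * b powr p" using s b by (simp add: powr_mult)
      have "(a + b) / 2 = ((1 + s) / 2) * b" using s by (simp add: algebra_simps)
      then show "((a + b) / 2) powr p = ((1 + s) / 2) powr p * b powr p"
        using s b by (simp only: powr_mult)
    qed
    have "(1 - s) powr p \<le> e * (1 + s powr p) + 2 / d * F s"
    proof (cases "s \<le> 1 - t")
      case True
      then have "d \<le> F s" using x(2) s by (simp add: d_def)
      have "(1 - s) powr p \<le> 1 powr p" using s p by (intro powr_mono2) auto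
      also have "\<dots> \<le> 2 / d * F s" using \<open>d \<le> F s\<close> d by (simp add: field_simps)
      finally show ?thesis using e by (simp add: add_increasing)
    next
      case False
      then have "(1 - s) powr p \<le> t powr p" using s p by (intro powr_mono2) auto
      also have "\<dots> \<le> e * (1 + s powr p)" using tp e by (simp add: algebra_simps add_increasing2)
      finally show ?thesis using d F_nonneg[OF s(1,2)] by (simp add: add_increasing2)
    qed
    then have "(1 - s) powr p * b powr p \<le> (e * (1 + s powr p) + 2 / d * F s) * b powr p"
      by (intro mult_right_mono) auto
    also have "\<dots> = e * (s powr p * b powr p + b powr p)
      + 2 / d * ((s powr p * b powr p + b powr p) / 2 - ((1 + s) / 2) powr p * b powr p)"
      unfolding F_def using d by (simp add: field_simps)
    finally show ?thesis unfolding eqs .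
  qed
  show ?thesis
  proof
    show "2 / d > 0" using d by simp
    show "\<bar>a - b\<bar> powr p \<le> e * (a powr p + b powr p)
        + 2 / d * ((a powr p + b powr p) / 2 - ((a + b) / 2) powr p)"
      if "0 \<le> a" "0 \<le> b" for a b
      using main[of a b] main[of b a] that by (cases "a \<le> b") (auto simp: add.commute abs_minus_commute)
  qed
qed

section \<open>Convergence and completeness in L^p in terms of integrals of p-th powers\<close>

lemma nn_integral_powr_eq:
  assumes "f \<in> Lp M p"
  shows "(\<integral>\<^sup>+x. ennreal (\<bar>f x\<bar> powr p) \<partial>M) = ennreal (\<integral>x. \<bar>f x\<bar> powr p \<partial>M)"
  using assms by (intro nn_integral_eq_integral) (auto simp: Lp_def)

lemma Lp_of_nn_integral:
  assumes "f \<in> borel_measurable M" "(\<integral>\<^sup>+x. ennreal (\<bar>f x\<bar> powr p) \<partial>M) < \<infinity>"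
  shows "f \<in> Lp M p"
  unfolding Lp_def
proof (intro CollectI conjI integrableI_bounded)
  show "f \<in> borel_measurable M" by fact
  with assms(1) show "(\<lambda>x. \<bar>f x\<bar> powr p) \<in> borel_measurable M" by measurable
qed (use assms(2) in simp)

lemma Lp_bounded_by_sum:
  assumes f: "f \<in> Lp M p" and g: "g \<in> Lp M p" and p: "p > 0"
    and h: "h \<in> borel_measurable M" "AE x in M. \<bar>h x\<bar> \<le> \<bar>f x\<bar> + \<bar>g x\<bar>"
  shows "h \<in> Lp M p"
proof -
  obtain K where K: "K > 0" "\<And>a b. 0 \<le> a \<Longrightarrow> 0 \<le> b \<Longrightarrow> (a + b) powr p \<le> (1 + 1) * a powr p + K * b powr p"
    using powr_add_le[OF p, of 1] by auto
  have "integrable M (\<lambda>x. \<bar>h x\<bar> powr p)"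
  proof (rule Bochner_Integration.integrable_bound)
    show "integrable M (\<lambda>x. (1 + 1) * \<bar>f x\<bar> powr p + K * \<bar>g x\<bar> powr p)"
      using f g by (auto simp: Lp_def)
    show "(\<lambda>x. \<bar>h x\<bar> powr p) \<in> borel_measurable M" using h(1) by measurable
    show "AE x in M. norm (\<bar>h x\<bar> powr p) \<le> norm ((1 + 1) * \<bar>f x\<bar> powr p + K * \<bar>g x\<bar> powr p)"
      using h(2)
    proof eventually_elim
      case (elim x)
      have "\<bar>h x\<bar> powr p \<le> (\<bar>f x\<bar> + \<bar>g x\<bar>) powr p"
        using elim p by (intro powr_mono2) auto
      also have "\<dots> \<le> (1 + 1) * \<bar>f x\<bar> powr p + K * \<bar>g x\<bar> powr p"
        by (intro K(2)) auto
      finally show ?case by simp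
    qed
  qed
  with h(1) show ?thesis by (simp add: Lp_def)
qed

lemma Lp_diff: "f \<in> Lp M p \<Longrightarrow> g \<in> Lp M p \<Longrightarrow> p > 0 \<Longrightarrow> (\<lambda>x. f x - g x) \<in> Lp M p"
  by (rule Lp_bounded_by_sum[of f _ _ g]) (auto simp: Lp_def)

lemma Lp_midpoint: "f \<in> Lp M p \<Longrightarrow> g \<in> Lp M p \<Longrightarrow> p > 0 \<Longrightarrow> (\<lambda>x. (f x + g x) / 2) \<in> Lp M p"
  by (rule Lp_bounded_by_sum[of f _ _ g]) (auto simp: Lp_def)

lemma nn_integral_Lp_triangle:
  assumes p: "p > 0" and K: "\<And>a b. 0 \<le> a \<Longrightarrow> 0 \<le> b \<Longrightarrow> (a + b) powr p \<le> (1 + e) * a powr p + K * b powr p"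
    and e: "e > 0" "K > 0"
    and [measurable]: "f \<in> borel_measurable M" "g \<in> borel_measurable M"
  shows "(\<integral>\<^sup>+x. ennreal (\<bar>f x\<bar> powr p) \<partial>M)
     \<le> ennreal (1 + e) * (\<integral>\<^sup>+x. ennreal (\<bar>g x\<bar> powr p) \<partial>M) + ennreal K * (\<integral>\<^sup>+x. ennreal (\<bar>f x - g x\<bar> powr p) \<partial>M)"
proof -
  have "(\<integral>\<^sup>+x. ennreal (\<bar>f x\<bar> powr p) \<partial>M)
     \<le> (\<integral>\<^sup>+x. ennreal (1 + e) * ennreal (\<bar>g x\<bar> powr p) + ennreal K * ennreal (\<bar>f x - g x\<bar> powr p) \<partial>M)"
  proof (rule nn_integral_mono)
    fix x
    have "\<bar>f x\<bar> powr p \<le> (\<bar>g x\<bar> + \<bar>f x - g x\<bar>) powr p"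
      using p by (intro powr_mono2) auto
    also have "\<dots> \<le> (1 + e) * \<bar>g x\<bar> powr p + K * \<bar>f x - g x\<bar> powr p"
      by (intro K) auto
    finally show "ennreal (\<bar>f x\<bar> powr p) \<le> ennreal (1 + e) * ennreal (\<bar>g x\<bar> powr p) + ennreal K * ennreal (\<bar>f x - g x\<bar> powr p)"
      using e by (simp add: ennreal_mult[symmetric] ennreal_plus[symmetric] ennreal_leI del: ennreal_plus)
  qed
  also have "\<dots> = ennreal (1 + e) * (\<integral>\<^sup>+x. ennreal (\<bar>g x\<bar> powr p) \<partial>M) + ennreal K * (\<integral>\<^sup>+x. ennreal (\<bar>f x - g x\<bar> powr p) \<partial>M)"
    by (simp add: nn_integral_add nn_integral_cmult)
  finally show ?thesis .
qed

text \<open>The triangle inequality with factor 1 + e is applied in both directions, to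
  \<open>a n\<close> against G and to G against \<open>a n\<close>.\<close>

lemma Lp_tendsto_integral:
  assumes a: "\<And>n. a n \<in> Lp M p" and G: "G \<in> Lp M p" and p: "p > 0" and lim: "Lp_tendsto M p a G"
  shows "(\<lambda>n. \<integral>x. \<bar>a n x\<bar> powr p \<partial>M) \<longlonglongrightarrow> (\<integral>x. \<bar>G x\<bar> powr p \<partial>M)"
proof (rule LIMSEQ_I)
  fix r :: real assume r: "r > 0"
  define A where "A n = (\<integral>x. \<bar>a n x\<bar> powr p \<partial>M)" for n
  define D where "D n = (\<integral>x. \<bar>a n x - G x\<bar> powr p \<partial>M)" for n
  define B where "B = (\<integral>x. \<bar>G x\<bar> powr p \<partial>M)"
  have AB: "A n \<ge> 0" "B \<ge> 0" "D n \<ge> 0" for n by (auto simp: A_def B_def D_def)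
  have D: "D \<longlonglongrightarrow> 0"
  proof -
    have "(\<lambda>n. ennreal (D n)) \<longlonglongrightarrow> ennreal 0"
      using lim nn_integral_powr_eq[OF Lp_diff[OF a G p]] by (simp add: Lp_tendsto_def D_def)
    then show ?thesis using AB(3) by (subst (asm) tendsto_ennreal_iff) auto
  qed
  \<comment> \<open>The second direction produces e times the integral of \<open>a n\<close>, which
    is not bounded beforehand. The first direction bounds that integral by B + r / 2, so e is chosen
    small against B + r + 1.\<close>
  define e where "e = min 1 (r / (4 * (B + r + 1)))"
  have e: "e > 0" "e \<le> 1" using r AB by (auto simp: e_def)
  have e2: "e * (B + r + 1) \<le> r / 4"
  proof -
    have "e \<le> r / (4 * (B + r + 1))" by (simp add: e_def)
    moreover have "B + r + 1 > 0" using r AB by (simp add: add_nonneg_pos)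
    ultimately show ?thesis by (simp add: field_simps)
  qed
  obtain K where K: "K > 0" "\<And>a b. 0 \<le> a \<Longrightarrow> 0 \<le> b \<Longrightarrow> (a + b) powr p \<le> (1 + e) * a powr p + K * b powr p"
    using powr_add_le[OF p e(1)] by blast
  have meas: "a n \<in> borel_measurable M" "G \<in> borel_measurable M" for n using a G by (auto simp: Lp_def)
  have nn: "(\<integral>\<^sup>+x. ennreal (\<bar>a n x\<bar> powr p) \<partial>M) = ennreal (A n)"
    "(\<integral>\<^sup>+x. ennreal (\<bar>G x\<bar> powr p) \<partial>M) = ennreal B"
    "(\<integral>\<^sup>+x. ennreal (\<bar>a n x - G x\<bar> powr p) \<partial>M) = ennreal (D n)"
    "(\<integral>\<^sup>+x. ennreal (\<bar>G x - a n x\<bar> powr p) \<partial>M) = ennreal (D n)" for n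
    unfolding A_def B_def D_def using nn_integral_powr_eq[OF a[of n]] nn_integral_powr_eq[OF G]
      nn_integral_powr_eq[OF Lp_diff[OF a[of n] G p]]
    by (auto simp: abs_minus_commute)
  have 1: "A n \<le> (1 + e) * B + K * D n" for n
    using nn_integral_Lp_triangle[OF p K(2) e(1) K(1) meas(1)[of n] meas(2)] e AB K(1)
    unfolding nn by (simp add: ennreal_mult[symmetric] ennreal_plus[symmetric] del: ennreal_plus)
  have 2: "B \<le> (1 + e) * A n + K * D n" for n
    using nn_integral_Lp_triangle[OF p K(2) e(1) K(1) meas(2) meas(1)[of n]] e AB K(1)
    unfolding nn by (simp add: ennreal_mult[symmetric] ennreal_plus[symmetric] del: ennreal_plus)
  have "(\<lambda>n. K * D n) \<longlonglongrightarrow> K * 0" using D by (intro tendsto_intros)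
  then have "eventually (\<lambda>n. K * D n < r / 4) sequentially"
    using r by (intro order_tendstoD) auto
  then obtain n0 where n0: "\<And>n. n \<ge> n0 \<Longrightarrow> K * D n < r / 4"
    by (auto simp: eventually_sequentially)
  have "norm (A n - B) < r" if "n \<ge> n0" for n
  proof -
    have "A n \<le> B + e * B + r / 4" using 1[of n] n0[OF that] by (simp add: algebra_simps)
    moreover have "e * B \<le> r / 4"
      using order_trans[OF mult_left_mono[of B "B + r + 1" e] e2] e r by simp
    ultimately have A: "A n \<le> B + r / 2" by simp
    have "e * A n \<le> e * (B + r + 1)" using A e r by (intro mult_left_mono) auto
    with e2 have "B \<le> A n + r / 4 + r / 4" using 2[of n] n0[OF that] by (simp add: algebra_simps)
    with A r show ?thesis by (simp add: abs_less_iff)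
  qed
  then show "\<exists>no. \<forall>n\<ge>no. norm ((\<integral>x. \<bar>a n x\<bar> powr p \<partial>M) - (\<integral>x. \<bar>G x\<bar> powr p \<partial>M)) < r"
    unfolding A_def B_def by blast
qed

lemma Lp_complete:
  fixes a :: "nat \<Rightarrow> 'a \<Rightarrow> real"
  assumes a: "\<And>n. a n \<in> Lp M p" and p: "p > 0" and nonneg: "\<And>n x. 0 \<le> a n x"
    and Cauchy: "\<And>e. e > 0 \<Longrightarrow> \<exists>n0. \<forall>i\<ge>n0. \<forall>j\<ge>n0. (\<integral>x. \<bar>a i x - a j x\<bar> powr p \<partial>M) \<le> e"
  shows "\<exists>G\<in>Lp M p. (\<forall>x. 0 \<le> G x) \<and> Lp_tendsto M p a G"
proof -
  have [measurable]: "a n \<in> borel_measurable M" for n using a by (auto simp: Lp_def)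
  have nn: "(\<integral>\<^sup>+x. ennreal (\<bar>a i x - a j x\<bar> powr p) \<partial>M) = ennreal (\<integral>x. \<bar>a i x - a j x\<bar> powr p \<partial>M)" for i j
    using nn_integral_powr_eq[OF Lp_diff[OF a[of i] a[of j] p]] .
  \<comment> \<open>The extra power of 2 leaves room for the weight 2 powr (k p): the weighted
    integrals are still summable, and finiteness of the weighted sum at a point forces geometric
    decay of the increments there.\<close>
  define q where "q k = 2 powr (- real k * (p + 1))" for k :: nat
  have "\<exists>n0. \<forall>i\<ge>n0. \<forall>j\<ge>n0. (\<integral>x. \<bar>a i x - a j x\<bar> powr p \<partial>M) \<le> q k" for k
    by (rule Cauchy) (simp add: q_def)
  then obtain n0 where n0: "\<And>k i j. i \<ge> n0 k \<Longrightarrow> j \<ge> n0 k \<Longrightarrow> (\<integral>x. \<bar>a i x - a j x\<bar> powr p \<partial>M) \<le> q k"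
    by metis
  define r where "r = rec_nat (n0 0) (\<lambda>k i. max (n0 (Suc k)) (Suc i))"
  have r_Suc: "r (Suc k) = max (n0 (Suc k)) (Suc (r k))" for k by (simp add: r_def)
  have r: "strict_mono r" by (rule strict_monoI_Suc) (simp add: r_Suc)
  have r_ge: "r k \<ge> n0 k" for k by (cases k) (auto simp: r_Suc, simp add: r_def)
  define d where "d k x = \<bar>a (r (Suc k)) x - a (r k) x\<bar>" for k x
  have "(\<integral>\<^sup>+x. (\<Sum>k. ennreal (2 powr (real k * p) * d k x powr p)) \<partial>M)
      = (\<Sum>k. \<integral>\<^sup>+x. ennreal (2 powr (real k * p) * d k x powr p) \<partial>M)"
    unfolding d_def by (rule nn_integral_suminf) measurable
  also have "\<dots> \<le> (\<Sum>k. ennreal ((1/2) ^ k))"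
  proof (rule suminf_le)
    fix k
    have "(\<integral>\<^sup>+x. ennreal (2 powr (real k * p) * d k x powr p) \<partial>M)
       = ennreal (2 powr (real k * p)) * (\<integral>\<^sup>+x. ennreal (d k x powr p) \<partial>M)"
      unfolding d_def by (simp add: ennreal_mult nn_integral_cmult)
    also have "\<dots> \<le> ennreal (2 powr (real k * p)) * ennreal (q k)"
    proof (intro mult_left_mono)
      have "r (Suc k) \<ge> n0 k" using r_ge[of k] strict_monoD[OF r, of k "Suc k"] by simp
      then show "(\<integral>\<^sup>+x. ennreal (d k x powr p) \<partial>M) \<le> ennreal (q k)"
        unfolding d_def nn using r_ge[of k] by (intro ennreal_leI n0) auto
    qed simp
    also have "\<dots> = ennreal ((1/2) ^ k)"
    proof -
      have "2 powr (real k * p) * q k = 2 powr (- real k)"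
        by (simp add: q_def powr_add[symmetric] algebra_simps)
      also have "\<dots> = (1/2) ^ k"
        by (simp add: powr_minus powr_realpow power_one_over inverse_eq_divide)
      finally show ?thesis by (simp add: q_def ennreal_mult[symmetric])
    qed
    finally show "(\<integral>\<^sup>+x. ennreal (2 powr (real k * p) * d k x powr p) \<partial>M) \<le> ennreal ((1/2) ^ k)" .
  qed auto
  also have "\<dots> = ennreal (\<Sum>k. (1/2) ^ k)"
    by (intro suminf_ennreal2) (auto intro: summable_geometric)
  also have "\<dots> < \<infinity>" by simp
  finally have "AE x in M. (\<Sum>k. ennreal (2 powr (real k * p) * d k x powr p)) \<noteq> \<infinity>"
    by (intro nn_integral_noteq_infinite) (auto simp: d_def)
  then have conv: "AE x in M. convergent (\<lambda>k. a (r k) x)"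
  proof eventually_elim
    case (elim x)
    define S where "S = (\<Sum>k. ennreal (2 powr (real k * p) * d k x powr p))"
    obtain s where s: "S = ennreal s" "s \<ge> 0" using elim by (cases S) (auto simp: S_def)
    have d0: "d k x \<ge> 0" for k by (simp add: d_def)
    have bd: "d k x \<le> s powr (1 / p) * (1/2) ^ k" for k
    proof -
      have "sum (\<lambda>k. ennreal (2 powr (real k * p) * d k x powr p)) {k} \<le> S"
        unfolding S_def by (rule sum_le_suminf) auto
      then have "2 powr (real k * p) * d k x powr p \<le> s" using s by (simp del: ennreal_mult'')
      then have "(2 powr real k * d k x) powr p \<le> s"
        using d0 by (simp add: powr_mult powr_powr)
      then have "((2 powr real k * d k x) powr p) powr (1 / p) \<le> s powr (1 / p)"
        using p by (intro powr_mono2) auto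
      then have "2 powr real k * d k x \<le> s powr (1 / p)"
        using d0 p by (simp add: powr_powr)
      then show ?thesis by (simp add: powr_realpow field_simps)
    qed
    have "summable (\<lambda>k. s powr (1 / p) * (1/2::real) ^ k)"
      by (intro summable_mult summable_geometric) simp
    then have "summable (\<lambda>k. a (r (Suc k)) x - a (r k) x)"
      by (rule summable_comparison_test'[where N = 0]) (use bd in \<open>simp add: d_def\<close>)
    then have "convergent (\<lambda>n. (\<Sum>k<n. a (r (Suc k)) x - a (r k) x))"
      by (simp add: summable_iff_convergent)
    then have "convergent (\<lambda>n. (a (r n) x - a (r 0) x) + a (r 0) x)"
      unfolding sum_lessThan_telescope[of "\<lambda>k. a (r k) x"] by (intro convergent_add convergent_const)
    then show ?case by simp
  qed
  \<comment> \<open>The absolute value makes G nonnegative at every point, also where the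
    subsequence diverges and \<open>lim\<close> is arbitrary.\<close>
  define G where "G x = \<bar>lim (\<lambda>k. a (r k) x)\<bar>" for x
  have [measurable]: "G \<in> borel_measurable M"
    unfolding G_def by (intro borel_measurable_abs borel_measurable_lim_metric) measurable
  have Glim: "AE x in M. (\<lambda>k. a (r k) x) \<longlonglongrightarrow> G x"
    using conv
  proof eventually_elim
    case (elim x)
    then have l: "(\<lambda>k. a (r k) x) \<longlonglongrightarrow> lim (\<lambda>k. a (r k) x)" by (simp add: convergent_LIMSEQ_iff)
    moreover have "lim (\<lambda>k. a (r k) x) \<ge> 0" using l by (rule LIMSEQ_le_const) (auto simp: nonneg)
    ultimately show ?case using elim by (simp add: G_def)
  qed
  \<comment> \<open>Fatou along the subsequence with i fixed: the Cauchy bound between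
    \<open>a i\<close> and \<open>a (r k)\<close> passes to G, hence holds for the whole
    sequence.\<close>
  have conv_e: "\<exists>m0. \<forall>i\<ge>m0. (\<integral>\<^sup>+x. ennreal (\<bar>a i x - G x\<bar> powr p) \<partial>M) \<le> ennreal e" if "e > 0" for e
  proof -
    obtain m0 where m0: "\<And>i j. i \<ge> m0 \<Longrightarrow> j \<ge> m0 \<Longrightarrow> (\<integral>x. \<bar>a i x - a j x\<bar> powr p \<partial>M) \<le> e"
      using Cauchy[OF \<open>e > 0\<close>] by blast
    have "(\<integral>\<^sup>+x. ennreal (\<bar>a i x - G x\<bar> powr p) \<partial>M) \<le> ennreal e" if "i \<ge> m0" for i
    proof -
      have "(\<integral>\<^sup>+x. ennreal (\<bar>a i x - G x\<bar> powr p) \<partial>M)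
        = (\<integral>\<^sup>+x. liminf (\<lambda>k. ennreal (\<bar>a i x - a (r k) x\<bar> powr p)) \<partial>M)"
      proof (rule nn_integral_cong_AE)
        show "AE x in M. ennreal (\<bar>a i x - G x\<bar> powr p) = liminf (\<lambda>k. ennreal (\<bar>a i x - a (r k) x\<bar> powr p))"
          using Glim
        proof eventually_elim
          case (elim x)
          have "(\<lambda>k. ennreal (\<bar>a i x - a (r k) x\<bar> powr p)) \<longlonglongrightarrow> ennreal (\<bar>a i x - G x\<bar> powr p)"
            using p elim by (intro tendsto_intros) auto
          then show ?case by (intro lim_imp_Liminf[symmetric]) auto
        qed
      qed
      also have "\<dots> \<le> liminf (\<lambda>k. \<integral>\<^sup>+x. ennreal (\<bar>a i x - a (r k) x\<bar> powr p) \<partial>M)"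
        by (rule nn_integral_liminf) measurable
      also have "\<dots> \<le> limsup (\<lambda>k. \<integral>\<^sup>+x. ennreal (\<bar>a i x - a (r k) x\<bar> powr p) \<partial>M)"
        by (rule Liminf_le_Limsup) simp
      also have "\<dots> \<le> ennreal e"
      proof (rule Limsup_bounded)
        have "r k \<ge> m0" if "k \<ge> m0" for k using seq_suble[OF r, of k] that by simp
        then show "eventually (\<lambda>k. (\<integral>\<^sup>+x. ennreal (\<bar>a i x - a (r k) x\<bar> powr p) \<partial>M) \<le> ennreal e) sequentially"
          unfolding nn using m0 \<open>i \<ge> m0\<close> by (intro eventually_sequentiallyI[of m0] ennreal_leI) auto
      qed
      finally show ?thesis .
    qed
    then show ?thesis by blast
  qed
  have lim: "Lp_tendsto M p a G"
    unfolding Lp_tendsto_def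
  proof (rule order_tendstoI)
    fix c :: ennreal assume "0 < c"
    then obtain z where z: "0 < z" "z < c" using dense by blast
    then have "z < top" by (intro order.strict_trans2[OF z(2)]) simp
    then obtain e where "z = ennreal e" "e \<ge> 0" by (cases z) auto
    with z have e: "e > 0" "ennreal e < c" by auto
    from conv_e[OF e(1)] show "eventually (\<lambda>n. (\<integral>\<^sup>+x. ennreal (\<bar>a n x - G x\<bar> powr p) \<partial>M) < c) sequentially"
      using e(2) by (auto simp: eventually_sequentially intro: order.strict_trans1)
  qed auto
  obtain m0 where "\<And>i. i \<ge> m0 \<Longrightarrow> (\<integral>\<^sup>+x. ennreal (\<bar>a i x - G x\<bar> powr p) \<partial>M) \<le> ennreal 1"
    using conv_e[of 1] by auto
  from this[OF order_refl] have "(\<lambda>x. a m0 x - G x) \<in> Lp M p"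
    by (intro Lp_of_nn_integral) (auto intro: order.strict_trans1)
  then have "G \<in> Lp M p"
    by (rule Lp_bounded_by_sum[OF _ a[of m0] p]) auto
  moreover have "0 \<le> G x" for x by (simp add: G_def)
  ultimately show ?thesis using lim by blast
qed

section \<open>Existence of the minimal weak upper gradient\<close>

lemma Cheeger_energy_le:
  assumes "\<And>n. fs n \<in> Lp m p \<inter> LIP" "Lp_tendsto m p fs f"
  shows "Cheeger_energy m p f \<le> liminf (\<lambda>n. \<integral>\<^sup>+x. ennreal (lip (fs n) x powr p) \<partial>m)"
  unfolding Cheeger_energy_def using assms by (intro Inf_lower) auto

lemma Cheeger_energy_le_self:
  assumes "f \<in> Lp m p \<inter> LIP"
  shows "Cheeger_energy m p f \<le> (\<integral>\<^sup>+x. ennreal (lip f x powr p) \<partial>m)"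
proof -
  have "Cheeger_energy m p f \<le> liminf (\<lambda>n::nat. \<integral>\<^sup>+x. ennreal (lip f x powr p) \<partial>m)"
    using assms by (intro Cheeger_energy_le) (auto simp: Lp_tendsto_def)
  then show ?thesis by (simp add: Liminf_const)
qed

text \<open>A lower limit below c gives infinitely many terms with energy below c, while the L^p
  distance is small for all late terms; one common index is enough.\<close>

lemma Cheeger_energy_approx:
  assumes fin: "Cheeger_energy m p f < c" and e: "e > 0"
  shows "\<exists>g \<in> Lp m p \<inter> LIP. (\<integral>\<^sup>+x. ennreal (\<bar>g x - f x\<bar> powr p) \<partial>m) < e \<and>
      (\<integral>\<^sup>+x. ennreal (lip g x powr p) \<partial>m) < c"
proof -
  obtain fs where fs: "\<And>n. fs n \<in> Lp m p \<inter> LIP" "Lp_tendsto m p fs f"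
    and less: "liminf (\<lambda>n. \<integral>\<^sup>+x. ennreal (lip (fs n) x powr p) \<partial>m) < c"
    using fin unfolding Cheeger_energy_def Inf_less_iff by blast
  have "\<not> eventually (\<lambda>n. c \<le> (\<integral>\<^sup>+x. ennreal (lip (fs n) x powr p) \<partial>m)) sequentially"
    using less Liminf_bounded[of c "\<lambda>n. \<integral>\<^sup>+x. ennreal (lip (fs n) x powr p) \<partial>m" sequentially]
    by (auto simp: not_le)
  then have "frequently (\<lambda>n. (\<integral>\<^sup>+x. ennreal (lip (fs n) x powr p) \<partial>m) < c) sequentially"
    by (simp add: frequently_def not_less)
  moreover have "eventually (\<lambda>n. (\<integral>\<^sup>+x. ennreal (\<bar>fs n x - f x\<bar> powr p) \<partial>m) < e) sequentially"
    using fs(2) e unfolding Lp_tendsto_def by (rule order_tendstoD)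
  ultimately have "frequently (\<lambda>n. (\<integral>\<^sup>+x. ennreal (\<bar>fs n x - f x\<bar> powr p) \<partial>m) < e
      \<and> (\<integral>\<^sup>+x. ennreal (lip (fs n) x powr p) \<partial>m) < c) sequentially"
    by (rule frequently_eventually_conj)
  from frequently_ex[OF this] fs(1) show ?thesis by blast
qed

text \<open>Counterexamples at distances 1 / Suc n would form an admissible sequence whose energies
  stay below C - d, against the infimum. The uniform radius is what allows the bound to be applied
  to all midpoints of late terms at once.\<close>

lemma Cheeger_energy_lower_semicontinuous:
  assumes fin: "Cheeger_energy m p f = ennreal C" and d: "d > 0"
  shows "\<exists>e>0. \<forall>g\<in>Lp m p \<inter> LIP. (\<integral>\<^sup>+x. ennreal (\<bar>g x - f x\<bar> powr p) \<partial>m) < ennreal e \<longrightarrow>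
      ennreal (C - d) \<le> (\<integral>\<^sup>+x. ennreal (lip g x powr p) \<partial>m)"
proof (rule ccontr)
  assume neg: "\<not> ?thesis"
  have "\<forall>n. \<exists>g. g \<in> Lp m p \<inter> LIP \<and> (\<integral>\<^sup>+x. ennreal (\<bar>g x - f x\<bar> powr p) \<partial>m) < ennreal (1 / Suc n) \<and>
      (\<integral>\<^sup>+x. ennreal (lip g x powr p) \<partial>m) < ennreal (C - d)"
  proof
    fix n
    have "(1::real) / Suc n > 0" by simp
    with neg show "\<exists>g. g \<in> Lp m p \<inter> LIP \<and> (\<integral>\<^sup>+x. ennreal (\<bar>g x - f x\<bar> powr p) \<partial>m) < ennreal (1 / Suc n) \<and>
      (\<integral>\<^sup>+x. ennreal (lip g x powr p) \<partial>m) < ennreal (C - d)"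
      by (meson not_le)
  qed
  then obtain g where g: "\<And>n. g n \<in> Lp m p \<inter> LIP"
    "\<And>n. (\<integral>\<^sup>+x. ennreal (\<bar>g n x - f x\<bar> powr p) \<partial>m) < ennreal (1 / Suc n)"
    "\<And>n. (\<integral>\<^sup>+x. ennreal (lip (g n) x powr p) \<partial>m) < ennreal (C - d)"
    unfolding choice_iff by blast
  have "Lp_tendsto m p g f"
    unfolding Lp_tendsto_def
  proof (rule tendsto_sandwich[OF _ _ tendsto_const])
    have "(\<lambda>n. ennreal (1 / Suc n)) \<longlonglongrightarrow> ennreal 0"
      using lim_inverse_n' by (intro tendsto_ennrealI LIMSEQ_Suc)
    then show "(\<lambda>n. ennreal (1 / Suc n)) \<longlonglongrightarrow> 0" by simp
  qed (use less_imp_le[OF g(2)] in auto)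
  with g(1) have "ennreal C \<le> liminf (\<lambda>n. \<integral>\<^sup>+x. ennreal (lip (g n) x powr p) \<partial>m)"
    unfolding fin[symmetric] by (rule Cheeger_energy_le)
  also have "\<dots> \<le> limsup (\<lambda>n. \<integral>\<^sup>+x. ennreal (lip (g n) x powr p) \<partial>m)"
    by (rule Liminf_le_Limsup) simp
  also have "\<dots> \<le> ennreal (C - d)"
    using less_imp_le[OF g(3)] by (intro Limsup_bounded) auto
  finally have C: "ennreal C \<le> ennreal (C - d)" .
  \<comment> \<open>\<open>ennreal\<close> truncates negative numbers to 0; an integral strictly
    below \<open>ennreal (C - d)\<close> excludes that case, and only then do C and C - d contradict
    each other.\<close>
  have "C - d > 0"
    using order.strict_trans1[OF _ g(3)[of 0]] ennreal_less_zero_iff by (metis zero_le)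
  with C d show False by simp
qed

text \<open>Along a minimizing sequence the local Lipschitz constants are Cauchy by uniform convexity, since
  midpoints compete in the definition of the Cheeger energy.\<close>

lemma minimal_wug_exists:
  fixes m :: "'a::metric_space measure"
  assumes sets: "sets m = sets borel" and p: "p > 1"
    and u: "u \<in> Lp m p" and fin: "Cheeger_energy m p u < \<infinity>"
  shows "\<exists>G. is_minimal_wug m p u G"
proof -
  have sets': "measurable m borel = measurable borel borel" by (rule measurable_cong_sets[OF sets refl])
  have p0: "p > 0" using p by simp
  obtain C where C: "Cheeger_energy m p u = ennreal C" "C \<ge> 0"
    using fin by (cases "Cheeger_energy m p u") auto
  have "\<exists>g \<in> Lp m p \<inter> LIP. (\<integral>\<^sup>+x. ennreal (\<bar>g x - u x\<bar> powr p) \<partial>m) < ennreal (1 / Suc n) \<and>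
      (\<integral>\<^sup>+x. ennreal (lip g x powr p) \<partial>m) < ennreal (C + 1 / Suc n)" for n
    using C by (intro Cheeger_energy_approx) (auto simp: ennreal_less_iff)
  then have "\<exists>f. \<forall>n. f n \<in> Lp m p \<inter> LIP \<and>
      (\<integral>\<^sup>+x. ennreal (\<bar>f n x - u x\<bar> powr p) \<partial>m) < ennreal (1 / Suc n) \<and>
      (\<integral>\<^sup>+x. ennreal (lip (f n) x powr p) \<partial>m) < ennreal (C + 1 / Suc n)"
    by (intro choice allI) (unfold Bex_def)
  then obtain f where f: "\<And>n. f n \<in> Lp m p" "\<And>n. f n \<in> LIP"
    "\<And>n. (\<integral>\<^sup>+x. ennreal (\<bar>f n x - u x\<bar> powr p) \<partial>m) < ennreal (1 / Suc n)"
    "\<And>n. (\<integral>\<^sup>+x. ennreal (lip (f n) x powr p) \<partial>m) < ennreal (C + 1 / Suc n)"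
    unfolding Int_iff by (elim exE) (rule that; blast)
  have lim1: "(\<lambda>n. 1 / real (Suc n)) \<longlonglongrightarrow> 0"
    by (intro LIMSEQ_Suc lim_inverse_n')
  have lip_meas: "lip g \<in> borel_measurable m" if "g \<in> LIP" for g
    unfolding sets' using that by (auto simp: LIP_def)
  have lip_Lp: "lip (f n) \<in> Lp m p" for n
    using f(4)[of n] lip_meas[OF f(2)] by (intro Lp_of_nn_integral) (auto elim: order.strict_trans)
  define A where "A n = (\<integral>x. lip (f n) x powr p \<partial>m)" for n
  have nnA: "(\<integral>\<^sup>+x. ennreal (lip (f n) x powr p) \<partial>m) = ennreal (A n)" for n
    using nn_integral_powr_eq[OF lip_Lp] by (simp add: A_def)
  have A0: "A n \<ge> 0" for n by (simp add: A_def)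
  have A_le: "A n \<le> C + 1 / Suc n" for n
    using f(4)[of n] A0 C(2) unfolding nnA by (subst (asm) ennreal_less_iff) auto
  define F where "F n = (\<integral>x. \<bar>f n x - u x\<bar> powr p \<partial>m)" for n
  have nnF: "(\<integral>\<^sup>+x. ennreal (\<bar>f n x - u x\<bar> powr p) \<partial>m) = ennreal (F n)" for n
    using nn_integral_powr_eq[OF Lp_diff[OF f(1) u p0]] by (simp add: F_def)
  have F0: "F n \<ge> 0" for n by (simp add: F_def)
  have F_less: "F n < 1 / Suc n" for n
    using f(3)[of n] F0 unfolding nnF by (subst (asm) ennreal_less_iff) auto
  have mid: "\<bar>(a + b) / 2\<bar> powr p \<le> \<bar>a\<bar> powr p + \<bar>b\<bar> powr p" for a b :: real
  proof -
    have "\<bar>(a + b) / 2\<bar> \<le> max \<bar>a\<bar> \<bar>b\<bar>" using abs_triangle_ineq[of a b] by (auto simp: max_def)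
    then have "\<bar>(a + b) / 2\<bar> powr p \<le> max \<bar>a\<bar> \<bar>b\<bar> powr p"
      using p by (intro powr_mono2) auto
    also have "\<dots> \<le> \<bar>a\<bar> powr p + \<bar>b\<bar> powr p" by (simp add: max_def)
    finally show ?thesis .
  qed
  define B where "B i j = (\<integral>x. ((lip (f i) x + lip (f j) x) / 2) powr p \<partial>m)" for i j
  have B_int: "integrable m (\<lambda>x. ((lip (f i) x + lip (f j) x) / 2) powr p)" for i j
    using Lp_midpoint[OF lip_Lp lip_Lp p0, of i j] by (simp add: Lp_def)
  \<comment> \<open>The midpoint of two late terms is still close to u, so its energy is at least C
    - d; convexity of \<open>lip\<close> moves this bound to the mean of the two local Lipschitz
    constants.\<close>
  have lsc: "\<exists>n0. \<forall>i\<ge>n0. \<forall>j\<ge>n0. C - d \<le> B i j" if d: "d > 0" for d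
  proof -
    obtain e where e: "e > 0" "\<And>g. g \<in> Lp m p \<inter> LIP \<Longrightarrow> (\<integral>\<^sup>+x. ennreal (\<bar>g x - u x\<bar> powr p) \<partial>m) < ennreal e
      \<Longrightarrow> ennreal (C - d) \<le> (\<integral>\<^sup>+x. ennreal (lip g x powr p) \<partial>m)"
      using Cheeger_energy_lower_semicontinuous[OF C(1) d] by blast
    have "eventually (\<lambda>n. 1 / real (Suc n) < e / 2) sequentially"
      using e(1) by (intro order_tendstoD(2)[OF lim1]) simp
    then obtain n0 where n0: "\<And>n. n \<ge> n0 \<Longrightarrow> 1 / real (Suc n) < e / 2"
      by (auto simp: eventually_sequentially)
    have "C - d \<le> B i j" if ij: "i \<ge> n0" "j \<ge> n0" for i j
    proof -
      define g where "g x = (f i x + f j x) / 2" for x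
      have g: "g \<in> Lp m p" "g \<in> LIP"
        using Lp_midpoint[OF f(1) f(1) p0] LIP_midpoint[OF f(2) f(2)] by (auto simp: g_def[abs_def])
      have "(\<integral>\<^sup>+x. ennreal (\<bar>g x - u x\<bar> powr p) \<partial>m)
         \<le> (\<integral>\<^sup>+x. ennreal (\<bar>f i x - u x\<bar> powr p) + ennreal (\<bar>f j x - u x\<bar> powr p) \<partial>m)"
      proof (rule nn_integral_mono)
        fix x
        have "g x - u x = ((f i x - u x) + (f j x - u x)) / 2" by (simp add: g_def field_simps)
        then show "ennreal (\<bar>g x - u x\<bar> powr p) \<le> ennreal (\<bar>f i x - u x\<bar> powr p) + ennreal (\<bar>f j x - u x\<bar> powr p)"
          using mid[of "f i x - u x" "f j x - u x", folded \<open>g x - u x = _\<close>]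
          by (simp add: ennreal_leI ennreal_plus[symmetric] del: ennreal_plus)
      qed
      also have "\<dots> = ennreal (F i) + ennreal (F j)"
        unfolding nnF[symmetric] using f(1)[of i] f(1)[of j] u
        by (intro nn_integral_add) (auto simp: Lp_def)
      also have "\<dots> = ennreal (F i + F j)" using F0 by simp
      also have "\<dots> < ennreal e"
        using F_less[of i] F_less[of j] n0[OF ij(1)] n0[OF ij(2)] F0[of i] F0[of j]
        by (intro ennreal_lessI) auto
      finally have "ennreal (C - d) \<le> (\<integral>\<^sup>+x. ennreal (lip g x powr p) \<partial>m)"
        using g by (intro e(2)) auto
      also have "\<dots> \<le> (\<integral>\<^sup>+x. ennreal (((lip (f i) x + lip (f j) x) / 2) powr p) \<partial>m)"
      proof (intro nn_integral_mono ennreal_leI powr_mono2)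
        fix x
        obtain L M where "L-lipschitz_on UNIV (f i)" "M-lipschitz_on UNIV (f j)"
          using f(2)[of i] f(2)[of j] by (auto simp: LIP_def)
        then show "lip g x \<le> (lip (f i) x + lip (f j) x) / 2"
          unfolding g_def by (rule lip_midpoint_le)
      qed (use p in auto)
      also have "\<dots> = ennreal (B i j)"
        unfolding B_def by (intro nn_integral_eq_integral B_int) auto
      finally show ?thesis by (simp add: B_def ennreal_le_iff)
    qed
    then show ?thesis by blast
  qed
  have "\<exists>n0. \<forall>i\<ge>n0. \<forall>j\<ge>n0. (\<integral>x. \<bar>lip (f i) x - lip (f j) x\<bar> powr p \<partial>m) \<le> e" if e: "e > 0" for e
  proof -
    \<comment> \<open>Half of e is spent on each term of uniform convexity: the energies sum to at
      most 2 (C + 1), and the convexity defect is at most 2 d.\<close>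
    define e' where "e' = e / (4 * (C + 1))"
    have e': "e' > 0" "e' * (2 * (C + 1)) = e / 2" using e C by (auto simp: e'_def field_simps)
    obtain K where K: "K > 0" "\<And>a b. 0 \<le> a \<Longrightarrow> 0 \<le> b \<Longrightarrow>
      \<bar>a - b\<bar> powr p \<le> e' * (a powr p + b powr p) + K * ((a powr p + b powr p) / 2 - ((a + b) / 2) powr p)"
      using powr_uniformly_convex[OF p e'(1)] by blast
    define d where "d = e / (4 * K)"
    have d: "d > 0" "K * d = e / 4" using e K by (auto simp: d_def)
    obtain n1 where n1: "\<And>i j. i \<ge> n1 \<Longrightarrow> j \<ge> n1 \<Longrightarrow> C - d \<le> B i j" using lsc[OF d(1)] by blast
    have "eventually (\<lambda>n. 1 / real (Suc n) < d) sequentially"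
      using d(1) by (intro order_tendstoD(2)[OF lim1])
    then obtain n2 where n2: "\<And>n. n \<ge> n2 \<Longrightarrow> 1 / real (Suc n) < d"
      by (auto simp: eventually_sequentially)
    have "(\<integral>x. \<bar>lip (f i) x - lip (f j) x\<bar> powr p \<partial>m) \<le> e" if ij: "i \<ge> max n1 n2" "j \<ge> max n1 n2" for i j
    proof -
      have int: "integrable m (\<lambda>x. lip (f i) x powr p)" for i
        using lip_Lp[of i] by (simp add: Lp_def)
      have "(\<integral>x. \<bar>lip (f i) x - lip (f j) x\<bar> powr p \<partial>m)
        \<le> (\<integral>x. e' * (lip (f i) x powr p + lip (f j) x powr p)
          + K * ((lip (f i) x powr p + lip (f j) x powr p) / 2 - ((lip (f i) x + lip (f j) x) / 2) powr p) \<partial>m)"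
        using Lp_diff[OF lip_Lp lip_Lp p0, of i j] K(2) int B_int
        by (intro integral_mono) (auto simp: Lp_def)
      also have "\<dots> = e' * (A i + A j) + K * ((A i + A j) / 2 - B i j)"
        using int B_int by (simp add: A_def B_def)
      also have "\<dots> \<le> e' * (2 * (C + 1)) + K * ((C + d) - (C - d))"
      proof (intro add_mono mult_left_mono)
        have "1 / real (Suc n) \<le> 1" for n by simp
        then show "A i + A j \<le> 2 * (C + 1)"
          using A_le[of i] A_le[of j] by (smt (verit))
        have "A i \<le> C + d" "A j \<le> C + d"
          using A_le[of i] A_le[of j] n2[of i] n2[of j] ij by auto
        moreover have "C - d \<le> B i j" using n1[of i j] ij by simp
        ultimately show "(A i + A j) / 2 - B i j \<le> (C + d) - (C - d)" by argo
      qed (use e' K in auto)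
      also have "\<dots> = e" using e' d by (simp add: algebra_simps)
      finally show ?thesis .
    qed
    then show ?thesis by blast
  qed
  then have "\<exists>G\<in>Lp m p. (\<forall>x. 0 \<le> G x) \<and> Lp_tendsto m p (\<lambda>n. lip (f n)) G"
    by (intro Lp_complete[OF lip_Lp p0 lip_nonneg])
  then obtain G where G: "G \<in> Lp m p" "\<And>x. 0 \<le> G x" "Lp_tendsto m p (\<lambda>n. lip (f n)) G"
    by blast
  have "A \<longlonglongrightarrow> (\<integral>x. G x powr p \<partial>m)"
    using Lp_tendsto_integral[OF lip_Lp G(1) p0 G(3)] G(2) by (simp add: A_def[abs_def])
  \<comment> \<open>On the diagonal \<open>B n n\<close> is \<open>A n\<close>, so the bound for
    midpoints also bounds the energies from below.\<close>
  moreover have "A \<longlonglongrightarrow> C"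
  proof (rule LIMSEQ_I)
    fix r :: real assume "r > 0"
    then obtain n1 where n1: "\<And>i j. i \<ge> n1 \<Longrightarrow> j \<ge> n1 \<Longrightarrow> C - r / 2 \<le> B i j" using lsc[of "r / 2"] by auto
    have "eventually (\<lambda>n. 1 / real (Suc n) < r) sequentially"
      using \<open>r > 0\<close> by (intro order_tendstoD(2)[OF lim1])
    then obtain n2 where n2: "\<And>n. n \<ge> n2 \<Longrightarrow> 1 / real (Suc n) < r"
      by (auto simp: eventually_sequentially)
    have "norm (A n - C) < r" if "n \<ge> max n1 n2" for n
      using n1[of n n] n2[of n] A_le[of n] that \<open>r > 0\<close> by (auto simp: A_def B_def abs_less_iff)
    then show "\<exists>no. \<forall>n\<ge>no. norm (A n - C) < r" by blast
  qed
  ultimately have "(\<integral>x. G x powr p \<partial>m) = C" by (rule LIMSEQ_unique)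
  then have energy: "Cheeger_energy m p u = (\<integral>\<^sup>+x. ennreal (G x powr p) \<partial>m)"
    using nn_integral_powr_eq[OF G(1)] G(2) C by simp
  have "Lp_tendsto m p f u"
    unfolding Lp_tendsto_def
  proof (rule tendsto_sandwich[OF _ _ tendsto_const])
    have "(\<lambda>n. ennreal (1 / Suc n)) \<longlonglongrightarrow> ennreal 0"
      using lim1 by (rule tendsto_ennrealI)
    then show "(\<lambda>n. ennreal (1 / Suc n)) \<longlonglongrightarrow> 0" by simp
  qed (use less_imp_le[OF f(3)] in auto)
  then have "weak_upper_gradient m p u G"
    unfolding weak_upper_gradient_def using G f lip_Lp
    by (intro conjI exI[of _ f] exI[of _ "\<lambda>n. lip (f n)"]) auto
  with energy show ?thesis unfolding is_minimal_wug_def by blast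
qed

section \<open>The CD(0,N) inequality along a transport plan\<close>

text \<open>Concavity: the graph lies below the tangent at r, which is Young's inequality after
  division by a power of r. The entropy of an unknown density s is thereby bounded by an expression
  linear in s, for any reference value r.\<close>

lemma powr_tangent_le:
  fixes a r s :: real
  assumes "0 < a" "a < 1" "r > 0" "s \<ge> 0"
  shows "s powr a \<le> (1 - a) * r powr a + a * r powr (a - 1) * s"
proof (cases "s = 0")
  case False
  then have s: "s > 0" using assms by simp
  have "s powr a * r powr (1 - a) \<le> a * s + (1 - a) * r"
    using assms s by (intro Youngs_inequality_0) auto
  then have "(s powr a * r powr (1 - a)) * r powr (a - 1) \<le> (a * s + (1 - a) * r) * r powr (a - 1)"
    by (intro mult_right_mono) auto
  also have "(s powr a * r powr (1 - a)) * r powr (a - 1) = s powr a"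
    using assms by (simp add: mult.assoc powr_add[symmetric])
  also have "r * r powr (a - 1) = r powr a"
    using assms powr_mult_base[of r "a - 1"] by simp
  then have "(a * s + (1 - a) * r) * r powr (a - 1) = (1 - a) * r powr a + a * r powr (a - 1) * s"
    by (simp add: algebra_simps)
  finally show ?thesis .
qed (use assms in simp)

section \<open>Probability densities and transport plans\<close>

lemma ev_borel_measurable [measurable]: "ev t \<in> borel_measurable borel"
proof (rule borel_measurable_continuous_onI)
  have "1-lipschitz_on UNIV (ev t :: (real \<Rightarrow>\<^sub>C 'a) \<Rightarrow> 'a)"
    by (rule lipschitz_onI) (auto simp: ev_def dist_bounded)
  then show "continuous_on UNIV (ev t :: (real \<Rightarrow>\<^sub>C 'a) \<Rightarrow> 'a)"
    by (rule lipschitz_on_continuous_on)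
qed

lemma geodesics_dist:
  assumes "\<gamma> \<in> geodesics" "t \<in> {0..1}"
  shows "dist (ev 0 \<gamma>) (ev t \<gamma>) = t * dist (ev 0 \<gamma>) (ev 1 \<gamma>)"
proof -
  have "\<forall>s\<in>{0..1}. \<forall>t\<in>{0..1}. dist (ev s \<gamma>) (ev t \<gamma>) = \<bar>s - t\<bar> * dist (ev 0 \<gamma>) (ev 1 \<gamma>)"
    using assms(1) unfolding geodesics_def by blast
  from this[rule_format, of 0 t] assms(2) show ?thesis by simp
qed

locale cd0_space =
  fixes m :: "'a::polish_space measure" and N :: real
  assumes mms: "metric_measure_space m" and N_gt_1: "1 < N" and CD: "CD0 m N"
begin

lemma sets_m [simp, measurable_cong]: "sets m = sets borel"
  using mms by (simp add: metric_measure_space_def)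

lemma space_m [simp]: "space m = UNIV"
  using sets_eq_imp_space_eq[OF sets_m] by simp

lemma measurable_m: "measurable m borel = measurable borel borel"
  by (rule measurable_cong_sets) auto

lemma emeasure_bounded: "B \<in> sets borel \<Longrightarrow> bounded B \<Longrightarrow> emeasure m B < \<infinity>"
  using mms by (auto simp: metric_measure_space_def)

lemma emeasure_bounded_eq: "B \<in> sets borel \<Longrightarrow> bounded B \<Longrightarrow> emeasure m B = ennreal (measure m B)"
  using emeasure_bounded[of B] by (intro emeasure_eq_ennreal_measure) auto

lemma measure_ball_pos: "r > 0 \<Longrightarrow> measure m (ball x r) > 0"
proof -
  assume "r > 0"
  have "x \<in> measure_supp m" using mms by (simp add: metric_measure_space_def)
  then have "emeasure m (ball x r) > 0" using \<open>r > 0\<close> by (auto simp: measure_supp_def)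
  then show ?thesis using emeasure_bounded_eq[of "ball x r"] by simp
qed

lemma measure_bounded_mono:
  "A \<subseteq> B \<Longrightarrow> bounded B \<Longrightarrow> A \<in> sets borel \<Longrightarrow> B \<in> sets borel \<Longrightarrow> measure m A \<le> measure m B"
  using emeasure_bounded[of B] by (intro measure_mono_fmeasurable) (auto simp: fmeasurable_def)

text \<open>The bounded support is witnessed by an explicit Borel set outside which the density
  vanishes at every point; this set is also where the endpoints of almost every geodesic
  lie.\<close>

definition prob_dens :: "('a \<Rightarrow> real) \<Rightarrow> 'a set \<Rightarrow> bool" where
  "prob_dens \<rho> B \<longleftrightarrow> \<rho> \<in> borel_measurable borel \<and> (\<forall>x. 0 \<le> \<rho> x) \<and> (\<integral>\<^sup>+x. ennreal (\<rho> x) \<partial>m) = 1 \<and>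
     B \<in> sets borel \<and> bounded B \<and> (\<forall>x. x \<notin> B \<longrightarrow> \<rho> x = 0)"

lemma prob_dens_bounded_prob_density:
  assumes "prob_dens \<rho> B"
  shows "bounded_prob_density m \<rho>"
proof -
  have [measurable]: "\<rho> \<in> borel_measurable m" "B \<in> sets borel"
    using assms by (auto simp: prob_dens_def measurable_m)
  have "prob_space (density m (\<lambda>x. ennreal (\<rho> x)))"
    using assms by (intro prob_spaceI) (auto simp: emeasure_density prob_dens_def)
  moreover have "measure_supp (density m (\<lambda>x. ennreal (\<rho> x))) \<subseteq> closure B"
  proof (rule subsetI, rule ccontr)
    fix x assume x: "x \<in> measure_supp (density m (\<lambda>x. ennreal (\<rho> x)))" "x \<notin> closure B"
    have "emeasure (density m (\<lambda>x. ennreal (\<rho> x))) (- closure B)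
        = (\<integral>\<^sup>+x. ennreal (\<rho> x) * indicator (- closure B) x \<partial>m)"
      by (rule emeasure_density) auto
    also have "\<dots> = (\<integral>\<^sup>+x. 0 \<partial>m)"
      using assms closure_subset[of B]
      by (intro nn_integral_cong) (auto simp: prob_dens_def indicator_def)
    finally show False
      using x by (auto simp: measure_supp_def dest!: spec[of _ "- closure B"])
  qed
  then have "bounded (measure_supp (density m (\<lambda>x. ennreal (\<rho> x))))"
    using assms by (meson bounded_closure bounded_subset prob_dens_def)
  ultimately show ?thesis
    using assms by (simp add: bounded_prob_density_def prob_dens_def)
qed

lemma prob_dens_integrable_powr:
  assumes "prob_dens \<rho> B"
  shows "integrable m (\<lambda>x. \<rho> x powr (1 - 1 / N))" "integrable m \<rho>" "(\<integral>x. \<rho> x \<partial>m) = 1"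
proof -
  have [measurable]: "\<rho> \<in> borel_measurable m" "B \<in> sets borel"
    using assms by (auto simp: prob_dens_def measurable_m)
  show int: "integrable m \<rho>"
    using assms by (intro integrableI_bounded) (auto simp: prob_dens_def)
  show "(\<integral>x. \<rho> x \<partial>m) = 1"
    using assms by (subst integral_eq_nn_integral) (auto simp: prob_dens_def)
  have intB: "integrable m (indicator B :: 'a \<Rightarrow> real)"
    using assms emeasure_bounded[of B] by (auto simp: prob_dens_def)
  show "integrable m (\<lambda>x. \<rho> x powr (1 - 1 / N))"
  proof (rule Bochner_Integration.integrable_bound)
    show "integrable m (\<lambda>x. indicator B x + \<rho> x)" using int intB by auto
    show "AE x in m. norm (\<rho> x powr (1 - 1 / N)) \<le> norm (indicator B x + \<rho> x)"
    proof (rule AE_I2)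
      fix x
      have "\<rho> x \<ge> 0" "x \<notin> B \<Longrightarrow> \<rho> x = 0" using assms by (auto simp: prob_dens_def)
      moreover have "\<rho> x powr (1 - 1 / N) \<le> 1 / N + (1 - 1 / N) * \<rho> x"
        using powr_tangent_le[of "1 - 1 / N" 1 "\<rho> x"] N_gt_1 \<open>\<rho> x \<ge> 0\<close> by simp
      then have "\<rho> x powr (1 - 1 / N) \<le> 1 + \<rho> x"
        using mult_right_mono[of "1 - 1 / N" 1 "\<rho> x"] N_gt_1 \<open>\<rho> x \<ge> 0\<close>
        by (intro order_trans[OF _ add_mono[of "1 / N" 1]]) auto
      ultimately show "norm (\<rho> x powr (1 - 1 / N)) \<le> norm (indicator B x + \<rho> x)"
        by (auto simp: indicator_def)
    qed
  qed measurable
qed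

text \<open>The last clause is the CD(0,N) inequality for exponent N with the intermediate density
  eliminated: its entropy is replaced by the tangent at a positive reference r on a set E that
  carries the mass at time t. What is left is an integral of r over E and an integral of r along the
  plan.\<close>

definition transport_plan :: "('a \<Rightarrow> real) \<Rightarrow> ('a \<Rightarrow> real) \<Rightarrow> (real \<Rightarrow>\<^sub>C 'a) measure \<Rightarrow> bool" where
  "transport_plan \<rho>0 \<rho>1 \<pi> \<longleftrightarrow> prob_space \<pi> \<and> space \<pi> = geodesics \<and> (\<forall>t. ev t \<in> borel_measurable \<pi>) \<and>
     distr \<pi> borel (ev 0) = density m (\<lambda>x. ennreal (\<rho>0 x)) \<and>
     distr \<pi> borel (ev 1) = density m (\<lambda>x. ennreal (\<rho>1 x)) \<and>
     (\<forall>t\<in>{0..1}. \<forall>E r Bd. E \<in> sets borel \<longrightarrow> emeasure m E < \<infinity> \<longrightarrow> (AE \<gamma> in \<pi>. ev t \<gamma> \<in> E) \<longrightarrow>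
        r \<in> borel_measurable borel \<longrightarrow> (\<forall>x. 0 < r x) \<longrightarrow>
        integrable m (\<lambda>x. indicator E x * r x powr (1 - 1 / N)) \<longrightarrow> (\<forall>x. r x powr (- 1 / N) \<le> Bd) \<longrightarrow>
        (1 - t) * (\<integral>x. \<rho>0 x powr (1 - 1 / N) \<partial>m) + t * (\<integral>x. \<rho>1 x powr (1 - 1 / N) \<partial>m)
          \<le> 1 / N * (\<integral>x. indicator E x * r x powr (1 - 1 / N) \<partial>m)
            + (1 - 1 / N) * (\<integral>\<gamma>. r (ev t \<gamma>) powr (- 1 / N) \<partial>\<pi>))"

lemma transport_plan_exists:
  assumes \<rho>0: "prob_dens \<rho>0 B0" and \<rho>1: "prob_dens \<rho>1 B1"
  shows "\<exists>\<pi>. transport_plan \<rho>0 \<rho>1 \<pi>"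
proof -
  have [measurable]: "\<rho>0 \<in> borel_measurable borel" "\<rho>1 \<in> borel_measurable borel"
    using assms by (auto simp: prob_dens_def)
  have pos: "0 \<le> \<rho>0 x" "0 \<le> \<rho>1 x" for x using assms by (auto simp: prob_dens_def)
  from CD[unfolded CD0_def, rule_format, OF prob_dens_bounded_prob_density[OF \<rho>0]
      prob_dens_bounded_prob_density[OF \<rho>1]]
  obtain \<pi> where plan: "optimal_dynamical_plan (density m (\<lambda>x. ennreal (\<rho>0 x)))
                                   (density m (\<lambda>x. ennreal (\<rho>1 x))) \<pi>"
    and ex: "\<forall>t\<in>{0..1}. \<exists>\<rho>t :: 'a \<Rightarrow> real. \<rho>t \<in> borel_measurable m \<and> (\<forall>x. 0 \<le> \<rho>t x) \<and>
              distr \<pi> borel (ev t) = density m (\<lambda>x. ennreal (\<rho>t x)) \<and>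
              (\<forall>N'\<ge>N. - (\<integral>x. \<rho>t x powr (1 - 1 / N') \<partial>m)
                 \<le> - (\<integral>\<gamma>. (1 - t) * \<rho>0 (ev 0 \<gamma>) powr (- 1 / N')
                            + t * \<rho>1 (ev 1 \<gamma>) powr (- 1 / N') \<partial>\<pi>))"
    by (elim exE conjE)
  have prob: "prob_space \<pi>" and sets_\<pi>: "sets \<pi> = sets (restrict_space borel geodesics)"
    using plan by (auto simp: optimal_dynamical_plan_def)
  interpret \<pi>: prob_space \<pi> by (rule prob)
  have space_\<pi>: "space \<pi> = geodesics"
    using sets_eq_imp_space_eq[OF sets_\<pi>] by (simp add: space_restrict_space)
  have ev_meas [measurable]: "ev t \<in> borel_measurable \<pi>" for t
    unfolding measurable_cong_sets[OF sets_\<pi> refl] by (intro measurable_restrict_space1) measurable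
  have "distr (distr \<pi> (borel \<Otimes>\<^sub>M borel) (\<lambda>\<gamma>. (ev 0 \<gamma>, ev 1 \<gamma>))) borel fst = density m (\<lambda>x. ennreal (\<rho>0 x))"
    "distr (distr \<pi> (borel \<Otimes>\<^sub>M borel) (\<lambda>\<gamma>. (ev 0 \<gamma>, ev 1 \<gamma>))) borel snd = density m (\<lambda>x. ennreal (\<rho>1 x))"
    using plan by (auto simp: optimal_dynamical_plan_def W2_optimal_def couplings_def)
  then have d0: "distr \<pi> borel (ev 0) = density m (\<lambda>x. ennreal (\<rho>0 x))"
    and d1: "distr \<pi> borel (ev 1) = density m (\<lambda>x. ennreal (\<rho>1 x))"
    using distr_distr[of fst "borel \<Otimes>\<^sub>M borel" borel "\<lambda>\<gamma>. (ev 0 \<gamma>, ev 1 \<gamma>)" \<pi>]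
      distr_distr[of snd "borel \<Otimes>\<^sub>M borel" borel "\<lambda>\<gamma>. (ev 0 \<gamma>, ev 1 \<gamma>)" \<pi>]
    by (simp_all add: comp_def)
  have end_int: "integrable \<pi> (\<lambda>\<gamma>. \<rho> (ev s \<gamma>) powr (- 1 / N))"
      "(\<integral>\<gamma>. \<rho> (ev s \<gamma>) powr (- 1 / N) \<partial>\<pi>) = (\<integral>x. \<rho> x powr (1 - 1 / N) \<partial>m)"
    if \<rho>: "prob_dens \<rho> B" and d: "distr \<pi> borel (ev s) = density m (\<lambda>x. ennreal (\<rho> x))" for \<rho> B s
  proof -
    have [measurable]: "\<rho> \<in> borel_measurable borel" and nn: "\<And>x. 0 \<le> \<rho> x"
      using \<rho> by (auto simp: prob_dens_def)
    \<comment> \<open>Both sides are 0 where the density vanishes, because 0 powr a is 0; elsewhere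
      the exponents add.\<close>
    have eq: "\<rho> x * \<rho> x powr (- 1 / N) = \<rho> x powr (1 - 1 / N)" for x
      using nn[of x] powr_mult_base[of "\<rho> x" "- 1 / N"] by (cases "\<rho> x = 0") auto
    have "integrable (density m (\<lambda>x. ennreal (\<rho> x))) (\<lambda>x. \<rho> x powr (- 1 / N))"
      using nn prob_dens_integrable_powr(1)[OF \<rho>]
      by (subst integrable_density) (auto simp: eq[simplified])
    then show "integrable \<pi> (\<lambda>\<gamma>. \<rho> (ev s \<gamma>) powr (- 1 / N))"
      unfolding d[symmetric] by (rule integrable_distr[OF ev_meas])
    have "(\<integral>\<gamma>. \<rho> (ev s \<gamma>) powr (- 1 / N) \<partial>\<pi>) = (\<integral>x. \<rho> x powr (- 1 / N) \<partial>distr \<pi> borel (ev s))"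
      by (subst integral_distr) auto
    also have "\<dots> = (\<integral>x. \<rho> x powr (1 - 1 / N) \<partial>m)"
      unfolding d using nn by (subst integral_density) (auto simp: eq[simplified])
    finally show "(\<integral>\<gamma>. \<rho> (ev s \<gamma>) powr (- 1 / N) \<partial>\<pi>) = (\<integral>x. \<rho> x powr (1 - 1 / N) \<partial>m)" .
  qed
  have main: "(1 - t) * (\<integral>x. \<rho>0 x powr (1 - 1 / N) \<partial>m) + t * (\<integral>x. \<rho>1 x powr (1 - 1 / N) \<partial>m)
          \<le> 1 / N * (\<integral>x. indicator E x * r x powr (1 - 1 / N) \<partial>m)
            + (1 - 1 / N) * (\<integral>\<gamma>. r (ev t \<gamma>) powr (- 1 / N) \<partial>\<pi>)"
    if t: "t \<in> {0..1}" and E: "E \<in> sets borel" "emeasure m E < \<infinity>" "AE \<gamma> in \<pi>. ev t \<gamma> \<in> E"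
      and r: "r \<in> borel_measurable borel" "\<forall>x. 0 < r x"
        "integrable m (\<lambda>x. indicator E x * r x powr (1 - 1 / N))" "\<forall>x. r x powr (- 1 / N) \<le> Bd"
    for t E r Bd
  proof -
    note [measurable] = E(1) r(1)
    from bspec[OF ex t] obtain \<rho>t where \<rho>t: "\<rho>t \<in> borel_measurable m" "\<And>x. 0 \<le> \<rho>t x"
      "distr \<pi> borel (ev t) = density m (\<lambda>x. ennreal (\<rho>t x))"
      "- (\<integral>x. \<rho>t x powr (1 - 1 / N) \<partial>m)
                 \<le> - (\<integral>\<gamma>. (1 - t) * \<rho>0 (ev 0 \<gamma>) powr (- 1 / N)
                            + t * \<rho>1 (ev 1 \<gamma>) powr (- 1 / N) \<partial>\<pi>)"
      by (elim exE conjE) (drule spec[of _ N], simp)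
    note [measurable] = \<rho>t(1)
    have "AE x in distr \<pi> borel (ev t). x \<in> E"
      using E by (subst AE_distr_iff) auto
    then have outE: "AE x in m. \<rho>t x \<noteq> 0 \<longrightarrow> x \<in> E"
      unfolding \<rho>t(3) using \<rho>t(2) by (subst (asm) AE_density) (auto simp: less_le)
    have "integrable \<pi> (\<lambda>\<gamma>. r (ev t \<gamma>) powr (- 1 / N))"
      using r(4) by (intro \<pi>.integrable_const_bound[of _ Bd]) auto
    then have "integrable (distr \<pi> borel (ev t)) (\<lambda>x. r x powr (- 1 / N))"
      by (subst integrable_distr_eq) auto
    then have int1: "integrable m (\<lambda>x. \<rho>t x * r x powr (- 1 / N))"
      unfolding \<rho>t(3) using \<rho>t(2) by (subst (asm) integrable_density) auto
    have eq1: "(\<integral>x. \<rho>t x * r x powr (- 1 / N) \<partial>m) = (\<integral>\<gamma>. r (ev t \<gamma>) powr (- 1 / N) \<partial>\<pi>)"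
    proof -
      have "(\<integral>x. \<rho>t x * r x powr (- 1 / N) \<partial>m) = (\<integral>x. r x powr (- 1 / N) \<partial>density m (\<lambda>x. ennreal (\<rho>t x)))"
        using \<rho>t(2) by (subst integral_density) auto
      also have "\<dots> = (\<integral>\<gamma>. r (ev t \<gamma>) powr (- 1 / N) \<partial>\<pi>)"
        unfolding \<rho>t(3)[symmetric] by (subst integral_distr) auto
      finally show ?thesis .
    qed
    \<comment> \<open>The tangent at r, cut off to E; outside E the intermediate density vanishes
      almost everywhere. The domination also supplies integrability of the intermediate
      entropy.\<close>
    let ?R = "\<lambda>x. 1 / N * (indicator E x * r x powr (1 - 1 / N)) + (1 - 1 / N) * (\<rho>t x * r x powr (- 1 / N))"
    have intR: "integrable m ?R" using r(3) int1 by auto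
    have le: "AE x in m. \<rho>t x powr (1 - 1 / N) \<le> ?R x"
      using outE
    proof eventually_elim
      case (elim x)
      show ?case
      proof (cases "\<rho>t x = 0")
        case True
        then show ?thesis using N_gt_1 by simp
      next
        case False
        then have "x \<in> E" using elim by simp
        then show ?thesis
          using powr_tangent_le[of "1 - 1 / N" "r x" "\<rho>t x"] N_gt_1 r(2)[rule_format, of x] \<rho>t(2)[of x]
          by (simp add: algebra_simps)
      qed
    qed
    have intL: "integrable m (\<lambda>x. \<rho>t x powr (1 - 1 / N))"
      using intR by (rule Bochner_Integration.integrable_bound) (measurable, use le in \<open>auto elim!: eventually_mono\<close>)
    have "(1 - t) * (\<integral>x. \<rho>0 x powr (1 - 1 / N) \<partial>m) + t * (\<integral>x. \<rho>1 x powr (1 - 1 / N) \<partial>m)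
       = (\<integral>\<gamma>. (1 - t) * \<rho>0 (ev 0 \<gamma>) powr (- 1 / N) + t * \<rho>1 (ev 1 \<gamma>) powr (- 1 / N) \<partial>\<pi>)"
      using end_int[OF \<rho>0 d0] end_int[OF \<rho>1 d1] by simp
    also have "\<dots> \<le> (\<integral>x. \<rho>t x powr (1 - 1 / N) \<partial>m)" using \<rho>t(4) by simp
    also have "\<dots> \<le> (\<integral>x. ?R x \<partial>m)" using intL intR le by (rule integral_mono_AE)
    also have "\<dots> = 1 / N * (\<integral>x. indicator E x * r x powr (1 - 1 / N) \<partial>m)
            + (1 - 1 / N) * (\<integral>\<gamma>. r (ev t \<gamma>) powr (- 1 / N) \<partial>\<pi>)"
      using r(3) int1 eq1 by simp
    finally show ?thesis .
  qed
  have "transport_plan \<rho>0 \<rho>1 \<pi>"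
    unfolding transport_plan_def
  proof (intro conjI ballI allI impI prob space_\<pi> ev_meas d0 d1)
    fix t :: real and E and r :: "'a \<Rightarrow> real" and Bd :: real
    assume "t \<in> {0..1}" "E \<in> sets borel" "emeasure m E < \<infinity>" "AE \<gamma> in \<pi>. ev t \<gamma> \<in> E"
      "r \<in> borel_measurable borel" "\<forall>x. 0 < r x"
      "integrable m (\<lambda>x. indicator E x * r x powr (1 - 1 / N))" "\<forall>x. r x powr (- 1 / N) \<le> Bd"
    then show "(1 - t) * (\<integral>x. \<rho>0 x powr (1 - 1 / N) \<partial>m) + t * (\<integral>x. \<rho>1 x powr (1 - 1 / N) \<partial>m)
          \<le> 1 / N * (\<integral>x. indicator E x * r x powr (1 - 1 / N) \<partial>m)
            + (1 - 1 / N) * (\<integral>\<gamma>. r (ev t \<gamma>) powr (- 1 / N) \<partial>\<pi>)"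
      by (rule main)
  qed
  then show ?thesis by blast
qed

lemma transport_plan_AE:
  assumes "transport_plan \<rho>0 \<rho>1 \<pi>" "prob_dens \<rho>0 B0" "prob_dens \<rho>1 B1"
  shows "AE \<gamma> in \<pi>. \<gamma> \<in> geodesics \<and> ev 0 \<gamma> \<in> B0 \<and> ev 1 \<gamma> \<in> B1"
proof -
  have meas [measurable]: "ev t \<in> borel_measurable \<pi>" for t using assms(1) by (simp add: transport_plan_def)
  have *: "AE \<gamma> in \<pi>. ev s \<gamma> \<in> B" if "prob_dens \<rho> B" "distr \<pi> borel (ev s) = density m (\<lambda>x. ennreal (\<rho> x))" for s \<rho> B
  proof -
    have [measurable]: "\<rho> \<in> borel_measurable borel" "B \<in> sets borel"
      using that(1) by (auto simp: prob_dens_def)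
    have "AE x in density m (\<lambda>x. ennreal (\<rho> x)). x \<in> B"
      using that(1) by (subst AE_density) (auto simp: prob_dens_def less_le)
    then show ?thesis unfolding that(2)[symmetric] by (subst (asm) AE_distr_iff) auto
  qed
  have "AE \<gamma> in \<pi>. \<gamma> \<in> geodesics"
    using assms(1) AE_space[of \<pi>] by (simp add: transport_plan_def)
  moreover have "AE \<gamma> in \<pi>. ev 0 \<gamma> \<in> B0" "AE \<gamma> in \<pi>. ev 1 \<gamma> \<in> B1"
    using * assms by (auto simp: transport_plan_def)
  ultimately show ?thesis by eventually_elim auto
qed

section \<open>Bishop-Gromov inequality and asymptotic volume ratio\<close>


lemma prob_dens_uniform:
  assumes "B \<in> sets borel" "bounded B" "measure m B > 0"
  shows "prob_dens (\<lambda>x. indicator B x / measure m B) B"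
    and "(\<integral>x. (indicator B x / measure m B) powr (1 - 1 / N) \<partial>m) = measure m B powr (1 / N)"
proof -
  note [measurable] = assms(1)
  have fin: "emeasure m B = ennreal (measure m B)" using assms by (intro emeasure_bounded_eq)
  have "(\<integral>\<^sup>+x. ennreal (indicator B x / measure m B) \<partial>m)
      = (\<integral>\<^sup>+x. ennreal (1 / measure m B) * indicator B x \<partial>m)"
    by (intro nn_integral_cong) (auto simp: indicator_def)
  also have "\<dots> = ennreal (1 / measure m B) * emeasure m B"
    by (rule nn_integral_cmult_indicator) simp
  also have "\<dots> = 1"
    unfolding fin using assms(3) by (simp add: ennreal_mult[symmetric])
  finally show "prob_dens (\<lambda>x. indicator B x / measure m B) B"
    using assms by (auto simp: prob_dens_def)
  have "(\<integral>x. (indicator B x / measure m B) powr (1 - 1 / N) \<partial>m)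
     = (\<integral>x. (1 / measure m B) powr (1 - 1 / N) * indicator B x \<partial>m)"
    by (intro Bochner_Integration.integral_cong) (auto simp: indicator_def)
  also have "\<dots> = (1 / measure m B) powr (1 - 1 / N) * measure m B"
    using fin by simp
  also have "\<dots> = measure m B powr (1 / N)"
    using assms(3) powr_mult_base[of "measure m B" "1 / N - 1"]
    by (simp add: powr_divide powr_minus_divide[symmetric] mult.commute powr_diff[symmetric])
  finally show "(\<integral>x. (indicator B x / measure m B) powr (1 - 1 / N) \<partial>m) = measure m B powr (1 / N)" .
qed

lemma geodesic_in_ball:
  assumes "\<gamma> \<in> geodesics" "t \<in> {0..1}" "ev 0 \<gamma> \<in> ball x r" "ev 1 \<gamma> \<in> ball x R"
  shows "ev t \<gamma> \<in> ball x (r + t * (r + R))"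
proof -
  have "dist (ev 0 \<gamma>) (ev 1 \<gamma>) \<le> r + R"
    using assms dist_triangle3[of "ev 0 \<gamma>" "ev 1 \<gamma>" x] by (simp add: dist_commute)
  then have "t * dist (ev 0 \<gamma>) (ev 1 \<gamma>) \<le> t * (r + R)"
    using assms by (intro mult_left_mono) auto
  then show ?thesis
    using geodesics_dist[OF assms(1,2)] dist_triangle[of x "ev t \<gamma>" "ev 0 \<gamma>"] assms(3) by simp
qed

text \<open>The contraction of a ball towards its centre by the factor t. The centre is replaced by
  a ball of radius e because only absolutely continuous measures can be transported; its
  contribution is nonnegative and is dropped. At time t the geodesics lie within e + t (e + R),
  hence within t R + 2 e.\<close>

lemma Brunn_Minkowski_balls:
  assumes t: "0 < t" "t < 1" and e: "e > 0" and R: "R > 0"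
  shows "t powr N * measure m (ball x R) \<le> measure m (ball x (t * R + 2 * e))"
proof -
  define \<rho>0 where "\<rho>0 = (\<lambda>y. indicator (ball x e) y / measure m (ball x e))"
  define \<rho>1 where "\<rho>1 = (\<lambda>y. indicator (ball x R) y / measure m (ball x R))"
  have \<rho>0: "prob_dens \<rho>0 (ball x e)" and S0: "(\<integral>x. \<rho>0 x powr (1 - 1 / N) \<partial>m) = measure m (ball x e) powr (1 / N)"
    unfolding \<rho>0_def using e by (intro prob_dens_uniform measure_ball_pos; simp)+
  have \<rho>1: "prob_dens \<rho>1 (ball x R)" and S1: "(\<integral>x. \<rho>1 x powr (1 - 1 / N) \<partial>m) = measure m (ball x R) powr (1 / N)"
    unfolding \<rho>1_def using R by (intro prob_dens_uniform measure_ball_pos; simp)+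
  obtain \<pi> where \<pi>: "transport_plan \<rho>0 \<rho>1 \<pi>" using transport_plan_exists[OF \<rho>0 \<rho>1] by blast
  interpret \<pi>: prob_space \<pi> using \<pi> by (simp add: transport_plan_def)
  define E where "E = ball x (t * R + 2 * e)"
  \<comment> \<open>With the constant reference 1 / V both parts of the tangent bound combine to V
    powr (1 / N), the entropy of the uniform density on E. This is Jensen's inequality for the
    intermediate density.\<close>
  define V where "V = measure m E"
  have V: "V > 0" unfolding V_def E_def using t R e by (intro measure_ball_pos add_pos_pos) auto
  have E: "E \<in> sets borel" "bounded E" "emeasure m E < \<infinity>"
    unfolding E_def by (auto simp: emeasure_bounded[unfolded infinity_ennreal_def])
  have "AE \<gamma> in \<pi>. ev t \<gamma> \<in> E"
    using transport_plan_AE[OF \<pi> \<rho>0 \<rho>1]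
  proof eventually_elim
    case (elim \<gamma>)
    then have "ev t \<gamma> \<in> ball x (e + t * (e + R))" using t by (intro geodesic_in_ball) auto
    moreover have "t * e \<le> e" using t e by simp
    ultimately show ?case by (simp add: E_def algebra_simps)
  qed
  moreover have "integrable m (\<lambda>x. indicator E x * (1 / V) powr (1 - 1 / N))"
    using E by (intro integrable_mult_left) auto
  ultimately have "(1 - t) * (\<integral>x. \<rho>0 x powr (1 - 1 / N) \<partial>m) + t * (\<integral>x. \<rho>1 x powr (1 - 1 / N) \<partial>m)
      \<le> 1 / N * (\<integral>x. indicator E x * (1 / V) powr (1 - 1 / N) \<partial>m)
            + (1 - 1 / N) * (\<integral>\<gamma>. (1 / V) powr (- 1 / N) \<partial>\<pi>)"
    using \<pi>[unfolded transport_plan_def, THEN conjunct2, THEN conjunct2, THEN conjunct2, THEN conjunct2, THEN conjunct2,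
        rule_format, of t E "\<lambda>_. 1 / V" "(1 / V) powr (- 1 / N)"] E V t by simp
  also have "(\<integral>x. indicator E x * (1 / V) powr (1 - 1 / N) \<partial>m) = V * (1 / V) powr (1 - 1 / N)"
    using E by (simp add: V_def)
  also have "V * (1 / V) powr (1 - 1 / N) = V powr (1 / N)"
    using V powr_mult_base[of V "1 / N - 1"]
    by (simp add: powr_divide powr_minus_divide[symmetric])
  also have "(\<integral>\<gamma>. (1 / V) powr (- 1 / N) \<partial>\<pi>) = V powr (1 / N)"
    using V by (simp add: \<pi>.prob_space powr_divide powr_minus_divide)
  also have "1 / N * V powr (1 / N) + (1 - 1 / N) * V powr (1 / N) = V powr (1 / N)"
    by (simp add: algebra_simps)
  finally have "(1 - t) * measure m (ball x e) powr (1 / N) + t * measure m (ball x R) powr (1 / N) \<le> V powr (1 / N)"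
    unfolding S0 S1 .
  then have "t * measure m (ball x R) powr (1 / N) \<le> V powr (1 / N)"
    using t by (smt (verit) mult_nonneg_nonneg powr_ge_zero)
  then have "(t * measure m (ball x R) powr (1 / N)) powr N \<le> (V powr (1 / N)) powr N"
    using t N_gt_1 by (intro powr_mono2) auto
  then show ?thesis
    using t N_gt_1 V by (simp add: powr_mult powr_powr V_def E_def)
qed

text \<open>For t < s / R the choice e = (s - t R) / 2 makes the target radius t R + 2 e exactly s.
  The limit is then taken in t alone, and continuity of the ball volume in the radius does not come
  into it.\<close>

theorem Bishop_Gromov:
  assumes "0 < s" "s \<le> R"
  shows "measure m (ball x R) / R powr N \<le> measure m (ball x s) / s powr N"
proof (cases "s = R")
  case False
  with assms have s: "0 < s" "s < R" by auto
  have "((\<lambda>t. t powr N * measure m (ball x R)) \<longlongrightarrow> (s / R) powr N * measure m (ball x R)) (at_left (s / R))"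
    using s N_gt_1 by (intro tendsto_intros) auto
  moreover have "eventually (\<lambda>t. t powr N * measure m (ball x R) \<le> measure m (ball x s)) (at_left (s / R))"
  proof -
    have "eventually (\<lambda>t. t \<in> {0<..<s / R}) (at_left (s / R))"
      using s by (intro eventually_at_left_real) auto
    then show ?thesis
    proof eventually_elim
      case (elim t)
      then have "t * R < s" using s by (simp add: field_simps)
      moreover have "s / R < 1" using s by simp
      then have "t < 1" using elim by simp
      ultimately show ?case
        using Brunn_Minkowski_balls[of t "(s - t * R) / 2" R x] elim s by (simp add: field_simps)
    qed
  qed
  ultimately have "(s / R) powr N * measure m (ball x R) \<le> measure m (ball x s)"
    by (rule tendsto_upperbound) (simp add: trivial_limit_at_left_real)
  then show ?thesis using s by (simp add: powr_divide field_simps)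
qed simp

lemma unit_ball_vol_N_pos: "unit_ball_vol N > 0"
  using N_gt_1 by (intro unit_ball_vol_pos) simp

text \<open>The volume ratio is decreasing by Bishop-Gromov, so it converges to its infimum. A ball
  around y is contained in the ball around x with radius enlarged by the distance, and the ratio of
  the radii tends to 1, so all centres share the limit; this gives the definite description in
  \<open>AVR\<close> its meaning.\<close>

lemma AVR_tendsto:
  "((\<lambda>R. measure m (ball x R) / (unit_ball_vol N * R powr N)) \<longlongrightarrow> AVR m N) at_top"
proof -
  define \<theta> where "\<theta> x R = measure m (ball x R) / (unit_ball_vol N * R powr N)" for x R
  define a where "a x = (INF R\<in>{0<..}. \<theta> x R)" for x
  have \<theta>0: "\<theta> x R \<ge> 0" for x R
    unfolding \<theta>_def using unit_ball_vol_N_pos by (intro divide_nonneg_nonneg mult_nonneg_nonneg) auto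
  have bdd: "bdd_below (\<theta> x ` {0<..})" for x using \<theta>0 by (intro bdd_belowI2[of _ 0]) auto
  have lim: "(\<theta> x \<longlongrightarrow> a x) at_top" for x
  proof (rule decreasing_tendsto)
    show "eventually (\<lambda>R. a x \<le> \<theta> x R) at_top"
      using eventually_gt_at_top[of 0]
      by eventually_elim (auto simp: a_def intro!: cINF_lower bdd)
    fix y assume "a x < y"
    then obtain s where s: "s > 0" "\<theta> x s < y"
      unfolding a_def by (subst (asm) cINF_less_iff) (auto intro: bdd)
    show "eventually (\<lambda>R. \<theta> x R < y) at_top"
      using eventually_ge_at_top[of s]
    proof eventually_elim
      case (elim R)
      have "\<theta> x R \<le> \<theta> x s"
        using divide_right_mono[OF Bishop_Gromov[OF s(1) elim, of x], of "unit_ball_vol N"] unit_ball_vol_N_pos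
        by (simp add: \<theta>_def mult.commute)
      with s show ?case by simp
    qed
  qed
  have le: "a y \<le> a x" for x y
  proof -
    define d where "d = dist x y"
    have "filterlim (\<lambda>R. R + d) at_top at_top"
      by (subst add.commute) (intro filterlim_tendsto_add_at_top[OF tendsto_const] filterlim_ident)
    then have "((\<lambda>R. \<theta> x (R + d)) \<longlongrightarrow> a x) at_top" by (rule filterlim_compose[OF lim])
    moreover have "((\<lambda>R. ((R + d) / R) powr N) \<longlongrightarrow> 1 powr N) at_top"
    proof (rule tendsto_powr)
      have "((\<lambda>R. 1 + d / R) \<longlongrightarrow> 1 + 0) at_top"
        by (intro tendsto_intros tendsto_divide_0[OF tendsto_const] filterlim_at_top_imp_at_infinity filterlim_ident)
      moreover have "eventually (\<lambda>R. 1 + d / R = (R + d) / R) at_top"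
        using eventually_gt_at_top[of 0] by eventually_elim (simp add: field_simps)
      ultimately show "((\<lambda>R. (R + d) / R) \<longlongrightarrow> 1) at_top" by (simp add: tendsto_cong)
    qed auto
    ultimately have "((\<lambda>R. \<theta> x (R + d) * ((R + d) / R) powr N) \<longlongrightarrow> a x * 1 powr N) at_top"
      by (intro tendsto_mult)
    moreover have "eventually (\<lambda>R. \<theta> y R \<le> \<theta> x (R + d) * ((R + d) / R) powr N) at_top"
      using eventually_gt_at_top[of 0]
    proof eventually_elim
      case (elim R)
      have d: "d \<ge> 0" by (simp add: d_def)
      have "\<theta> y R \<le> measure m (ball x (R + d)) / (unit_ball_vol N * R powr N)"
        unfolding \<theta>_def
      proof (intro divide_right_mono measure_bounded_mono)
        show "ball y R \<subseteq> ball x (R + d)"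
        proof
          fix z assume "z \<in> ball y R"
          then show "z \<in> ball x (R + d)" using dist_triangle[of x z y] by (simp add: d_def)
        qed
      qed (use unit_ball_vol_N_pos in auto)
      also have "\<dots> = \<theta> x (R + d) * ((R + d) / R) powr N"
        using elim d by (simp add: \<theta>_def powr_divide)
      finally show ?case .
    qed
    ultimately show ?thesis using lim[of y] by (intro tendsto_le[of at_top]) auto
  qed
  then have eq: "a y = a x" for y by (simp add: antisym)
  have "AVR m N = a x"
    unfolding AVR_def
  proof (rule the_equality)
    show "\<forall>x0. ((\<lambda>R. measure m (ball x0 R) / (unit_ball_vol N * R powr N)) \<longlongrightarrow> a x) at_top"
    proof
      fix x0
      show "((\<lambda>R. measure m (ball x0 R) / (unit_ball_vol N * R powr N)) \<longlongrightarrow> a x) at_top"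
        using lim[of x0] unfolding eq[of x0] by (simp add: \<theta>_def[abs_def])
    qed
    fix b assume "\<forall>x0. ((\<lambda>R. measure m (ball x0 R) / (unit_ball_vol N * R powr N)) \<longlongrightarrow> b) at_top"
    then have "(\<theta> x \<longlongrightarrow> b) at_top" by (simp add: \<theta>_def[abs_def])
    with lim[of x] show "b = a x" by (intro tendsto_unique[of at_top]) auto
  qed
  with lim[of x] show ?thesis by (simp add: \<theta>_def[abs_def])
qed

text \<open>Volume doubling implies properness. The balls of radius e / 2 around e-separated points
  are disjoint, and each has at least a fixed fraction of the volume of the enlarged ball, which
  bounds the number of points; a separated set of maximal size is an e-net. Truncated radial
  functions thereby have compact support, as sharpness requires.\<close>

lemma compact_cball:
  fixes x :: 'a
  shows "compact (cball x r)"
  unfolding compact_eq_totally_bounded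
proof (intro conjI allI impI)
  show "Topological_Spaces.complete (cball x r)" by (rule complete_closed_subset[OF _ subset_UNIV complete_UNIV]) simp
  fix e :: real assume e: "0 < e"
  show "\<exists>k. finite k \<and> cball x r \<subseteq> (\<Union>y\<in>k. ball y e)"
  proof (cases "r \<ge> 0")
    case True
    define sep where "sep F \<longleftrightarrow> finite F \<and> F \<subseteq> cball x r \<and> (\<forall>y\<in>F. \<forall>z\<in>F. y \<noteq> z \<longrightarrow> e \<le> dist y z)" for F
    define V where "V = measure m (ball x (r + e))"
    \<comment> \<open>The Bishop-Gromov factor between the radii e / 2 and 2 r + 2 e; the larger
      ball around any point of \<open>cball x r\<close> contains
      \<open>ball x (r + e)\<close>.\<close>
    define c where "c = (e / 2 / (2 * r + 2 * e)) powr N"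
    have V: "V > 0" unfolding V_def using True e by (intro measure_ball_pos) simp
    have c: "c > 0" using True e by (simp add: c_def)
    have card_le: "card F < nat \<lceil>1 / c\<rceil> + 1" if "sep F" for F
    proof -
      have F: "finite F" "F \<subseteq> cball x r" "\<And>y z. y \<in> F \<Longrightarrow> z \<in> F \<Longrightarrow> y \<noteq> z \<Longrightarrow> e \<le> dist y z"
        using that by (auto simp: sep_def)
      have ball: "c * V \<le> measure m (ball y (e / 2))" if "y \<in> F" for y
      proof -
        have "measure m (ball y (2 * r + 2 * e)) / (2 * r + 2 * e) powr N \<le> measure m (ball y (e / 2)) / (e / 2) powr N"
          using True e by (intro Bishop_Gromov) auto
        then have "c * measure m (ball y (2 * r + 2 * e)) \<le> measure m (ball y (e / 2))"
          unfolding c_def powr_divide using True e by (simp add: field_simps)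
        moreover have "V \<le> measure m (ball y (2 * r + 2 * e))"
          unfolding V_def
        proof (rule measure_bounded_mono)
          show "ball x (r + e) \<subseteq> ball y (2 * r + 2 * e)"
          proof
            fix z assume "z \<in> ball x (r + e)"
            moreover have "dist x y \<le> r" using F(2) that by auto
            ultimately show "z \<in> ball y (2 * r + 2 * e)"
              using dist_triangle3[of y z x] e by simp
          qed
        qed auto
        then have "c * V \<le> c * measure m (ball y (2 * r + 2 * e))" using c by simp
        ultimately show ?thesis by simp
      qed
      have "real (card F) * (c * V) \<le> (\<Sum>y\<in>F. measure m (ball y (e / 2)))"
        using sum_mono[of F "\<lambda>_. c * V", OF ball] by simp
      also have "\<dots> = measure m (\<Union>y\<in>F. ball y (e / 2))"
      proof (rule measure_finite_Union[symmetric])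
        show "disjoint_family_on (\<lambda>y. ball y (e / 2)) F"
          unfolding disjoint_family_on_def
        proof (intro ballI impI)
          fix y z assume "y \<in> F" "z \<in> F" "y \<noteq> z"
          then have yz: "e \<le> dist y z" by (rule F(3))
          show "ball y (e / 2) \<inter> ball z (e / 2) = {}"
          proof (rule equals0I)
            fix w assume "w \<in> ball y (e / 2) \<inter> ball z (e / 2)"
            then show False using yz dist_triangle2[of y z w] by simp
          qed
        qed
        show "emeasure m (ball y (e / 2)) \<noteq> \<infinity>" for y using emeasure_bounded[of "ball y (e / 2)"] by simp
      qed (use F in auto)
      also have "\<dots> \<le> V"
        unfolding V_def
      proof (rule measure_bounded_mono)
        show "(\<Union>y\<in>F. ball y (e / 2)) \<subseteq> ball x (r + e)"
        proof
          fix z assume "z \<in> (\<Union>y\<in>F. ball y (e / 2))"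
          then obtain y where "y \<in> F" "dist y z < e / 2" by auto
          with F(2) dist_triangle[of x z y] e show "z \<in> ball x (r + e)" by force
        qed
        show "(\<Union>y\<in>F. ball y (e / 2)) \<in> sets borel" by (intro borel_open open_UN) auto
      qed auto
      finally have "real (card F) \<le> 1 / c" using V c by (simp add: field_simps)
      then show ?thesis by linarith
    qed
    have "sep {}" by (simp add: sep_def)
    with card_le obtain F where F: "sep F" "\<And>F'. sep F' \<Longrightarrow> card F' \<le> card F"
      using ex_has_greatest_nat[of sep "{}" card "nat \<lceil>1 / c\<rceil> + 1"] by (auto simp: less_imp_le)
    have "cball x r \<subseteq> (\<Union>y\<in>F. ball y e)"
    proof (rule subsetI, rule ccontr)
      fix z assume z: "z \<in> cball x r" "z \<notin> (\<Union>y\<in>F. ball y e)"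
      then have "z \<notin> F" using e by auto
      have "sep (insert z F)"
        using F(1) z by (auto simp: sep_def not_less dist_commute)
      with F have "card (insert z F) \<le> card F" by blast
      then show False using \<open>z \<notin> F\<close> F(1) by (simp add: sep_def)
    qed
    then show ?thesis using F(1) by (auto simp: sep_def)
  qed auto
qed

end

section \<open>First variation along the transport\<close>

lemma Holder_inequality:
  fixes f g :: "'a \<Rightarrow> real"
  assumes p: "p > 1" "q > 1" "1 / p + 1 / q = 1"
    and [measurable]: "f \<in> borel_measurable M" "g \<in> borel_measurable M"
    and nonneg: "\<And>x. f x \<ge> 0" "\<And>x. g x \<ge> 0"
    and int: "integrable M (\<lambda>x. f x powr p)" "integrable M (\<lambda>x. g x powr q)"
  shows "(\<integral>x. f x * g x \<partial>M) \<le> (\<integral>x. f x powr p \<partial>M) powr (1 / p) * (\<integral>x. g x powr q \<partial>M) powr (1 / q)"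
proof -
  define A where "A = (\<integral>x. f x powr p \<partial>M)"
  define B where "B = (\<integral>x. g x powr q \<partial>M)"
  have AB: "A \<ge> 0" "B \<ge> 0" by (auto simp: A_def B_def)
  have int_fg: "integrable M (\<lambda>x. f x * g x)"
  proof (rule Bochner_Integration.integrable_bound)
    show "integrable M (\<lambda>x. f x powr p / p + g x powr q / q)" using int by auto
    show "AE x in M. norm (f x * g x) \<le> norm (f x powr p / p + g x powr q / q)"
      using Youngs_inequality[OF p] nonneg p by (auto intro!: AE_I2 order_trans[OF _ abs_ge_self])
  qed measurable
  \<comment> \<open>The shift by t > 0 avoids dividing by a vanishing norm; it is removed at the end
    by a limit.\<close>
  have le: "(\<integral>x. f x * g x \<partial>M) \<le> (A + t) powr (1 / p) * (B + t) powr (1 / q)" if t: "t > 0" for t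
  proof -
    define a where "a = (A + t) powr (1 / p)"
    define b where "b = (B + t) powr (1 / q)"
    have At: "A + t > 0" "B + t > 0" using AB t by auto
    then have ab: "a > 0" "b > 0" by (simp_all add: a_def b_def)
    have ap: "a powr p = A + t" "b powr q = B + t"
      using At p by (simp_all add: a_def b_def powr_powr)
    have pt: "f x * g x \<le> a * b * (f x powr p / (p * (A + t)) + g x powr q / (q * (B + t)))" for x
    proof -
      have "(f x / a) * (g x / b) \<le> (f x / a) powr p / p + (g x / b) powr q / q"
        using nonneg ab by (intro Youngs_inequality p) (auto simp: divide_nonneg_pos)
      also have "\<dots> = f x powr p / (p * (A + t)) + g x powr q / (q * (B + t))"
        using nonneg ab by (simp add: powr_divide ap mult.commute)
      finally have "a * b * ((f x / a) * (g x / b)) \<le> a * b * (f x powr p / (p * (A + t)) + g x powr q / (q * (B + t)))"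
        using ab by (intro mult_left_mono) auto
      then show ?thesis using ab by simp
    qed
    have "(\<integral>x. f x * g x \<partial>M) \<le> (\<integral>x. a * b * (f x powr p / (p * (A + t)) + g x powr q / (q * (B + t))) \<partial>M)"
      using int int_fg pt by (intro integral_mono) auto
    also have "\<dots> = a * b * (1 / p * (A / (A + t)) + 1 / q * (B / (B + t)))"
      using int by (simp add: A_def B_def)
    also have "\<dots> \<le> a * b * (1 / p * 1 + 1 / q * 1)"
      using ab p AB t by (intro mult_left_mono add_mono) (auto simp: divide_le_eq)
    also have "\<dots> = a * b" using p by simp
    finally show ?thesis by (simp add: a_def b_def)
  qed
  have "((\<lambda>t. (A + t) powr (1 / p) * (B + t) powr (1 / q)) \<longlongrightarrow> (A + 0) powr (1 / p) * (B + 0) powr (1 / q)) (at_right 0)"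
  proof (intro tendsto_mult tendsto_powr' tendsto_add tendsto_const tendsto_ident_at)
    have "eventually (\<lambda>t. t \<in> {0<..<1}) (at_right (0::real))" by (rule eventually_at_right_real) simp
    then have "eventually (\<lambda>t. A + t \<ge> 0 \<and> B + t \<ge> 0) (at_right 0)"
      by eventually_elim (use AB in auto)
    then show "A + 0 \<noteq> 0 \<or> 0 < 1 / p \<and> (\<forall>\<^sub>F t in at_right 0. 0 \<le> A + t)"
      "B + 0 \<noteq> 0 \<or> 0 < 1 / q \<and> (\<forall>\<^sub>F t in at_right 0. 0 \<le> B + t)"
      using p by (auto elim: eventually_mono)
  qed
  moreover have "eventually (\<lambda>t. (\<integral>x. f x * g x \<partial>M) \<le> (A + t) powr (1 / p) * (B + t) powr (1 / q)) (at_right 0)"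
    using eventually_at_right_less[of "0::real"] by eventually_elim (rule le)
  ultimately have "(\<integral>x. f x * g x \<partial>M) \<le> (A + 0) powr (1 / p) * (B + 0) powr (1 / q)"
    by (rule tendsto_lowerbound) simp
  then show ?thesis by (simp add: A_def B_def)
qed

lemma lip_eq_0_outside:
  fixes u :: "'a::metric_space \<Rightarrow> real"
  assumes "\<And>y. y \<notin> cball x0 R \<Longrightarrow> u y = 0" "x \<notin> cball x0 R"
  shows "lip u x = 0"
proof (rule antisym)
  show "lip u x \<le> 0"
  proof (rule lip_le)
    fix e :: real assume "e > 0"
    have "eventually (\<lambda>y. y \<in> - cball x0 R) (at x)"
      using assms(2) by (intro eventually_at_in_open') auto
    then show "eventually (\<lambda>y. \<bar>u y - u x\<bar> \<le> (0 + e) * dist x y) (at x)"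
      by eventually_elim (use assms \<open>e > 0\<close> in auto)
  qed simp
qed simp

context cd0_space
begin

lemma integrable_bounded_support:
  fixes f :: "'a \<Rightarrow> real"
  assumes [measurable]: "f \<in> borel_measurable borel" and "\<And>x. x \<notin> cball x0 R \<Longrightarrow> f x = 0" "\<And>x. \<bar>f x\<bar> \<le> C"
  shows "integrable m f"
proof (rule Bochner_Integration.integrable_bound)
  show "integrable m (\<lambda>x. indicator (cball x0 R) x * C)"
    using emeasure_bounded[of "cball x0 R"] by (intro integrable_mult_left) auto
  show "AE x in m. norm (f x) \<le> norm (indicator (cball x0 R) x * C)"
    using assms(2) order_trans[OF assms(3) abs_ge_self] by (intro AE_I2) (auto simp: indicator_def)
qed (simp add: measurable_m)

text \<open>The first variation at \<open>t = 0\<close> of the Renyi entropy along the transport of \<open>\<rho>0\<close>. The density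
  \<open>\<rho>0\<close> is cut off at the boundary of a ball while the tangent line of the entropy is taken at
  a positive extension \<open>r\<close> of \<open>\<rho>0\<close>; by Bishop-Gromov the mass crossing the boundary contributes
  at most the term with the constant \<open>k\<close>.\<close>

lemma transport_first_variation:
  assumes r [measurable]: "r \<in> borel_measurable borel" and r_pos: "\<And>x. 0 < r x"
    and r_out: "\<And>x. x \<notin> ball x0 R \<Longrightarrow> r x = k"
    and \<rho>0: "prob_dens (\<lambda>x. indicator (ball x0 R) x * r x) (ball x0 R)"
    and g_lip: "L-lipschitz_on UNIV (\<lambda>x. r x powr (- 1 / N))" and g_bd: "\<And>x. r x powr (- 1 / N) \<le> Bd"
    and \<rho>1: "prob_dens \<rho>1 (ball x0 D)" and R: "R > 0" and D: "D > 0"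
  shows "\<exists>\<pi>. transport_plan (\<lambda>x. indicator (ball x0 R) x * r x) \<rho>1 \<pi> \<and>
    (\<integral>x. \<rho>1 x powr (1 - 1 / N) \<partial>m) \<le> (\<integral>x. indicator (ball x0 R) x * r x powr (1 - 1 / N) \<partial>m)
      + k powr (1 - 1 / N) * measure m (ball x0 R) * ((R + D) / R)
      + (1 - 1 / N) * (\<integral>\<gamma>. lip (\<lambda>x. r x powr (- 1 / N)) (ev 0 \<gamma>) * dist (ev 0 \<gamma>) (ev 1 \<gamma>) \<partial>\<pi>)"
proof -
  define \<rho>0 where "\<rho>0 = (\<lambda>x. indicator (ball x0 R) x * r x)"
  define g where "g = (\<lambda>x. r x powr (- 1 / N))"
  define B where "B = ball x0 R"
  define V where "V = measure m B"
  define S0 where "S0 = (\<integral>x. indicator B x * r x powr (1 - 1 / N) \<partial>m)"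
  define S1 where "S1 = (\<integral>x. \<rho>1 x powr (1 - 1 / N) \<partial>m)"
  define T where "T = (R + D) / R"
  have [measurable]: "g \<in> borel_measurable borel" unfolding g_def by measurable
  have \<rho>0': "prob_dens \<rho>0 B" using \<rho>0 by (simp add: \<rho>0_def B_def)
  obtain \<pi> where \<pi>: "transport_plan \<rho>0 \<rho>1 \<pi>" using transport_plan_exists[OF \<rho>0' \<rho>1] by blast
  interpret \<pi>: prob_space \<pi> using \<pi> by (simp add: transport_plan_def)
  have [measurable]: "ev t \<in> borel_measurable \<pi>" for t using \<pi> by (simp add: transport_plan_def)
  have L: "L \<ge> 0" using g_lip by (rule lipschitz_on_nonneg)
  have g_lip': "L-lipschitz_on UNIV g" using g_lip by (simp add: g_def)
  have [measurable]: "lip g \<in> borel_measurable borel" using g_lip' by measurable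
  have g_bound: "\<bar>g x\<bar> \<le> Bd" for x using g_bd[of x] by (simp add: g_def)
  have AE\<pi>: "AE \<gamma> in \<pi>. \<gamma> \<in> geodesics \<and> ev 0 \<gamma> \<in> B \<and> ev 1 \<gamma> \<in> ball x0 D"
    using transport_plan_AE[OF \<pi> \<rho>0' \<rho>1] .
  have intS0: "integrable m (\<lambda>x. indicator B x * r x powr (1 - 1 / N))"
    and S0_eq: "S0 = (\<integral>x. \<rho>0 x powr (1 - 1 / N) \<partial>m)"
  proof -
    have "\<rho>0 x powr (1 - 1 / N) = indicator B x * r x powr (1 - 1 / N)" for x
      by (auto simp: \<rho>0_def B_def indicator_def)
    then show "integrable m (\<lambda>x. indicator B x * r x powr (1 - 1 / N))"
      "S0 = (\<integral>x. \<rho>0 x powr (1 - 1 / N) \<partial>m)"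
      using prob_dens_integrable_powr(1)[OF \<rho>0'] by (auto simp: S0_def)
  qed
  have g0: "(\<integral>\<gamma>. g (ev 0 \<gamma>) \<partial>\<pi>) = S0"
  proof -
    have "(\<integral>\<gamma>. g (ev 0 \<gamma>) \<partial>\<pi>) = (\<integral>x. g x \<partial>distr \<pi> borel (ev 0))"
      by (subst integral_distr) auto
    also have "\<dots> = (\<integral>x. g x \<partial>density m (\<lambda>x. ennreal (\<rho>0 x)))"
      using \<pi> by (simp add: transport_plan_def)
    also have "\<dots> = (\<integral>x. \<rho>0 x * g x \<partial>m)"
      using \<rho>0' by (subst integral_density) (auto simp: prob_dens_def measurable_m)
    also have "\<dots> = S0"
      unfolding S0_def
    proof (intro Bochner_Integration.integral_cong refl)
      fix x
      show "\<rho>0 x * g x = indicator B x * r x powr (1 - 1 / N)"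
        using powr_mult_base[of "r x" "- 1 / N"] r_pos[of x]
        by (simp add: \<rho>0_def g_def B_def indicator_def)
    qed
    finally show ?thesis .
  qed
  have int_g: "integrable \<pi> (\<lambda>\<gamma>. g (ev t \<gamma>))" for t
    using g_bound by (intro \<pi>.integrable_const_bound[of _ Bd]) auto
  have ineq: "S1 - S0 \<le> k powr (1 - 1 / N) * V / N * (((1 + t * T) powr N - 1) / t)
      + (1 - 1 / N) * (\<integral>\<gamma>. (g (ev t \<gamma>) - g (ev 0 \<gamma>)) / t \<partial>\<pi>)" if t: "0 < t" "t \<le> 1" for t
  proof -
    define E where "E = ball x0 (R + t * (R + D))"
    have BE: "B \<subseteq> E" unfolding B_def E_def using t R D by (intro subset_ball) simp
    have E [measurable]: "E \<in> sets borel" and E': "bounded E" "emeasure m E < \<infinity>"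
      using emeasure_bounded[of E] by (auto simp: E_def)
    have B [measurable]: "B \<in> sets borel" by (simp add: B_def)
    have AEt: "AE \<gamma> in \<pi>. ev t \<gamma> \<in> E"
      using AE\<pi>
    proof eventually_elim
      case (elim \<gamma>)
      then show ?case unfolding E_def B_def using t by (intro geodesic_in_ball) auto
    qed
    \<comment> \<open>Geodesics leave B immediately, so the reference is also needed on E - B, where
      it is the constant k.\<close>
    have split: "indicator E x * r x powr (1 - 1 / N)
        = indicator B x * r x powr (1 - 1 / N) + indicator (E - B) x * k powr (1 - 1 / N)" for x
      using BE r_out[of x] by (auto simp: indicator_def B_def)
    have EB_fin: "emeasure m (E - B) < \<infinity>"
      using E' by (intro emeasure_bounded bounded_diff) auto
    have intE: "integrable m (\<lambda>x. indicator E x * r x powr (1 - 1 / N))"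
      unfolding split using intS0 EB_fin by (intro Bochner_Integration.integrable_add integrable_mult_left) auto
    have int_eq: "(\<integral>x. indicator E x * r x powr (1 - 1 / N) \<partial>m) = S0 + k powr (1 - 1 / N) * measure m (E - B)"
      unfolding split S0_def using intS0 EB_fin
      by (subst Bochner_Integration.integral_add) (auto intro!: integrable_mult_left)
    have main: "(1 - t) * S0 + t * S1 \<le> 1 / N * (\<integral>x. indicator E x * r x powr (1 - 1 / N) \<partial>m)
            + (1 - 1 / N) * (\<integral>\<gamma>. g (ev t \<gamma>) \<partial>\<pi>)"
      unfolding S0_eq S1_def g_def
      using \<pi>[unfolded transport_plan_def, THEN conjunct2, THEN conjunct2, THEN conjunct2, THEN conjunct2, THEN conjunct2,
          rule_format, OF _ E E'(2) AEt r r_pos intE g_bd] t by simp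
    have "measure m (E - B) = measure m E - V"
      unfolding V_def using BE E'(2) emeasure_bounded[of B]
      by (intro measure_Diff) (auto simp: B_def)
    \<comment> \<open>The concentric balls E and B have radii of ratio 1 + t T, so Bishop-Gromov
      makes the volume of E - B of first order in t. After division by t it survives as the term
      with k.\<close>
    also have "measure m E \<le> (1 + t * T) powr N * V"
    proof -
      have R': "R + t * (R + D) = R * (1 + t * T)" using R by (simp add: T_def field_simps)
      have pos: "1 + t * T > 0" using t R D by (simp add: T_def add_pos_nonneg)
      have "measure m E / (R + t * (R + D)) powr N \<le> V / R powr N"
        unfolding E_def V_def B_def using R D t by (intro Bishop_Gromov) auto
      then have "measure m E / (R powr N * (1 + t * T) powr N) \<le> V / R powr N"
        unfolding R' using R pos by (simp add: powr_mult)
      then show ?thesis using R pos by (simp add: field_simps)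
    qed
    finally have meas_EB: "measure m (E - B) \<le> V * ((1 + t * T) powr N - 1)" by (simp add: algebra_simps)
    \<comment> \<open>S0 is split with weights 1 / N and 1 - 1 / N: the first part cancels the
      reference integral over B, and the second is the integral of g along the plan at time
      0.\<close>
    have "t * (S1 - S0) = (1 - t) * S0 + t * S1 - S0" by (simp add: algebra_simps)
    also have "\<dots> \<le> 1 / N * (S0 + k powr (1 - 1 / N) * measure m (E - B))
            + (1 - 1 / N) * (\<integral>\<gamma>. g (ev t \<gamma>) \<partial>\<pi>) - (1 / N * S0 + (1 - 1 / N) * S0)"
      using main unfolding int_eq by (simp add: algebra_simps)
    also have "\<dots> = k powr (1 - 1 / N) * measure m (E - B) / N
            + (1 - 1 / N) * ((\<integral>\<gamma>. g (ev t \<gamma>) \<partial>\<pi>) - (\<integral>\<gamma>. g (ev 0 \<gamma>) \<partial>\<pi>))"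
      unfolding g0 by (simp add: algebra_simps)
    also have "\<dots> \<le> k powr (1 - 1 / N) * (V * ((1 + t * T) powr N - 1)) / N
            + (1 - 1 / N) * ((\<integral>\<gamma>. g (ev t \<gamma>) \<partial>\<pi>) - (\<integral>\<gamma>. g (ev 0 \<gamma>) \<partial>\<pi>))"
      using meas_EB N_gt_1 by (intro add_right_mono divide_right_mono mult_left_mono) auto
    also have "(\<integral>\<gamma>. g (ev t \<gamma>) \<partial>\<pi>) - (\<integral>\<gamma>. g (ev 0 \<gamma>) \<partial>\<pi>) = t * (\<integral>\<gamma>. (g (ev t \<gamma>) - g (ev 0 \<gamma>)) / t \<partial>\<pi>)"
      using int_g t by simp
    also have "k powr (1 - 1 / N) * (V * ((1 + t * T) powr N - 1)) / N
            + (1 - 1 / N) * (t * (\<integral>\<gamma>. (g (ev t \<gamma>) - g (ev 0 \<gamma>)) / t \<partial>\<pi>))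
        = t * (k powr (1 - 1 / N) * V / N * (((1 + t * T) powr N - 1) / t)
      + (1 - 1 / N) * (\<integral>\<gamma>. (g (ev t \<gamma>) - g (ev 0 \<gamma>)) / t \<partial>\<pi>))"
    proof -
      have "a * (V * y) / N + c * (t * J) = t * (a * V / N * (y / t) + c * J)" for a y c J :: real
        using t by (simp add: distrib_left)
      then show ?thesis .
    qed
    finally show ?thesis using t by simp
  qed
  define l where "l \<gamma> = lip g (ev 0 \<gamma>) * dist (ev 0 \<gamma>) (ev 1 \<gamma>)" for \<gamma>
  define F where "F n \<gamma> = (g (ev (1 / Suc n) \<gamma>) - g (ev 0 \<gamma>)) / (1 / Suc n)" for n \<gamma>
  define b where "b = L * (R + D)"
  have [measurable]: "l \<in> borel_measurable \<pi>" "F n \<in> borel_measurable \<pi>" for n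
    unfolding l_def F_def by measurable
  have dist01: "AE \<gamma> in \<pi>. dist (ev 0 \<gamma>) (ev 1 \<gamma>) \<le> R + D"
    using AE\<pi>
  proof eventually_elim
    case (elim \<gamma>)
    then show ?case using dist_triangle3[of "ev 0 \<gamma>" "ev 1 \<gamma>" x0] by (auto simp: B_def)
  qed
  have F_bd: "AE \<gamma> in \<pi>. \<bar>F n \<gamma>\<bar> \<le> b" for n
    using AE\<pi> dist01
  proof eventually_elim
    case (elim \<gamma>)
    have "\<bar>g (ev (1 / Suc n) \<gamma>) - g (ev 0 \<gamma>)\<bar> \<le> L * dist (ev 0 \<gamma>) (ev (1 / Suc n) \<gamma>)"
      using lipschitz_onD[OF g_lip', of "ev (1 / Suc n) \<gamma>" "ev 0 \<gamma>"] by (simp add: dist_real_def dist_commute)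
    also have "\<dots> = L * (1 / Suc n * dist (ev 0 \<gamma>) (ev 1 \<gamma>))"
      using elim by (subst geodesics_dist) auto
    also have "\<dots> \<le> L * (1 / Suc n * (R + D))"
      using elim L by (intro mult_left_mono) auto
    finally have le: "\<bar>g (ev (1 / Suc n) \<gamma>) - g (ev 0 \<gamma>)\<bar> \<le> L * (1 / Suc n * (R + D))" .
    have "\<bar>F n \<gamma>\<bar> = \<bar>g (ev (1 / Suc n) \<gamma>) - g (ev 0 \<gamma>)\<bar> * real (Suc n)"
      by (simp add: F_def abs_mult del: of_nat_Suc)
    also have "\<dots> \<le> (L * (1 / Suc n * (R + D))) * real (Suc n)"
      using le by (rule mult_right_mono) simp
    finally show ?case by (simp add: b_def del: of_nat_Suc)
  qed
  have l_bd: "AE \<gamma> in \<pi>. 0 \<le> l \<gamma> \<and> l \<gamma> \<le> b"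
    using dist01
  proof eventually_elim
    case (elim \<gamma>)
    then show ?case
      unfolding l_def b_def using lip_le_lipschitz[OF g_lip', of "ev 0 \<gamma>"] L
      by (auto intro!: mult_mono)
  qed
  have l_int: "integrable \<pi> l"
    using l_bd by (intro \<pi>.integrable_const_bound[of _ b]) auto
  have F_int: "integrable \<pi> (F n)" for n
    using F_bd by (intro \<pi>.integrable_const_bound[of _ b]) auto
  \<comment> \<open>The difference quotients need not converge; only their upper limits are bounded
    by \<open>l\<close>. The maximum with \<open>l\<close> does converge, so that dominated
    convergence acts as a reverse Fatou lemma.\<close>
  have lim_max: "(\<lambda>n. \<integral>\<gamma>. max (F n \<gamma>) (l \<gamma>) \<partial>\<pi>) \<longlonglongrightarrow> (\<integral>\<gamma>. l \<gamma> \<partial>\<pi>)"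
  proof (rule integral_dominated_convergence[where w = "\<lambda>_. b"])
    show "AE \<gamma> in \<pi>. norm (max (F n \<gamma>) (l \<gamma>)) \<le> b" for n
      using F_bd[of n] l_bd by eventually_elim auto
    show "AE \<gamma> in \<pi>. (\<lambda>n. max (F n \<gamma>) (l \<gamma>)) \<longlonglongrightarrow> l \<gamma>"
      using AE\<pi>
    proof eventually_elim
      case (elim \<gamma>)
      define d where "d = dist (ev 0 \<gamma>) (ev 1 \<gamma>)"
      have d: "d \<ge> 0" by (simp add: d_def)
      have dn: "dist (ev 0 \<gamma>) (ev (1 / Suc n) \<gamma>) = d / Suc n" for n
        using geodesics_dist[of \<gamma> "1 / Suc n"] elim by (simp add: d_def)
      have conv: "(\<lambda>n. ev (1 / Suc n) \<gamma>) \<longlonglongrightarrow> ev 0 \<gamma>"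
      proof (rule metric_tendsto_imp_tendsto)
        show "(\<lambda>n. d / Suc n) \<longlonglongrightarrow> 0"
          using LIMSEQ_Suc[OF lim_const_over_n[of d]] .
        show "eventually (\<lambda>n. dist (ev (1 / Suc n) \<gamma>) (ev 0 \<gamma>) \<le> dist (d / Suc n) 0) sequentially"
          unfolding dist_commute[of _ "ev 0 \<gamma>"] dn using d by (intro always_eventually allI) simp
      qed
      show ?case
      proof (rule LIMSEQ_I)
        fix e :: real assume e: "e > 0"
        define e' where "e' = e / (2 * (d + 1))"
        have e': "e' > 0" "e' * d < e"
          using e d by (auto simp: e'_def divide_simps mult_less_cancel_left) 
        have "eventually (\<lambda>y. \<bar>g y - g (ev 0 \<gamma>)\<bar> \<le> (lip g (ev 0 \<gamma>) + e') * dist (ev 0 \<gamma>) y) (at (ev 0 \<gamma>))"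
          by (rule lip_eventually[OF g_lip' e'(1)])
        then have "eventually (\<lambda>y. \<bar>g y - g (ev 0 \<gamma>)\<bar> \<le> (lip g (ev 0 \<gamma>) + e') * dist (ev 0 \<gamma>) y) (nhds (ev 0 \<gamma>))"
          unfolding eventually_at_filter by eventually_elim auto
        from eventually_compose_filterlim[OF this conv]
        obtain n0 where n0: "\<And>n. n \<ge> n0 \<Longrightarrow> \<bar>g (ev (1 / Suc n) \<gamma>) - g (ev 0 \<gamma>)\<bar> \<le> (lip g (ev 0 \<gamma>) + e') * dist (ev 0 \<gamma>) (ev (1 / Suc n) \<gamma>)"
          by (auto simp: eventually_sequentially)
        have "norm (max (F n \<gamma>) (l \<gamma>) - l \<gamma>) < e" if "n \<ge> n0" for n
        proof -
          have "g (ev (1 / Suc n) \<gamma>) - g (ev 0 \<gamma>) \<le> (lip g (ev 0 \<gamma>) + e') * (d / Suc n)"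
            using n0[OF that] unfolding dn by simp
          then have "(g (ev (1 / Suc n) \<gamma>) - g (ev 0 \<gamma>)) * real (Suc n)
              \<le> ((lip g (ev 0 \<gamma>) + e') * (d / Suc n)) * real (Suc n)"
            by (rule mult_right_mono) simp
          then have "F n \<gamma> \<le> (lip g (ev 0 \<gamma>) + e') * d"
            by (simp add: F_def del: of_nat_Suc)
          then have "F n \<gamma> \<le> l \<gamma> + e' * d" by (simp add: l_def d_def algebra_simps)
          then show ?thesis using e'(2) e by (auto simp: max_def)
        qed
        then show "\<exists>no. \<forall>n\<ge>no. norm (max (F n \<gamma>) (l \<gamma>) - l \<gamma>) < e" by blast
      qed
    qed
  qed (auto simp: \<pi>.integrable_const)
  have lim_T: "(\<lambda>n. ((1 + 1 / Suc n * T) powr N - 1) / (1 / Suc n)) \<longlonglongrightarrow> N * T"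
  proof -
    have "((\<lambda>t. (1 + t * T) powr N) has_real_derivative N * T) (at 0)"
      by (auto intro!: derivative_eq_intros)
    then have "((\<lambda>t. ((1 + t * T) powr N - (1 + 0 * T) powr N) / (t - 0)) \<longlongrightarrow> N * T) (at 0)"
      by (simp add: has_field_derivative_iff)
    moreover have "filterlim (\<lambda>n. 1 / real (Suc n)) (at 0) sequentially"
      using LIMSEQ_Suc[OF lim_inverse_n'] by (intro filterlim_atI) auto
    ultimately show ?thesis
      by (auto dest: filterlim_compose)
  qed
  have "(\<lambda>n. k powr (1 - 1 / N) * V / N * (((1 + 1 / Suc n * T) powr N - 1) / (1 / Suc n))
      + (1 - 1 / N) * (\<integral>\<gamma>. max (F n \<gamma>) (l \<gamma>) \<partial>\<pi>))
     \<longlonglongrightarrow> k powr (1 - 1 / N) * V / N * (N * T) + (1 - 1 / N) * (\<integral>\<gamma>. l \<gamma> \<partial>\<pi>)"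
    by (intro tendsto_intros lim_T lim_max)
  moreover have "S1 - S0 \<le> k powr (1 - 1 / N) * V / N * (((1 + 1 / Suc n * T) powr N - 1) / (1 / Suc n))
      + (1 - 1 / N) * (\<integral>\<gamma>. max (F n \<gamma>) (l \<gamma>) \<partial>\<pi>)" for n
  proof -
    have "S1 - S0 \<le> k powr (1 - 1 / N) * V / N * (((1 + 1 / Suc n * T) powr N - 1) / (1 / Suc n))
      + (1 - 1 / N) * (\<integral>\<gamma>. F n \<gamma> \<partial>\<pi>)"
      unfolding F_def by (intro ineq) auto
    also have "(\<integral>\<gamma>. F n \<gamma> \<partial>\<pi>) \<le> (\<integral>\<gamma>. max (F n \<gamma>) (l \<gamma>) \<partial>\<pi>)"
      using F_int l_int by (intro integral_mono integrable_max) auto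
    finally show ?thesis using N_gt_1 by (simp add: mult_left_mono)
  qed
  ultimately have "S1 - S0 \<le> k powr (1 - 1 / N) * V / N * (N * T) + (1 - 1 / N) * (\<integral>\<gamma>. l \<gamma> \<partial>\<pi>)"
    by (intro LIMSEQ_le_const) auto
  then have "S1 \<le> S0 + k powr (1 - 1 / N) * V * T + (1 - 1 / N) * (\<integral>\<gamma>. l \<gamma> \<partial>\<pi>)"
    using N_gt_1 by simp
  then show ?thesis
    using \<pi> unfolding S1_def S0_def V_def T_def l_def g_def B_def \<rho>0_def by blast
qed

end

section \<open>The first variation for a density built from u\<close>

lemma lipschitz_on_compose_bounded_derivative:
  fixes u :: "'a::metric_space \<Rightarrow> real"
  assumes u: "L-lipschitz_on UNIV u" and S: "convex S" "\<And>x. u x \<in> S"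
    and h: "\<And>z. z \<in> S \<Longrightarrow> (h has_real_derivative h' z) (at z within S)" "\<And>z. z \<in> S \<Longrightarrow> \<bar>h' z\<bar> \<le> B"
  shows "(B * L)-lipschitz_on UNIV (\<lambda>x. h (u x))"
proof (rule lipschitz_onI)
  have B: "B \<ge> 0" using h(2)[OF S(2)] abs_ge_zero order_trans by blast
  then show "B * L \<ge> 0" using lipschitz_on_nonneg[OF u] by simp
  fix x y
  have "dist (h (u x)) (h (u y)) \<le> B * dist (u x) (u y)"
    unfolding dist_norm using h by (intro field_differentiable_bound[OF S(1), of h h']) (auto intro: S(2))
  also have "\<dots> \<le> B * (L * dist x y)"
    using lipschitz_onD[OF u, of x y] B by (intro mult_left_mono) auto
  finally show "dist (h (u x)) (h (u y)) \<le> B * L * dist x y" by simp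
qed

context cd0_space
begin

lemma lip_powr_integrable:
  fixes u :: "'a \<Rightarrow> real"
  assumes u: "L-lipschitz_on UNIV u" and out: "\<And>x. x \<notin> cball x0 R \<Longrightarrow> u x = 0" and p: "p > 0"
  shows "integrable m (\<lambda>x. lip u x powr p)"
proof (rule integrable_bounded_support)
  have [measurable]: "lip u \<in> borel_measurable borel" using u by measurable
  show "(\<lambda>x. lip u x powr p) \<in> borel_measurable borel" by measurable
  show "lip u x powr p = 0" if "x \<notin> cball x0 R" for x
    using lip_eq_0_outside[of x0 R u x] out that by auto
  show "\<bar>lip u x powr p\<bar> \<le> L powr p" for x
    using lip_le_lipschitz[OF u, of x] p by (auto intro: powr_mono2)
qed

text \<open>The transport estimate for the density proportional to \<open>(u + e) powr p_star\<close>. The exponent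
  \<open>p_star\<close> is the one for which \<open>lip (r powr (- 1 / N)) powr p * r\<close> is a multiple of \<open>lip u powr p\<close>.\<close>

lemma transport_Sobolev_estimate:
  fixes u :: "'a \<Rightarrow> real" and p :: real
  assumes p: "1 < p" "p < N" and u: "L-lipschitz_on UNIV u" and u_nonneg: "\<And>x. 0 \<le> u x"
    and out: "\<And>x. x \<notin> ball x0 R \<Longrightarrow> u x = 0" and R: "R > 0" and e: "e > 0"
  defines "ps \<equiv> p * N / (N - p)" and "q \<equiv> p / (p - 1)"
  defines "Z \<equiv> (\<integral>x. indicator (ball x0 R) x * (u x + e) powr ps \<partial>m)"
  shows "Z > 0"
    and "\<exists>K. \<forall>D \<rho>1. D > 0 \<longrightarrow> prob_dens \<rho>1 (ball x0 D) \<longrightarrow>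
      (\<integral>x. \<rho>1 x powr (1 - 1 / N) \<partial>m) \<le> K + D * ((e powr ps / Z) powr (1 - 1 / N) * measure m (ball x0 R) / R)
        + (1 - 1 / N) * (ps / N * (1 / Z) powr (1 / ps) * (\<integral>x. lip u x powr p \<partial>m) powr (1 / p))
          * (\<integral>x. dist x0 x powr q * \<rho>1 x \<partial>m) powr (1 / q)"
proof -
  have ps: "ps > 0" using p by (simp add: ps_def)
  then have "ps / N > 0" using N_gt_1 by simp
  then have psN: "- 1 \<le> ps / N" by linarith
  have ps_eq: "p * (ps / N + 1) = ps" and ps_inv: "1 / ps = (1 - p / N) / p"
    using p N_gt_1 by (simp_all add: ps_def field_simps)
  have q: "q > 1" "1 / p + 1 / q = 1" using p by (simp_all add: q_def field_simps)
  define B where "B = ball x0 R"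
  have B [measurable]: "B \<in> sets borel" "bounded B" by (auto simp: B_def)
  have [measurable]: "u \<in> borel_measurable borel"
    using u by (intro LIP_borel_measurable) (auto simp: LIP_def)
  have [measurable]: "lip u \<in> borel_measurable borel" using u by measurable
  have L: "L \<ge> 0" using u by (rule lipschitz_on_nonneg)
  define U where "U = u x0 + L * R"
  have U: "U \<ge> 0" using u_nonneg[of x0] L R by (simp add: U_def)
  have u_bd: "u x \<le> U" for x
  proof (cases "x \<in> B")
    case True
    have "u x \<le> u x0 + L * dist x x0"
      using lipschitz_onD[OF u, of x x0] by (simp add: dist_real_def)
    also have "L * dist x x0 \<le> L * R"
      using True L by (intro mult_left_mono) (auto simp: B_def dist_commute)
    finally show ?thesis by (simp add: U_def)
  next
    case False
    then show ?thesis using out U by (simp add: B_def)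
  qed
  define w where "w x = u x + e" for x
  have w: "w x > 0" "w x \<ge> e" "w x \<le> U + e" for x
    using u_nonneg[of x] e u_bd[of x] by (auto simp: w_def)
  have [measurable]: "w \<in> borel_measurable borel" unfolding w_def by measurable
  have int_Z: "integrable m (\<lambda>x. indicator B x * w x powr ps)"
  proof (rule integrable_bounded_support[where C = "(U + e) powr ps"])
    show "(indicator B x * w x powr ps :: real) = 0" if "x \<notin> cball x0 R" for x
      using that by (auto simp: B_def indicator_def)
    show "\<bar>indicator B x * w x powr ps\<bar> \<le> (U + e) powr ps" for x
      using w[of x] ps by (auto simp: indicator_def intro!: powr_mono2)
  qed measurable
  have Z_eq: "Z = (\<integral>x. indicator B x * w x powr ps \<partial>m)" by (simp add: Z_def B_def w_def)
  have intB: "integrable m (indicator B :: 'a \<Rightarrow> real)"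
    using emeasure_bounded[OF B] by auto
  show Z: "Z > 0"
  proof -
    have "0 < e powr ps * measure m B" using e R by (simp add: B_def measure_ball_pos)
    also have "\<dots> = (\<integral>x. e powr ps * indicator B x \<partial>m)" using emeasure_bounded[OF B] by simp
    also have "\<dots> \<le> Z"
      unfolding Z_eq
    proof (rule integral_mono)
      show "e powr ps * indicator B x \<le> indicator B x * w x powr ps" for x
        using w[of x] e ps by (auto simp: indicator_def intro!: powr_mono2)
    qed (use intB int_Z in auto)
    finally show ?thesis .
  qed
  define c where "c = 1 / Z"
  have c: "c > 0" using Z by (simp add: c_def)
  define r where "r x = c * w x powr ps" for x
  \<comment> \<open>As e > 0, this negative power is smooth with bounded derivative on the half-line
    that contains the values of u; hence g is bounded and Lipschitz although u vanishes outside the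
    ball.\<close>
  define h where "h z = c powr (- 1 / N) * (z + e) powr (- ps / N)" for z
  define h' where "h' z = c powr (- 1 / N) * (- ps / N * (z + e) powr (- ps / N - 1))" for z
  define g where "g = (\<lambda>x. r x powr (- 1 / N))"
  have g_eq: "g = (\<lambda>x. h (u x))"
    using c w by (auto simp: g_def h_def r_def powr_mult powr_powr w_def)
  have h_deriv: "(h has_real_derivative h' z) (at z)" if "z \<ge> 0" for z
    unfolding h_def h'_def using that e by (auto intro!: derivative_eq_intros)
  define H where "H = c powr (- 1 / N) * (ps / N * e powr (- ps / N - 1))"
  have h'_abs: "\<bar>h' z\<bar> = c powr (- 1 / N) * (ps / N * (z + e) powr (- ps / N - 1))" for z
    using ps N_gt_1 by (simp add: h'_def abs_mult)
  have h'_bd: "\<bar>h' z\<bar> \<le> H" if "z \<ge> 0" for z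
    unfolding h'_abs H_def using that e ps N_gt_1 psN
    by (intro mult_left_mono powr_mono2') auto
  have g_lip: "(H * L)-lipschitz_on UNIV g"
    unfolding g_eq
  proof (rule lipschitz_on_compose_bounded_derivative[OF u, of "{0..}" h h'])
    show "(h has_real_derivative h' z) (at z within {0..})" if "z \<in> {0..}" for z
      using h_deriv[of z] that by (auto intro: has_field_derivative_at_within)
  qed (use u_nonneg h'_bd in auto)
  have [measurable]: "lip g \<in> borel_measurable borel" using g_lip by measurable
  have g_bd: "r x powr (- 1 / N) \<le> c powr (- 1 / N) * e powr (- ps / N)" for x
  proof -
    have "r x powr (- 1 / N) = h (u x)" using g_eq by (simp add: g_def fun_eq_iff)
    also have "\<dots> \<le> c powr (- 1 / N) * e powr (- ps / N)"
      unfolding h_def using e u_nonneg[of x] ps N_gt_1 by (intro mult_left_mono powr_mono2') auto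
    finally show ?thesis .
  qed
  have r_pos: "r x > 0" for x using c w[of x] by (simp add: r_def)
  have [measurable]: "r \<in> borel_measurable borel" unfolding r_def by measurable
  have \<rho>0: "prob_dens (\<lambda>x. indicator B x * r x) B"
    unfolding prob_dens_def
  proof (intro conjI allI impI B)
    have "(\<integral>\<^sup>+x. ennreal (indicator B x * r x) \<partial>m) = (\<integral>\<^sup>+x. ennreal (c * (indicator B x * w x powr ps)) \<partial>m)"
      by (simp add: r_def mult_ac)
    also have "\<dots> = ennreal (\<integral>x. c * (indicator B x * w x powr ps) \<partial>m)"
      using int_Z c by (intro nn_integral_eq_integral) auto
    also have "(\<integral>x. c * (indicator B x * w x powr ps) \<partial>m) = 1"
      using Z by (simp add: Z_eq[symmetric] c_def)
    finally show "(\<integral>\<^sup>+x. ennreal (indicator B x * r x) \<partial>m) = 1" by simp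
  qed (use less_imp_le[OF r_pos] in auto)
  define k where "k = c * e powr ps"
  have r_out: "r x = k" if "x \<notin> ball x0 R" for x using out[OF that] by (simp add: r_def k_def w_def)
  define I where "I = (\<integral>x. lip u x powr p \<partial>m)"
  have int_I: "integrable m (\<lambda>x. lip u x powr p)"
    using out p by (intro lip_powr_integrable[OF u, of x0 R]) auto
  define S0 where "S0 = (\<integral>x. indicator B x * r x powr (1 - 1 / N) \<partial>m)"
  have lip_g: "lip g x powr p * (indicator B x * r x) \<le> (ps / N) powr p * c powr (1 - p / N) * lip u x powr p" for x
  proof -
    have "lip g x \<le> \<bar>h' (u x)\<bar> * lip u x"
      unfolding g_eq by (rule lip_chain_le[OF u h_deriv]) (rule u_nonneg)
    then have "lip g x powr p \<le> (\<bar>h' (u x)\<bar> * lip u x) powr p"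
      using p by (intro powr_mono2) auto
    also have "\<dots> = (ps / N) powr p * (c powr (- p / N) * w x powr (- ps)) * lip u x powr p"
    proof -
      have "(w x powr (- ps / N - 1)) powr p = w x powr (- ps)"
      proof -
        have "(- ps / N - 1) * p = - ps" using ps_eq by (simp add: algebra_simps)
        then show ?thesis by (simp only: powr_powr)
      qed
      moreover have "(c powr (- 1 / N)) powr p = c powr (- p / N)"
        by (simp add: powr_powr)
      moreover have "(a * (b * d) * l) powr p = b powr p * (a powr p * d powr p) * l powr p"
        if "a \<ge> 0" "b \<ge> 0" "d \<ge> 0" "l \<ge> 0" for a b d l :: real
        using that by (simp add: powr_mult)
      from this[of "c powr (- 1 / N)" "ps / N" "w x powr (- ps / N - 1)" "lip u x"]
      have "(\<bar>h' (u x)\<bar> * lip u x) powr p = (ps / N) powr p * ((c powr (- 1 / N)) powr p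
          * (w x powr (- ps / N - 1)) powr p) * lip u x powr p"
        unfolding h'_abs w_def[symmetric] using ps N_gt_1 by simp
      ultimately show ?thesis by (simp only:)
    qed
    finally have "lip g x powr p * r x \<le> (ps / N) powr p * (c powr (- p / N) * w x powr (- ps)) * lip u x powr p * r x"
      using r_pos[of x] by (intro mult_right_mono) auto
    also have "\<dots> = (ps / N) powr p * (c powr (- p / N) * c) * (w x powr (- ps) * w x powr ps) * lip u x powr p"
      by (simp add: r_def)
    also have "w x powr (- ps) * w x powr ps = 1" using w[of x] by (simp add: powr_minus)
    also have "c powr (- p / N) * c = c powr (1 - p / N)"
      using c powr_mult_base[of c "- p / N"] by (simp add: mult.commute)
    finally show ?thesis by (simp add: indicator_def)
  qed
  show "\<exists>K. \<forall>D \<rho>1. D > 0 \<longrightarrow> prob_dens \<rho>1 (ball x0 D) \<longrightarrow>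
      (\<integral>x. \<rho>1 x powr (1 - 1 / N) \<partial>m) \<le> K + D * ((e powr ps / Z) powr (1 - 1 / N) * measure m (ball x0 R) / R)
        + (1 - 1 / N) * (ps / N * (1 / Z) powr (1 / ps) * (\<integral>x. lip u x powr p \<partial>m) powr (1 / p))
          * (\<integral>x. dist x0 x powr q * \<rho>1 x \<partial>m) powr (1 / q)"
  \<comment> \<open>The witness gathers all terms that depend neither on D nor on the target
    density. They stay bounded while the target spreads out.\<close>
  proof (intro exI[of _ "S0 + k powr (1 - 1 / N) * measure m B + (1 - 1 / N) * (H * L * R)"] allI impI)
    fix D \<rho>1 assume D: "D > 0" and \<rho>1: "prob_dens \<rho>1 (ball x0 D)"
    have [measurable]: "\<rho>1 \<in> borel_measurable borel" using \<rho>1 by (simp add: prob_dens_def)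
    have \<rho>1_nonneg: "\<rho>1 x \<ge> 0" for x using \<rho>1 by (simp add: prob_dens_def)
    obtain \<pi> where \<pi>: "transport_plan (\<lambda>x. indicator B x * r x) \<rho>1 \<pi>"
      and main: "(\<integral>x. \<rho>1 x powr (1 - 1 / N) \<partial>m) \<le> S0 + k powr (1 - 1 / N) * measure m B * ((R + D) / R)
      + (1 - 1 / N) * (\<integral>\<gamma>. lip g (ev 0 \<gamma>) * dist (ev 0 \<gamma>) (ev 1 \<gamma>) \<partial>\<pi>)"
      using transport_first_variation[of r x0 R k "H * L" "c powr (- 1 / N) * e powr (- ps / N)" \<rho>1 D]
        r_pos r_out \<rho>0 g_lip g_bd \<rho>1 R D by (auto simp: B_def g_def S0_def)
    interpret \<pi>: prob_space \<pi> using \<pi> by (simp add: transport_plan_def)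
    have [measurable]: "ev t \<in> borel_measurable \<pi>" for t using \<pi> by (simp add: transport_plan_def)
    have AE\<pi>: "AE \<gamma> in \<pi>. \<gamma> \<in> geodesics \<and> ev 0 \<gamma> \<in> B \<and> ev 1 \<gamma> \<in> ball x0 D"
      using transport_plan_AE[OF \<pi> \<rho>0 \<rho>1] .
    define f1 where "f1 \<gamma> = lip g (ev 0 \<gamma>)" for \<gamma> :: "real \<Rightarrow>\<^sub>C 'a"
    define f2 where "f2 \<gamma> = dist x0 (ev 1 \<gamma>)" for \<gamma> :: "real \<Rightarrow>\<^sub>C 'a"
    have [measurable]: "f1 \<in> borel_measurable \<pi>" "f2 \<in> borel_measurable \<pi>"
      unfolding f1_def f2_def by measurable
    have f1: "0 \<le> f1 \<gamma>" "f1 \<gamma> \<le> H * L" for \<gamma>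
      using lip_le_lipschitz[OF g_lip] by (auto simp: f1_def)
    have f2: "AE \<gamma> in \<pi>. 0 \<le> f2 \<gamma> \<and> f2 \<gamma> \<le> D"
      using AE\<pi> by eventually_elim (auto simp: f2_def)
    have HL: "H * L \<ge> 0" using g_lip by (rule lipschitz_on_nonneg)
    have int_f12: "integrable \<pi> (\<lambda>\<gamma>. f1 \<gamma> * f2 \<gamma>)"
    proof (rule \<pi>.integrable_const_bound[of _ "H * L * D"])
      show "AE \<gamma> in \<pi>. norm (f1 \<gamma> * f2 \<gamma>) \<le> H * L * D"
        using f2 by eventually_elim (use f1 HL in \<open>auto intro!: mult_mono simp: abs_mult\<close>)
    qed measurable
    have int_f1p: "integrable \<pi> (\<lambda>\<gamma>. f1 \<gamma> powr p)"
      using f1 p by (intro \<pi>.integrable_const_bound[of _ "(H * L) powr p"]) (auto intro!: AE_I2 powr_mono2)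
    have int_f2q: "integrable \<pi> (\<lambda>\<gamma>. f2 \<gamma> powr q)"
    proof (rule \<pi>.integrable_const_bound[of _ "D powr q"])
      show "AE \<gamma> in \<pi>. norm (f2 \<gamma> powr q) \<le> D powr q"
        using f2 by eventually_elim (use q in \<open>auto intro!: powr_mono2\<close>)
    qed measurable
    \<comment> \<open>A geodesic starts within R of x0, so its length is at most R plus the distance
      of its end to x0; the part with R goes into the witness.\<close>
    have "(\<integral>\<gamma>. lip g (ev 0 \<gamma>) * dist (ev 0 \<gamma>) (ev 1 \<gamma>) \<partial>\<pi>) \<le> (\<integral>\<gamma>. H * L * R + f1 \<gamma> * f2 \<gamma> \<partial>\<pi>)"
    proof (rule integral_mono_AE')
      show "AE \<gamma> in \<pi>. lip g (ev 0 \<gamma>) * dist (ev 0 \<gamma>) (ev 1 \<gamma>) \<le> H * L * R + f1 \<gamma> * f2 \<gamma>"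
        using AE\<pi>
      proof eventually_elim
        case (elim \<gamma>)
        then have "dist (ev 0 \<gamma>) (ev 1 \<gamma>) \<le> R + f2 \<gamma>"
          using dist_triangle3[of "ev 0 \<gamma>" "ev 1 \<gamma>" x0] by (simp add: B_def f2_def)
        then have "f1 \<gamma> * dist (ev 0 \<gamma>) (ev 1 \<gamma>) \<le> f1 \<gamma> * (R + f2 \<gamma>)"
          using f1 by (intro mult_left_mono)
        also have "\<dots> \<le> H * L * R + f1 \<gamma> * f2 \<gamma>"
          using f1[of \<gamma>] R by (simp add: distrib_left mult_right_mono)
        finally show ?case by (simp add: f1_def)
      qed
      show "AE \<gamma> in \<pi>. 0 \<le> H * L * R + f1 \<gamma> * f2 \<gamma>"
        using f2 by eventually_elim (use HL R f1(1) in auto)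
    qed (use int_f12 in auto)
    also have "\<dots> = H * L * R + (\<integral>\<gamma>. f1 \<gamma> * f2 \<gamma> \<partial>\<pi>)"
      using int_f12 by (simp add: \<pi>.prob_space)
    \<comment> \<open>Hoelder decouples the two ends: the first factor depends on the plan only
      through the initial density, the second only through the target. No knowledge of the coupling
      is required.\<close>
    also have "(\<integral>\<gamma>. f1 \<gamma> * f2 \<gamma> \<partial>\<pi>) \<le> (\<integral>\<gamma>. f1 \<gamma> powr p \<partial>\<pi>) powr (1 / p) * (\<integral>\<gamma>. f2 \<gamma> powr q \<partial>\<pi>) powr (1 / q)"
      using p(1) q f1(1) int_f1p int_f2q by (intro Holder_inequality) (auto simp: f2_def)
    also have "(\<integral>\<gamma>. f2 \<gamma> powr q \<partial>\<pi>) = (\<integral>x. dist x0 x powr q * \<rho>1 x \<partial>m)"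
    proof -
      have "(\<integral>\<gamma>. f2 \<gamma> powr q \<partial>\<pi>) = (\<integral>x. dist x0 x powr q \<partial>distr \<pi> borel (ev 1))"
        unfolding f2_def by (subst integral_distr) auto
      also have "\<dots> = (\<integral>x. dist x0 x powr q \<partial>density m (\<lambda>x. ennreal (\<rho>1 x)))"
        using \<pi> by (simp add: transport_plan_def)
      also have "\<dots> = (\<integral>x. dist x0 x powr q * \<rho>1 x \<partial>m)"
        using \<rho>1_nonneg by (subst integral_density) (auto simp: measurable_m mult.commute)
      finally show ?thesis .
    qed
    also have "(\<integral>\<gamma>. f1 \<gamma> powr p \<partial>\<pi>) powr (1 / p) \<le> ps / N * c powr (1 / ps) * I powr (1 / p)"
    proof -
      have "(\<integral>\<gamma>. f1 \<gamma> powr p \<partial>\<pi>) = (\<integral>x. lip g x powr p \<partial>distr \<pi> borel (ev 0))"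
        unfolding f1_def by (subst integral_distr) auto
      also have "\<dots> = (\<integral>x. lip g x powr p \<partial>density m (\<lambda>x. ennreal (indicator B x * r x)))"
        using \<pi> by (simp add: transport_plan_def)
      also have "\<dots> = (\<integral>x. lip g x powr p * (indicator B x * r x) \<partial>m)"
        using less_imp_le[OF r_pos] by (subst integral_density) (auto simp: measurable_m mult.commute)
      also have "\<dots> \<le> (\<integral>x. (ps / N) powr p * c powr (1 - p / N) * lip u x powr p \<partial>m)"
        using int_I lip_g less_imp_le[OF r_pos] by (intro integral_mono_AE') auto
      also have "\<dots> = (ps / N) powr p * c powr (1 - p / N) * I" by (simp add: I_def)
      finally have "(\<integral>\<gamma>. f1 \<gamma> powr p \<partial>\<pi>) powr (1 / p) \<le> ((ps / N) powr p * c powr (1 - p / N) * I) powr (1 / p)"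
        using p by (intro powr_mono2) auto
      also have "\<dots> = ps / N * c powr (1 / ps) * I powr (1 / p)"
        using ps N_gt_1 p c ps_inv by (simp add: powr_mult powr_powr I_def)
      finally show ?thesis .
    qed
    finally have "(\<integral>\<gamma>. lip g (ev 0 \<gamma>) * dist (ev 0 \<gamma>) (ev 1 \<gamma>) \<partial>\<pi>)
      \<le> H * L * R + ps / N * c powr (1 / ps) * I powr (1 / p) * (\<integral>x. dist x0 x powr q * \<rho>1 x \<partial>m) powr (1 / q)"
      by (simp add: mult_right_mono)
    then have "(1 - 1 / N) * (\<integral>\<gamma>. lip g (ev 0 \<gamma>) * dist (ev 0 \<gamma>) (ev 1 \<gamma>) \<partial>\<pi>)
      \<le> (1 - 1 / N) * (H * L * R + ps / N * c powr (1 / ps) * I powr (1 / p) * (\<integral>x. dist x0 x powr q * \<rho>1 x \<partial>m) powr (1 / q))"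
      using N_gt_1 by (intro mult_left_mono) auto
    moreover have "k powr (1 - 1 / N) * measure m B * ((R + D) / R)
      = k powr (1 - 1 / N) * measure m B + D * ((e powr ps / Z) powr (1 - 1 / N) * measure m B / R)"
      using R by (simp add: k_def c_def field_simps)
    ultimately show "(\<integral>x. \<rho>1 x powr (1 - 1 / N) \<partial>m) \<le> S0 + k powr (1 - 1 / N) * measure m B + (1 - 1 / N) * (H * L * R)
        + D * ((e powr ps / Z) powr (1 - 1 / N) * measure m (ball x0 R) / R)
        + (1 - 1 / N) * (ps / N * (1 / Z) powr (1 / ps) * (\<integral>x. lip u x powr p \<partial>m) powr (1 / p))
          * (\<integral>x. dist x0 x powr q * \<rho>1 x \<partial>m) powr (1 / q)"
      using main by (simp add: algebra_simps c_def I_def B_def)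
  qed
qed

end

section \<open>Radial integrals\<close>

text \<open>With the absolute value the power is differentiable on the whole line, 0 included, since
  q > 1. Substitution and the fundamental theorem on closed intervals starting at 0 then apply
  directly.\<close>

lemma has_real_derivative_abs_powr:
  fixes q r :: real
  assumes q: "q > 1"
  shows "((\<lambda>r. \<bar>r\<bar> powr q) has_real_derivative q * \<bar>r\<bar> powr (q - 1) * sgn r) (at r)"
proof -
  consider "r > 0" | "r < 0" | "r = 0" by linarith
  then show ?thesis
  proof cases
    case 1
    have "((\<lambda>r. r powr q) has_real_derivative q * r powr (q - 1)) (at r)"
      using 1 by (auto intro!: derivative_eq_intros)
    moreover have "eventually (\<lambda>x. x powr q = \<bar>x\<bar> powr q) (nhds r)"
      using eventually_gt_at_top eventually_nhds_in_open[of "{0<..}" r] 1 by (auto elim: eventually_mono)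
    ultimately show ?thesis
      using 1 by (auto simp: DERIV_cong_ev)
  next
    case 2
    have "((\<lambda>r. (- r) powr q) has_real_derivative - (q * (- r) powr (q - 1))) (at r)"
      using 2 by (auto intro!: derivative_eq_intros)
    moreover have "eventually (\<lambda>x. (- x) powr q = \<bar>x\<bar> powr q) (nhds r)"
      using eventually_nhds_in_open[of "{..<0}" r] 2 by (auto elim: eventually_mono)
    ultimately show ?thesis
      using 2 by (auto simp: DERIV_cong_ev)
  next
    case 3
    have "((\<lambda>h. \<bar>h\<bar> powr q / h) \<longlongrightarrow> 0) (at 0)"
    proof (rule Lim_null_comparison)
      have "\<bar>h\<bar> powr q = \<bar>h\<bar> * \<bar>h\<bar> powr (q - 1)" for h :: real
        using powr_mult_base[of "\<bar>h\<bar>" "q - 1"] by simp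
      then show "eventually (\<lambda>h. norm (\<bar>h\<bar> powr q / h) \<le> \<bar>h\<bar> powr (q - 1)) (at (0::real))"
        by (intro always_eventually) auto
      show "((\<lambda>h. \<bar>h\<bar> powr (q - 1)) \<longlongrightarrow> 0) (at (0::real))"
        using q by (auto intro!: tendsto_eq_intros)
    qed
    then show ?thesis using 3 by (simp add: has_field_derivative_iff)
  qed
qed

text \<open>The substitution x = r^q / (1 + r^q) maps the half-line onto [0, 1) and turns the
  integrand into q times smaller than that of the Beta integral. It is made on the intervals from 0
  to n, followed by monotone convergence on both sides.\<close>

lemma Beta_half_line:
  fixes a b q :: real
  assumes a: "a > 0" and b: "b > 0" and q: "q > 1"
  shows "(\<integral>\<^sup>+r. ennreal (indicator {0..} r * (r powr (a * q - 1) * (1 + r powr q) powr (- (a + b)))) \<partial>lborel)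
    = ennreal (Beta a b / q)"
proof -
  define F where "F x = x powr (a - 1) * (1 - x) powr (b - 1)" for x :: real
  define G where "G r = \<bar>r\<bar> powr q / (1 + \<bar>r\<bar> powr q)" for r :: real
  define G' where "G' r = q * \<bar>r\<bar> powr (q - 1) * sgn r / (1 + \<bar>r\<bar> powr q)\<^sup>2" for r :: real
  define k where "k r = r powr (a * q - 1) * (1 + r powr q) powr (- (a + b))" for r :: real
  have [measurable]: "F \<in> borel_measurable borel" "k \<in> borel_measurable borel"
    unfolding F_def k_def by measurable
  have one: "1 + \<bar>r\<bar> powr q > 0" for r :: real by (simp add: add_pos_nonneg)
  have G_deriv: "(G has_real_derivative G' r) (at r)" for r
  proof -
    note d = has_real_derivative_abs_powr[OF q, of r]
    have "((\<lambda>r. \<bar>r\<bar> powr q / (1 + \<bar>r\<bar> powr q)) has_real_derivative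
      (q * \<bar>r\<bar> powr (q - 1) * sgn r * (1 + \<bar>r\<bar> powr q) - \<bar>r\<bar> powr q * (0 + q * \<bar>r\<bar> powr (q - 1) * sgn r))
      / ((1 + \<bar>r\<bar> powr q) * (1 + \<bar>r\<bar> powr q))) (at r)"
      using one[of r] by (intro DERIV_divide DERIV_add DERIV_const d) auto
    then show ?thesis
      unfolding G_def G'_def by (rule DERIV_cong) (simp add: power2_eq_square algebra_simps)
  qed
  have contG': "continuous_on {0..n} G'" for n :: real
  proof -
    have "continuous_on {0..n} (\<lambda>r. q * \<bar>r\<bar> powr (q - 1) / (1 + \<bar>r\<bar> powr q)\<^sup>2)"
    proof -
      have c: "continuous_on {0..n} (\<lambda>r. \<bar>r\<bar> powr s)" if "s > 0" for s
        using that by (intro continuous_on_powr' continuous_on_rabs continuous_on_id continuous_on_const) auto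
      have "1 + r powr q \<noteq> 0" for r :: real using powr_ge_zero[of r q] by linarith
      then show ?thesis
        using q by (intro continuous_on_divide continuous_on_mult continuous_on_const continuous_on_power
            continuous_on_add c) auto
    qed
    then show ?thesis
      by (rule continuous_on_eq) (use q in \<open>auto simp: G'_def sgn_if\<close>)
  qed
  have FG: "F (G r) * G' r = q * k r" if "r \<ge> 0" for r
  proof (cases "r = 0")
    case False
    with that have r: "r > 0" by simp
    define S where "S = 1 + r powr q"
    have S: "S > 0" using one[of r] r by (simp add: S_def)
    have G: "G r = r powr q * S powr (- 1)" "1 - G r = S powr (- 1)"
      using r S by (auto simp: G_def S_def powr_minus field_simps)
    have "F (G r) * G' r = (r powr q * S powr (- 1)) powr (a - 1) * (S powr (- 1)) powr (b - 1) * (q * r powr (q - 1) * S powr (- 2))"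
      unfolding F_def G(2) unfolding G(1) G'_def using r S by (simp add: S_def powr_minus divide_inverse)
    also have "\<dots> = q * ((r powr (q * (a - 1)) * r powr (q - 1)) * (S powr (- (a - 1)) * S powr (- (b - 1)) * S powr (- 2)))"
    proof -
      have "(r powr q * S powr (- 1)) powr (a - 1) = r powr (q * (a - 1)) * S powr (- (a - 1))"
        by (subst powr_mult) (simp_all only: powr_ge_zero powr_powr mult_minus_left mult_1_left)
      moreover have "(S powr (- 1)) powr (b - 1) = S powr (- (b - 1))"
        by (simp only: powr_powr mult_minus_left mult_1_left)
      ultimately show ?thesis by (simp only: mult_ac)
    qed
    also have "\<dots> = q * (r powr (q * (a - 1) + (q - 1)) * S powr (- (a - 1) + - (b - 1) + - 2))"
      by (simp only: powr_add)
    also have "\<dots> = q * k r"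
      by (simp add: k_def S_def algebra_simps)
    finally show ?thesis .
  qed (simp add: F_def G_def G'_def k_def)
  have eq: "(\<integral>\<^sup>+x. ennreal (F x) * indicator {0..G n} x \<partial>lborel)
      = ennreal q * (\<integral>\<^sup>+r. ennreal (k r) * indicator {0..n} r \<partial>lborel)" if "n \<ge> 0" for n
  proof -
    have "(\<integral>\<^sup>+x. ennreal (F x) * indicator {G 0..G n} x \<partial>lborel)
        = (\<integral>\<^sup>+x. ennreal (F x * indicator {G 0..G n} x) \<partial>lborel)"
      by (intro nn_integral_cong) (auto simp: indicator_def)
    also have "\<dots> = (\<integral>\<^sup>+x. ennreal (F (G x) * G' x * indicator {0..n} x) \<partial>lborel)"
    proof (rule nn_integral_substitution[OF _ _ contG'])
      show "set_borel_measurable borel {G 0..G n} F"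
        unfolding set_borel_measurable_def by measurable
      show "G' r \<ge> 0" if "r \<in> {0..n}" for r using that q by (auto simp: G'_def sgn_if)
    qed (use G_deriv that in auto)
    also have "\<dots> = (\<integral>\<^sup>+r. ennreal q * (ennreal (k r) * indicator {0..n} r) \<partial>lborel)"
      using q FG by (intro nn_integral_cong) (auto simp: indicator_def ennreal_mult k_def)
    also have "\<dots> = ennreal q * (\<integral>\<^sup>+r. ennreal (k r) * indicator {0..n} r \<partial>lborel)"
      by (rule nn_integral_cmult) measurable
    finally show ?thesis by (simp add: G_def)
  qed
  have G_mono: "G r \<le> G s" if "0 \<le> r" "r \<le> s" for r s
  proof -
    have "r powr q \<le> s powr q" using that q by (intro powr_mono2) auto
    then show ?thesis using that one[of r] one[of s] by (simp add: G_def field_simps)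
  qed
  have G_less: "G r < 1" for r using one[of r] by (simp add: G_def field_simps)
  have G_lim: "(\<lambda>n. G (real n)) \<longlonglongrightarrow> 1"
  proof -
    have "filterlim (\<lambda>n. 1 + real n powr q) at_top sequentially"
      using q by (intro filterlim_tendsto_add_at_top[OF tendsto_const] filterlim_compose[OF real_powr_at_top] filterlim_real_sequentially) auto
    then have "(\<lambda>n. 1 - inverse (1 + real n powr q)) \<longlonglongrightarrow> 1 - 0"
      by (intro tendsto_intros tendsto_inverse_0_at_top)
    moreover have "1 - inverse (1 + real n powr q) = G (real n)" for n
      using one[of "real n"] by (simp add: G_def field_simps)
    ultimately show ?thesis by simp
  qed
  have lim1: "(\<lambda>n. \<integral>\<^sup>+x. ennreal (F x) * indicator {0..G (real n)} x \<partial>lborel)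
      \<longlonglongrightarrow> (\<integral>\<^sup>+x. ennreal (F x) * indicator {0..1} x \<partial>lborel)"
  proof (rule nn_integral_LIMSEQ)
    show "incseq (\<lambda>n x. ennreal (F x) * indicator {0..G (real n)} x)"
      using G_mono by (intro monoI le_funI mult_left_mono) (auto simp: indicator_def intro: order_trans)
    show "(\<lambda>n. ennreal (F x) * indicator {0..G (real n)} x) \<longlonglongrightarrow> ennreal (F x) * indicator {0..1} x" for x
    proof (cases "0 \<le> x \<and> x < 1")
      case True
      then have "eventually (\<lambda>n. x < G (real n)) sequentially"
        using G_lim by (intro order_tendstoD) auto
      then have "eventually (\<lambda>n. ennreal (F x) * indicator {0..G (real n)} x = ennreal (F x) * indicator {0..1} x) sequentially"
        by eventually_elim (use True in auto)
      then show ?thesis by (rule tendsto_eventually)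
    next
      case False
      \<comment> \<open>The endpoint 1 is never reached by \<open>G\<close>, but \<open>F 1\<close>
        is 0 for every b since 0 powr (b - 1) is 0.\<close>
      then have "ennreal (F x) * indicator {0..G (real n)} x = ennreal (F x) * indicator {0..1} x" for n
        using G_less[of "real n"] by (cases "x = 1") (auto simp: indicator_def F_def)
      then show ?thesis by simp
    qed
  qed measurable
  have int_F: "(\<integral>\<^sup>+x. ennreal (F x) * indicator {0..1} x \<partial>lborel) = ennreal (Beta a b)"
  proof -
    have "((\<lambda>x. if x \<in> {0..1} then F x else 0) has_integral Beta a b) UNIV"
      using has_integral_Beta_real[OF a b] unfolding has_integral_restrict_UNIV F_def[abs_def] .
    then have "(\<integral>\<^sup>+x. ennreal (if x \<in> {0..1} then F x else 0) \<partial>lborel) = ennreal (Beta a b)"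
      by (intro nn_integral_has_integral_lborel) (auto simp: F_def)
    moreover have "ennreal (F x) * indicator {0..1} x = ennreal (if x \<in> {0..1} then F x else 0)" for x
      by (simp add: indicator_def)
    ultimately show ?thesis by simp
  qed
  have lim2: "(\<lambda>n. \<integral>\<^sup>+x. ennreal (F x) * indicator {0..G (real n)} x \<partial>lborel)
      \<longlonglongrightarrow> ennreal q * (\<integral>\<^sup>+r. ennreal (k r) * indicator {0..} r \<partial>lborel)"
    unfolding eq[OF of_nat_0_le_iff]
  proof (rule ennreal_tendsto_cmult[OF _ nn_integral_LIMSEQ])
    show "incseq (\<lambda>n x. ennreal (k x) * indicator {0..real n} x)"
      by (intro monoI le_funI mult_left_mono) (auto simp: indicator_def)
    show "(\<lambda>n. ennreal (k x) * indicator {0..real n} x) \<longlonglongrightarrow> ennreal (k x) * indicator {0..} x" for x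
    proof -
      have "eventually (\<lambda>n. x \<le> real n) sequentially"
        using filterlim_real_sequentially by (simp add: filterlim_at_top)
      then have "eventually (\<lambda>n. ennreal (k x) * indicator {0..real n} x = ennreal (k x) * indicator {0..} x) sequentially"
        by eventually_elim (auto simp: indicator_def)
      then show ?thesis by (rule tendsto_eventually)
    qed
    show "(\<lambda>x. ennreal (k x) * indicator {0..real n} x) \<in> borel_measurable lborel" for n by measurable
  qed simp
  have "ennreal q * (\<integral>\<^sup>+r. ennreal (k r) * indicator {0..} r \<partial>lborel) = ennreal (Beta a b)"
    using LIMSEQ_unique[OF lim2 lim1] unfolding int_F .
  moreover have "(\<integral>\<^sup>+r. ennreal (k r) * indicator {0..} r \<partial>lborel)
      = (\<integral>\<^sup>+r. ennreal (indicator {0..} r * (r powr (a * q - 1) * (1 + r powr q) powr (- (a + b)))) \<partial>lborel)"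
    by (intro nn_integral_cong) (auto simp: k_def indicator_def)
  ultimately have eq': "ennreal q * (\<integral>\<^sup>+r. ennreal (indicator {0..} r * (r powr (a * q - 1) * (1 + r powr q) powr (- (a + b)))) \<partial>lborel)
      = ennreal (Beta a b)" (is "_ * ?X = _") by simp
  then have "?X \<noteq> \<infinity>" using q by (auto simp: ennreal_mult_top)
  then obtain x where x: "?X = ennreal x" "x \<ge> 0" by (cases ?X) auto
  have "Beta a b \<ge> 0" using a b by (simp add: Beta_def)
  with eq' have "q * x = Beta a b" unfolding x(1) using q x(2) by (simp add: ennreal_mult[symmetric])
  then have "x = Beta a b / q" using q by (simp add: field_simps)
  then show ?thesis unfolding x(1) by simp
qed

section \<open>Large-scale limits of volumes and of radial integrals\<close>

context cd0_space
begin

text \<open>\<open>AVR\<close> speaks of open balls, whereas distribution functions of the distance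
  involve closed ones; a closed ball lies between the open balls of the same radius and of radius
  larger by 1. For y = 0 the mass of a point is divided by a power tending to infinity.\<close>

lemma measure_cball_asymptotics:
  assumes y: "y \<ge> 0"
  shows "(\<lambda>n. measure m (cball x0 (real (Suc n) * y)) / real (Suc n) powr N)
    \<longlonglongrightarrow> AVR m N * unit_ball_vol N * y powr N"
proof (cases "y = 0")
  case True
  have "(\<lambda>n. real (Suc n) powr (- N)) \<longlonglongrightarrow> 0"
    using N_gt_1
    by (intro tendsto_neg_powr filterlim_compose[OF filterlim_real_sequentially filterlim_Suc]) auto
  then have "(\<lambda>n. measure m (cball x0 0) * real (Suc n) powr (- N)) \<longlonglongrightarrow> measure m (cball x0 0) * 0"
    by (intro tendsto_intros)
  then show ?thesis using True N_gt_1 by (simp add: powr_minus divide_inverse)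
next
  case False
  with y have y: "y > 0" by simp
  define \<theta> where "\<theta> R = measure m (ball x0 R) / (unit_ball_vol N * R powr N)" for R
  have lim: "(\<theta> \<longlongrightarrow> AVR m N) at_top" using AVR_tendsto[of x0] by (simp add: \<theta>_def[abs_def])
  have V: "measure m (ball x0 R) = \<theta> R * unit_ball_vol N * R powr N" if "R > 0" for R
    using that unit_ball_vol_N_pos by (simp add: \<theta>_def)
  have l1: "filterlim (\<lambda>n. real (Suc n) * y) at_top sequentially"
    using y by (intro filterlim_at_top_mult_tendsto_pos[OF tendsto_const] filterlim_compose[OF filterlim_real_sequentially filterlim_Suc]) auto
  then have l2: "filterlim (\<lambda>n. 1 + real (Suc n) * y) at_top sequentially"
    by (intro filterlim_tendsto_add_at_top[OF tendsto_const])
  show ?thesis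
  proof (rule tendsto_sandwich)
    show "eventually (\<lambda>n. \<theta> (real (Suc n) * y) * unit_ball_vol N * y powr N
        \<le> measure m (cball x0 (real (Suc n) * y)) / real (Suc n) powr N) sequentially"
    proof (intro always_eventually allI)
      fix n
      have "\<theta> (real (Suc n) * y) * unit_ball_vol N * y powr N = measure m (ball x0 (real (Suc n) * y)) / real (Suc n) powr N"
        using y by (simp add: V powr_mult del: of_nat_Suc)
      also have "\<dots> \<le> measure m (cball x0 (real (Suc n) * y)) / real (Suc n) powr N"
        by (intro divide_right_mono measure_bounded_mono) auto
      finally show "\<theta> (real (Suc n) * y) * unit_ball_vol N * y powr N
        \<le> measure m (cball x0 (real (Suc n) * y)) / real (Suc n) powr N" .
    qed
    show "eventually (\<lambda>n. measure m (cball x0 (real (Suc n) * y)) / real (Suc n) powr N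
       \<le> \<theta> (1 + real (Suc n) * y) * unit_ball_vol N * (1 / real (Suc n) + y) powr N) sequentially"
    proof (intro always_eventually allI)
      fix n
      have "1 + real (Suc n) * y = real (Suc n) * (1 / real (Suc n) + y)" by (simp add: field_simps)
      then have eq: "(1 + real (Suc n) * y) powr N = real (Suc n) powr N * (1 / real (Suc n) + y) powr N"
        using y by (simp add: powr_mult del: of_nat_Suc)
      have "measure m (cball x0 (real (Suc n) * y)) / real (Suc n) powr N \<le> measure m (ball x0 (1 + real (Suc n) * y)) / real (Suc n) powr N"
        by (intro divide_right_mono measure_bounded_mono) auto
      also have "\<dots> = \<theta> (1 + real (Suc n) * y) * unit_ball_vol N * (1 / real (Suc n) + y) powr N"
        using y by (subst V) (auto simp: eq add_pos_nonneg simp del: of_nat_Suc)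
      finally show "measure m (cball x0 (real (Suc n) * y)) / real (Suc n) powr N
       \<le> \<theta> (1 + real (Suc n) * y) * unit_ball_vol N * (1 / real (Suc n) + y) powr N" .
    qed
    show "(\<lambda>n. \<theta> (real (Suc n) * y) * unit_ball_vol N * y powr N) \<longlonglongrightarrow> AVR m N * unit_ball_vol N * y powr N"
      by (intro tendsto_intros filterlim_compose[OF lim l1])
    have "(\<lambda>n. \<theta> (1 + real (Suc n) * y) * unit_ball_vol N * (1 / real (Suc n) + y) powr N)
      \<longlonglongrightarrow> AVR m N * unit_ball_vol N * (0 + y) powr N"
      using y by (intro tendsto_intros filterlim_compose[OF lim l2] LIMSEQ_Suc[OF lim_inverse_n']) auto
    then show "(\<lambda>n. \<theta> (1 + real (Suc n) * y) * unit_ball_vol N * (1 / real (Suc n) + y) powr N)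
      \<longlonglongrightarrow> AVR m N * unit_ball_vol N * y powr N" by simp
  qed
qed

text \<open>The rescaled distance to \<open>x0\<close>, under the normalized measure of a large ball, converges weakly
  to the law with density proportional to \<open>r powr (N - 1)\<close>.\<close>

lemma radial_limit:
  fixes f :: "real \<Rightarrow> real"
  assumes AVR: "AVR m N > 0" and \<Lambda>: "\<Lambda> > 0" and f: "continuous_on UNIV f" "\<And>r. \<bar>f r\<bar> \<le> B"
  shows "(\<lambda>n. (\<integral>x. indicator (cball x0 (real (Suc n) * \<Lambda>)) x * f (dist x0 x / real (Suc n)) \<partial>m) / real (Suc n) powr N)
    \<longlonglongrightarrow> AVR m N * unit_ball_vol N * N * (\<integral>r. indicator {0..\<Lambda>} r * (r powr (N - 1) * f r) \<partial>lborel)"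
proof -
  define C where "C n = cball x0 (real (Suc n) * \<Lambda>)" for n
  define V where "V n = measure m (C n)" for n
  define dens where "dens n x = (indicator (C n) x / V n :: real)" for n x
  define d where "d n x = dist x0 x / real (Suc n)" for n x
  define \<mu> where "\<mu> n = distr (density m (\<lambda>x. ennreal (dens n x))) borel (d n)" for n
  \<comment> \<open>Normalized to total mass 1 on the interval up to \<Lambda>, with distribution
    function (y / \<Lambda>) powr N there; restricting to a ball makes both laws probability
    measures.\<close>
  define g where "g r = indicator {0..\<Lambda>} r * (N * r powr (N - 1)) / \<Lambda> powr N" for r :: real
  define \<nu> where "\<nu> = density lborel (\<lambda>r. ennreal (g r))"
  have [measurable]: "f \<in> borel_measurable borel" using f(1) by (rule borel_measurable_continuous_onI)
  have [measurable]: "C n \<in> sets borel" "d n \<in> borel_measurable borel" for n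
    unfolding C_def d_def[abs_def] by (simp, measurable)
  have [measurable]: "dens n \<in> borel_measurable borel" "g \<in> borel_measurable borel" for n
    unfolding dens_def g_def by measurable
  have Vpos: "V n > 0" for n
  proof -
    have "0 < measure m (ball x0 (real (Suc n) * \<Lambda>))" using \<Lambda> by (intro measure_ball_pos) simp
    also have "\<dots> \<le> V n" unfolding V_def C_def by (intro measure_bounded_mono) auto
    finally show ?thesis .
  qed
  have V_lim: "(\<lambda>n. V n / real (Suc n) powr N) \<longlonglongrightarrow> AVR m N * unit_ball_vol N * \<Lambda> powr N"
    unfolding V_def C_def using \<Lambda> by (intro measure_cball_asymptotics) simp
  have dens: "prob_dens (dens n) (C n)" for n
    unfolding dens_def using Vpos[of n] unfolding V_def by (intro prob_dens_uniform) (auto simp: C_def)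
  have dens_nonneg: "dens n x \<ge> 0" for n x using dens by (simp add: prob_dens_def)
  have int_\<mu>: "(\<integral>r. h r \<partial>\<mu> n) = (\<integral>x. indicator (C n) x * h (d n x) \<partial>m) / V n"
    if [measurable]: "h \<in> borel_measurable borel" for h :: "real \<Rightarrow> real" and n
  proof -
    have "(\<integral>r. h r \<partial>\<mu> n) = (\<integral>x. h (d n x) \<partial>density m (\<lambda>x. ennreal (dens n x)))"
      unfolding \<mu>_def by (subst integral_distr) auto
    also have "\<dots> = (\<integral>x. dens n x * h (d n x) \<partial>m)"
      using dens_nonneg by (subst integral_density) auto
    also have "\<dots> = (\<integral>x. indicator (C n) x * h (d n x) / V n \<partial>m)"
      by (intro Bochner_Integration.integral_cong) (auto simp: dens_def)
    finally show ?thesis by simp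
  qed
  have \<mu>: "real_distribution (\<mu> n)" for n
  proof -
    interpret prob_space "density m (\<lambda>x. ennreal (dens n x))"
      using prob_dens_bounded_prob_density[OF dens] by (simp add: bounded_prob_density_def)
    have "prob_space (\<mu> n)" unfolding \<mu>_def by (intro prob_space_distr) simp
    then show ?thesis
      by (intro real_distribution.intro real_distribution_axioms.intro) (auto simp: \<mu>_def)
  qed
  have FTC: "(\<integral>\<^sup>+r. ennreal (N * \<bar>r\<bar> powr (N - 1) * sgn r) * indicator {0..y} r \<partial>lborel) = ennreal (y powr N)" if "y \<ge> 0" for y
  proof -
    have "(\<integral>\<^sup>+r. ennreal (N * \<bar>r\<bar> powr (N - 1) * sgn r) * indicator {0..y} r \<partial>lborel) = \<bar>y\<bar> powr N - \<bar>0\<bar> powr N"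
    proof (rule nn_integral_FTC_Icc)
      show "((\<lambda>r. \<bar>r\<bar> powr N) has_real_derivative N * \<bar>r\<bar> powr (N - 1) * sgn r) (at r)" for r
        by (rule has_real_derivative_abs_powr[OF N_gt_1])
    qed (use that N_gt_1 in \<open>auto simp: sgn_if\<close>)
    then show ?thesis using that by simp
  qed
  have g_nn: "(\<integral>\<^sup>+r. ennreal (g r) * indicator {..y} r \<partial>lborel) = ennreal ((min y \<Lambda> / \<Lambda>) powr N)" if "y \<ge> 0" for y
  proof -
    have "(\<integral>\<^sup>+r. ennreal (g r) * indicator {..y} r \<partial>lborel)
       = (\<integral>\<^sup>+r. ennreal (1 / \<Lambda> powr N) * (ennreal (N * \<bar>r\<bar> powr (N - 1) * sgn r) * indicator {0..min y \<Lambda>} r) \<partial>lborel)"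
      using N_gt_1 by (intro nn_integral_cong) (auto simp: g_def indicator_def ennreal_mult[symmetric] sgn_if)
    also have "\<dots> = ennreal (1 / \<Lambda> powr N) * ennreal (min y \<Lambda> powr N)"
      using that \<Lambda> by (subst nn_integral_cmult) (auto simp: FTC)
    also have "\<dots> = ennreal ((min y \<Lambda> / \<Lambda>) powr N)"
      using that \<Lambda> by (simp add: ennreal_mult[symmetric] powr_divide)
    finally show ?thesis .
  qed
  have g_nonneg: "g r \<ge> 0" for r using N_gt_1 by (auto simp: g_def)
  have g_total: "(\<integral>\<^sup>+r. ennreal (g r) \<partial>lborel) = 1"
  proof -
    have "(\<integral>\<^sup>+r. ennreal (g r) \<partial>lborel) = (\<integral>\<^sup>+r. ennreal (g r) * indicator {..\<Lambda>} r \<partial>lborel)"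
      by (intro nn_integral_cong) (auto simp: g_def indicator_def)
    also have "\<dots> = 1" using g_nn[of \<Lambda>] \<Lambda> by simp
    finally show ?thesis .
  qed
  have \<nu>: "real_distribution \<nu>"
  proof -
    have "prob_space \<nu>" unfolding \<nu>_def using g_total by (intro prob_spaceI) (simp add: emeasure_density)
    then show ?thesis by (intro real_distribution.intro real_distribution_axioms.intro) (auto simp: \<nu>_def)
  qed
  have cdf_\<nu>: "cdf \<nu> y = (if y \<ge> 0 then (min y \<Lambda> / \<Lambda>) powr N else 0)" for y
  proof (cases "y \<ge> 0")
    case True
    then have "emeasure \<nu> {..y} = ennreal ((min y \<Lambda> / \<Lambda>) powr N)"
      unfolding \<nu>_def using g_nn[of y] by (simp add: emeasure_density)
    then show ?thesis using True by (simp add: cdf_def measure_def)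
  next
    case False
    have "emeasure \<nu> {..y} = (\<integral>\<^sup>+r. ennreal (g r) * indicator {..y} r \<partial>lborel)"
      unfolding \<nu>_def by (rule emeasure_density) auto
    also have "\<dots> = (\<integral>\<^sup>+(r::real). 0 \<partial>lborel)"
      by (rule nn_integral_cong) (use False in \<open>auto simp: g_def indicator_def\<close>)
    finally have "emeasure \<nu> {..y} = 0" by simp
    then show ?thesis using False by (simp add: cdf_def measure_def)
  qed
  have cdf_\<mu>: "cdf (\<mu> n) y = (if y \<ge> 0 then measure m (cball x0 (real (Suc n) * min y \<Lambda>)) / V n else 0)" for n y
  proof -
    interpret \<mu>: real_distribution "\<mu> n" by (rule \<mu>)
    have "cdf (\<mu> n) y = (\<integral>r. indicator {..y} r \<partial>\<mu> n)"
      by (simp add: cdf_def)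
    also have "\<dots> = (\<integral>x. indicator (C n) x * indicator {..y} (d n x) \<partial>m) / V n"
      by (rule int_\<mu>) measurable
    also have "(\<integral>x. indicator (C n) x * indicator {..y} (d n x) \<partial>m)
       = (\<integral>x. (indicator (if y \<ge> 0 then cball x0 (real (Suc n) * min y \<Lambda>) else {}) x :: real) \<partial>m)"
    proof (intro Bochner_Integration.integral_cong refl)
      fix x
      have "d n x \<le> y \<longleftrightarrow> dist x0 x \<le> real (Suc n) * y"
        unfolding d_def by (simp add: divide_le_eq mult.commute del: of_nat_Suc)
      moreover have "d n x \<ge> 0" by (simp add: d_def)
      moreover have "real (Suc n) * min y \<Lambda> = min (real (Suc n) * y) (real (Suc n) * \<Lambda>)"
        by (simp add: min_mult_distrib_left del: of_nat_Suc)
      ultimately show "indicator (C n) x * indicator {..y} (d n x)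
        = (indicator (if y \<ge> 0 then cball x0 (real (Suc n) * min y \<Lambda>) else {}) x :: real)"
        by (auto simp: C_def indicator_def simp del: of_nat_Suc)
    qed
    finally show ?thesis by simp
  qed
  \<comment> \<open>Each distribution function is a quotient of two ball volumes, in which the
    common factor from \<open>AVR\<close> cancels; this is where positivity of \<open>AVR\<close>
    enters.\<close>
  have "weak_conv_m \<mu> \<nu>"
    unfolding weak_conv_m_def weak_conv_def
  proof (intro allI impI)
    fix y
    show "(\<lambda>n. cdf (\<mu> n) y) \<longlonglongrightarrow> cdf \<nu> y"
    proof (cases "y \<ge> 0")
      case True
      have "(\<lambda>n. (measure m (cball x0 (real (Suc n) * min y \<Lambda>)) / real (Suc n) powr N) / (V n / real (Suc n) powr N))
         \<longlonglongrightarrow> (AVR m N * unit_ball_vol N * min y \<Lambda> powr N) / (AVR m N * unit_ball_vol N * \<Lambda> powr N)"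
        using True \<Lambda> AVR unit_ball_vol_N_pos by (intro tendsto_divide measure_cball_asymptotics V_lim) auto
      then show ?thesis
        using True \<Lambda> AVR unit_ball_vol_N_pos by (simp add: cdf_\<mu> cdf_\<nu> powr_divide)
    qed (simp add: cdf_\<mu> cdf_\<nu>)
  qed
  then have "(\<lambda>n. \<integral>r. f r \<partial>\<mu> n) \<longlonglongrightarrow> (\<integral>r. f r \<partial>\<nu>)"
  proof (rule weak_conv_imp_integral_bdd_continuous_conv[OF \<mu> \<nu>])
    show "isCont f r" for r using f(1) by (simp add: continuous_on_eq_continuous_at)
    show "norm (f r) \<le> B" for r using f(2) by simp
  qed
  then have "(\<lambda>n. V n / real (Suc n) powr N * (\<integral>r. f r \<partial>\<mu> n)) \<longlonglongrightarrow> AVR m N * unit_ball_vol N * \<Lambda> powr N * (\<integral>r. f r \<partial>\<nu>)"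
    by (intro tendsto_mult V_lim)
  moreover have "V n / real (Suc n) powr N * (\<integral>r. f r \<partial>\<mu> n)
      = (\<integral>x. indicator (cball x0 (real (Suc n) * \<Lambda>)) x * f (dist x0 x / real (Suc n)) \<partial>m) / real (Suc n) powr N" for n
    using Vpos[of n] by (simp add: int_\<mu> C_def d_def)
  moreover have "\<Lambda> powr N * (\<integral>r. f r \<partial>\<nu>) = N * (\<integral>r. indicator {0..\<Lambda>} r * (r powr (N - 1) * f r) \<partial>lborel)"
  proof -
    have "(\<integral>r. f r \<partial>\<nu>) = (\<integral>r. g r * f r \<partial>lborel)"
      unfolding \<nu>_def using g_nonneg by (subst integral_density) auto
    also have "\<dots> = (\<integral>r. N / \<Lambda> powr N * (indicator {0..\<Lambda>} r * (r powr (N - 1) * f r)) \<partial>lborel)"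
      by (intro Bochner_Integration.integral_cong) (auto simp: g_def)
    finally show ?thesis using \<Lambda> by simp
  qed
  ultimately show ?thesis by (simp add: mult.assoc)
qed

end

text \<open>The two radial integrals of the Aubin-Talenti function
  \<open>v r = (1 + r powr q) powr (- (N - p) / p)\<close>, \<open>q = p / (p - 1)\<close>, up to constants: the first is the
  integral of \<open>v powr p_star\<close> and the second one that of \<open>\<bar>v'\<bar> powr p\<close>.\<close>

definition bubble_mass :: "real \<Rightarrow> real \<Rightarrow> real \<Rightarrow> real" where
  "bubble_mass N q \<Lambda> = (\<integral>r. indicator {0..\<Lambda>} r * (r powr (N - 1) * (1 + \<bar>r\<bar> powr q) powr (- N)) \<partial>lborel)"

definition bubble_moment :: "real \<Rightarrow> real \<Rightarrow> real \<Rightarrow> real" where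
  "bubble_moment N q \<Lambda> = (\<integral>r. indicator {0..\<Lambda>} r * (r powr (N - 1) * (\<bar>r\<bar> powr q * (1 + \<bar>r\<bar> powr q) powr (- N))) \<partial>lborel)"

lemma one_plus_abs_powr_pos [simp]: "0 < 1 + \<bar>r\<bar> powr (q::real)"
  by (simp add: add_pos_nonneg)

text \<open>The formula for f is asked for on the half-line only, so that one statement covers
  integrands written with an absolute value and those whose powers of r have to be merged
  first.\<close>

lemma bubble_aux:
  fixes a b q N :: real
  assumes ab: "a > 0" "b > 0" and q: "q > 1" and N: "a + b = N"
    and f: "\<And>r. r \<ge> 0 \<Longrightarrow> f r = r powr (a * q - 1) * (1 + \<bar>r\<bar> powr q) powr (- N)"
    and [measurable]: "f \<in> borel_measurable borel"
  shows "integrable lborel (\<lambda>r. indicator {0..} r * f r :: real)"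
    and "(\<integral>r. indicator {0..} r * f r \<partial>lborel) = Beta a b / q"
    and "(\<lambda>k. \<integral>r. indicator {0..real (Suc k)} r * f r \<partial>lborel) \<longlonglongrightarrow> Beta a b / q"
proof -
  have eq: "indicator {0..} r * f r = indicator {0..} r * (r powr (a * q - 1) * (1 + r powr q) powr (- (a + b)))" for r :: real
    using f[of r] N by (auto simp: indicator_def)
  have f_nonneg: "f r \<ge> 0" if "r \<ge> 0" for r using f[OF that] by simp
  then have nonneg: "indicator {0..} r * f r \<ge> 0" for r by (auto simp: indicator_def)
  have nn: "(\<integral>\<^sup>+r. ennreal (indicator {0..} r * f r) \<partial>lborel) = ennreal (Beta a b / q)"
    unfolding eq by (rule Beta_half_line[OF ab q])
  show int: "integrable lborel (\<lambda>r. indicator {0..} r * f r)"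
    using nn nonneg by (intro integrableI_bounded) auto
  have "Beta a b / q \<ge> 0" using ab q by (simp add: Beta_def)
  then show I: "(\<integral>r. indicator {0..} r * f r \<partial>lborel) = Beta a b / q"
    using nn nonneg by (subst integral_eq_nn_integral) auto
  have "(\<lambda>k. \<integral>r. indicator {0..real (Suc k)} r * f r \<partial>lborel) \<longlonglongrightarrow> (\<integral>r. indicator {0..} r * f r \<partial>lborel)"
  proof (rule integral_dominated_convergence[where w = "\<lambda>r. indicator {0..} r * f r"])
    show "AE r in lborel. norm (indicator {0..real (Suc k)} r * f r) \<le> indicator {0..} r * f r" for k
      using f_nonneg by (intro AE_I2) (auto simp: indicator_def)
    show "AE r in lborel. (\<lambda>k. indicator {0..real (Suc k)} r * f r) \<longlonglongrightarrow> indicator {0..} r * f r"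
    proof (rule AE_I2)
      fix r :: real
      have "eventually (\<lambda>k. r \<le> real (Suc k)) sequentially"
        using filterlim_compose[OF filterlim_real_sequentially filterlim_Suc] by (simp add: filterlim_at_top)
      then have "eventually (\<lambda>k. indicator {0..real (Suc k)} r * f r = indicator {0..} r * f r) sequentially"
        by eventually_elim (auto simp: indicator_def)
      then show "(\<lambda>k. indicator {0..real (Suc k)} r * f r) \<longlonglongrightarrow> indicator {0..} r * f r"
        by (rule tendsto_eventually)
    qed
  qed (use int in auto)
  then show "(\<lambda>k. \<integral>r. indicator {0..real (Suc k)} r * f r \<partial>lborel) \<longlonglongrightarrow> Beta a b / q"
    unfolding I .
qed

section \<open>Beta integrals of the bubble and the constant \<open>Eucl\<close>\<close>

context
  fixes N p q :: real
  assumes p: "1 < p" "p < N" and q_def: "q = p / (p - 1)"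
begin

lemma exponent_facts: "q > 1" "1 / p + 1 / q = 1" "N / q = N - N / p" "N / q > 0" "N / p > 1"
  "N / q / (N / p - 1) = N * (p - 1) / (N - p)" "(q - 1) * p = q"
  using p by (simp_all add: q_def field_simps)

lemma bubble_mass_limit: "(\<lambda>k. bubble_mass N q (real (Suc k))) \<longlonglongrightarrow> Beta (N / q) (N / p) / q"
  and bubble_mass_integrable: "integrable lborel (\<lambda>r. indicator {0..} r * (r powr (N - 1) * (1 + \<bar>r\<bar> powr q) powr (- N)))"
  and bubble_mass_half_line: "(\<integral>r. indicator {0..} r * (r powr (N - 1) * (1 + \<bar>r\<bar> powr q) powr (- N)) \<partial>lborel) = Beta (N / q) (N / p) / q"
proof -
  have q: "N / q * q - 1 = N - 1" using exponent_facts(1) by simp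
  have f: "r powr (N - 1) * (1 + \<bar>r\<bar> powr q) powr (- N) = r powr (N / q * q - 1) * (1 + \<bar>r\<bar> powr q) powr (- N)" for r :: real
    unfolding q ..
  have *: "N / q > 0" "N / p > 0" "q > 1" "N / q + N / p = N" using exponent_facts by auto
  show "integrable lborel (\<lambda>r. indicator {0..} r * (r powr (N - 1) * (1 + \<bar>r\<bar> powr q) powr (- N)))"
    by (rule bubble_aux(1)[OF * f]) measurable
  show "(\<integral>r. indicator {0..} r * (r powr (N - 1) * (1 + \<bar>r\<bar> powr q) powr (- N)) \<partial>lborel) = Beta (N / q) (N / p) / q"
    by (rule bubble_aux(2)[OF * f]) measurable
  show "(\<lambda>k. bubble_mass N q (real (Suc k))) \<longlonglongrightarrow> Beta (N / q) (N / p) / q"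
    unfolding bubble_mass_def by (rule bubble_aux(3)[OF * f]) measurable
qed

text \<open>The moment is a Beta integral with one parameter raised and the other lowered by 1
  relative to the mass. The two recurrences of the Beta function give the ratio a / b with a = N / q
  and b = N / p - 1; p < N makes b positive.\<close>

lemma bubble_moment_limit: "(\<lambda>k. bubble_moment N q (real (Suc k))) \<longlonglongrightarrow> Beta (N / q) (N / p) / q * (N * (p - 1) / (N - p))"
proof -
  define a b where "a = N / q" and "b = N / p - 1"
  have ab: "a > 0" "b > 0" using exponent_facts by (auto simp: a_def b_def)
  have "(a + b) * Beta (a + 1) b = a * Beta a b"
    using ab by (intro Beta_plus1_left) (auto simp: nonpos_Ints_def)
  moreover have "(a + b) * Beta a (b + 1) = b * Beta a b"
    using ab by (intro Beta_plus1_right) (auto simp: nonpos_Ints_def)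
  ultimately have "(a + b) * (b * Beta (a + 1) b) = (a + b) * (a * Beta a (b + 1))"
    by (simp only: mult.left_commute[of "a + b"] mult.left_commute[of b a])
  then have "b * Beta (a + 1) b = a * Beta a (b + 1)"
    using ab by (subst (asm) mult_cancel_left) auto
  then have "Beta (a + 1) b = Beta a (b + 1) * (a / b)"
    using ab by (simp add: field_simps)
  then have B: "Beta (N / q + 1) (N / p - 1) = Beta (N / q) (N / p) * (N * (p - 1) / (N - p))"
    unfolding a_def b_def exponent_facts(6)[symmetric] by simp
  have f: "r powr (N - 1) * (\<bar>r\<bar> powr q * (1 + \<bar>r\<bar> powr q) powr (- N))
      = r powr ((N / q + 1) * q - 1) * (1 + \<bar>r\<bar> powr q) powr (- N)" if "r \<ge> 0" for r :: real
    using exponent_facts(1) that by (simp add: distrib_right powr_add[symmetric] algebra_simps)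
  have "(\<lambda>k. bubble_moment N q (real (Suc k))) \<longlonglongrightarrow> Beta (N / q + 1) (N / p - 1) / q"
    unfolding bubble_moment_def
    using exponent_facts f by (intro bubble_aux(3)[where N = N and q = q and a = "N / q + 1" and b = "N / p - 1"]) auto
  then show "(\<lambda>k. bubble_moment N q (real (Suc k))) \<longlonglongrightarrow> Beta (N / q) (N / p) / q * (N * (p - 1) / (N - p))"
    unfolding B by (simp add: mult.commute)
qed

lemma Beta_bubble_pos: "Beta (N / q) (N / p) / q > 0"
  using exponent_facts by (simp add: Beta_def Gamma_real_pos)

text \<open>The quotient of Gamma values in \<open>Eucl\<close> is the reciprocal of
  \<open>unit_ball_vol N * N\<close> times the total bubble mass, because N + 1 - N / p is N / q +
  1. In this form \<open>AVR\<close> joins the volume factor, as it does in the radial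
  limits.\<close>

lemma Eucl_eq_bubble:
  assumes A: "A > 0"
  shows "Eucl N p * A powr (- 1 / N) = 1 / N * (N * (p - 1) / (N - p)) powr (1 / q)
    * (A * unit_ball_vol N * N * (Beta (N / q) (N / p) / q)) powr (- 1 / N)"
proof -
  have N: "N > 0" "N > 1" using p by auto
  have w: "unit_ball_vol N > 0" using N by (intro unit_ball_vol_pos) simp
  define J where "J = Beta (N / q) (N / p) / q"
  have J: "J > 0" unfolding J_def by (rule Beta_bubble_pos)
  have G: "Gamma N > 0" "Gamma (N / p) > 0" "Gamma (N / q) > 0"
    using N exponent_facts by (auto simp: Gamma_real_pos)
  have G1: "Gamma (N + 1) = N * Gamma N" using N by (intro Gamma_plus1) (auto elim!: nonpos_Ints_cases)
  have G2: "Gamma (N + 1 - N / p) = N / q * Gamma (N / q)"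
  proof -
    have "Gamma (N / q + 1) = N / q * Gamma (N / q)"
      using exponent_facts(4) by (intro Gamma_plus1) (auto elim!: nonpos_Ints_cases)
    moreover have "N / q + 1 = N + 1 - N / p" using exponent_facts(3) by simp
    ultimately show ?thesis by (simp only:)
  qed
  have J_eq: "J = Gamma (N / q) * Gamma (N / p) / Gamma N / q"
    using exponent_facts(3) by (simp add: J_def Beta_def)
  have K: "Gamma (N + 1) / (N * unit_ball_vol N * Gamma (N / p) * Gamma (N + 1 - N / p))
      = 1 / (unit_ball_vol N * N * J)"
    unfolding G1 G2 J_eq using N w G exponent_facts(1) by (simp add: field_simps)
  have q': "(p - 1) / p = 1 / q" using p by (simp add: q_def)
  have "(1 / (unit_ball_vol N * N * J)) powr (1 / N) * A powr (- 1 / N) = (A * unit_ball_vol N * N * J) powr (- 1 / N)"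
  proof -
    define X where "X = unit_ball_vol N * N * J"
    have X: "X > 0" using N w J by (simp add: X_def)
    have "(1 / X) powr (1 / N) * A powr (- 1 / N) = A powr (- 1 / N) * X powr (- 1 / N)"
      using X by (simp add: powr_divide powr_minus_divide)
    also have "\<dots> = (A * X) powr (- 1 / N)" using X A by (simp add: powr_mult)
    finally show ?thesis by (simp add: X_def mult.assoc)
  qed
  then show ?thesis
    unfolding Eucl_def K q' J_def[symmetric] by (simp add: mult.assoc)
qed

text \<open>On the left is the ratio of mass plus moment to mass, that is, the entropy of the
  bubble. On the right is the factor of the gradient term in the transport estimate, so the two
  cancel in the final comparison.\<close>

lemma one_plus_bubble_ratio: "1 + N * (p - 1) / (N - p) = (1 - 1 / N) * (p * N / (N - p))"
  using p by (simp add: field_simps)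

end

section \<open>The Sobolev inequality\<close>

lemma continuous_on_abs_powr:
  "s > 0 \<Longrightarrow> continuous_on UNIV (\<lambda>r::real. \<bar>r\<bar> powr s)"
  by (intro continuous_on_powr' continuous_on_rabs continuous_on_id continuous_on_const) auto

lemma continuous_on_one_plus_abs_powr:
  "q > 0 \<Longrightarrow> continuous_on UNIV (\<lambda>r::real. (1 + \<bar>r\<bar> powr q) powr s)"
  by (intro continuous_on_powr continuous_on_add continuous_on_const continuous_on_abs_powr)
    (auto simp: less_imp_neq[OF one_plus_abs_powr_pos, symmetric])

lemma one_plus_abs_powr_le_one: "s \<le> 0 \<Longrightarrow> (1 + \<bar>r::real\<bar> powr q) powr s \<le> 1"
  using powr_mono[of s 0 "1 + \<bar>r\<bar> powr q"] one_plus_abs_powr_pos[of r q] by (auto split: if_splits)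

text \<open>The scaling count behind the limit in l: with masses of order l powr N, entropies are of
  order l.\<close>

lemma powr_ratio_eq_1:
  fixes l N :: real
  assumes "l > 0" "N > 0"
  shows "(l powr N) powr (1 - 1 / N) * l = l powr N"
proof -
  have "N * (1 - 1 / N) = N - 1" using assms by (simp add: field_simps)
  then have "(l powr N) powr (1 - 1 / N) = l powr (N - 1)" by (simp only: powr_powr)
  then show ?thesis using assms powr_mult_base[of l "N - 1"] by (simp add: mult.commute)
qed

lemma divide_powr_minus:
  fixes x y s :: real
  shows "x > 0 \<Longrightarrow> y > 0 \<Longrightarrow> (x / y) powr (- s) = x powr (- s) * y powr s"
  by (simp add: powr_divide powr_minus field_simps)

text \<open>Here c stands for a value of an indicator function, which a nonzero power leaves
  unchanged; with 0 powr s = 0 this holds for every s.\<close>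

lemma mult_divide_powr:
  fixes c h x s :: real
  shows "c = 0 \<or> c = 1 \<Longrightarrow> h > 0 \<Longrightarrow> x > 0 \<Longrightarrow> (c * h / x) powr s = x powr (- s) * (c * h powr s)"
  by (auto simp: powr_divide powr_minus field_simps)

context cd0_space
begin

text \<open>The target is the bubble at scale l cut at distance \<Lambda> l. Its entropy and the
  root of its q-th moment are of order l, as is the boundary term; division by l removes the
  unspecified constant of the transport estimate. The boundary term keeps the factor \<Lambda>, so e
  must tend to 0 before \<Lambda> grows.\<close>

lemma Sobolev_finite_radius:
  fixes u :: "'a \<Rightarrow> real" and p :: real
  assumes AVR: "AVR m N > 0" and p: "1 < p" "p < N"
    and u: "L-lipschitz_on UNIV u" and u_nonneg: "\<And>x. 0 \<le> u x"
    and out: "\<And>x. x \<notin> ball x0 R \<Longrightarrow> u x = 0" and R: "R > 0" and e: "e > 0" and \<Lambda>: "\<Lambda> > 0"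
  defines "ps \<equiv> p * N / (N - p)" and "q \<equiv> p / (p - 1)" and "\<kappa> \<equiv> AVR m N * unit_ball_vol N * N"
  defines "Z \<equiv> (\<integral>x. indicator (ball x0 R) x * (u x + e) powr ps \<partial>m)"
  assumes J: "bubble_mass N q \<Lambda> > 0"
  shows "(\<kappa> * bubble_mass N q \<Lambda>) powr (- (1 - 1 / N)) * (\<kappa> * (bubble_mass N q \<Lambda> + bubble_moment N q \<Lambda>))
    \<le> \<Lambda> * ((e powr ps / Z) powr (1 - 1 / N) * measure m (ball x0 R) / R)
        + (1 - 1 / N) * (ps / N * (1 / Z) powr (1 / ps) * (\<integral>x. lip u x powr p \<partial>m) powr (1 / p))
          * (bubble_moment N q \<Lambda> / bubble_mass N q \<Lambda>) powr (1 / q)"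
proof -
  have N: "N > 0" using N_gt_1 by simp
  have q: "q > 1" using p by (simp add: q_def field_simps)
  have \<kappa>: "\<kappa> > 0" using AVR unit_ball_vol_N_pos N by (simp add: \<kappa>_def)
  define h where "h r = (1 + \<bar>r\<bar> powr q) powr (- N)" for r :: real
  define h2 where "h2 r = (1 + \<bar>r\<bar> powr q) powr (- (N - 1))" for r :: real
  define h3 where "h3 r = \<bar>r\<bar> powr q * h r" for r :: real
  define C where "C n = cball x0 (real (Suc n) * \<Lambda>)" for n
  define l where "l n = real (Suc n)" for n
  have l: "l n > 0" for n by (simp add: l_def)
  define I where "I f n = (\<integral>x. indicator (C n) x * f (dist x0 x / l n) \<partial>m)" for f :: "real \<Rightarrow> real" and n
  \<comment> \<open>\<open>h2\<close> is the power 1 - 1 / N of the density \<open>h\<close>, that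
    is, (1 + r^q) times \<open>h\<close>. So the entropy of the bubble is the sum of its mass and
    its q-th moment.\<close>
  have h2_eq: "h2 r = h r + h3 r" for r
    using powr_mult_base[of "1 + \<bar>r\<bar> powr q" "- N"] by (simp add: h_def h2_def h3_def algebra_simps)
  have h_cont: "continuous_on UNIV h" unfolding h_def using q by (intro continuous_on_one_plus_abs_powr) simp
  have h2_cont: "continuous_on UNIV h2" unfolding h2_def using q by (intro continuous_on_one_plus_abs_powr) simp
  have h3_cont: "continuous_on UNIV h3" unfolding h3_def using q
    by (intro continuous_on_mult continuous_on_abs_powr h_cont) simp
  have h_bd: "0 < h r" "h r \<le> 1" for r
    using one_plus_abs_powr_le_one[of "- N" r q] N less_imp_neq[OF one_plus_abs_powr_pos, of r q] by (auto simp: h_def)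
  have h_nonneg: "0 \<le> h r" for r using h_bd(1)[of r] by simp
  have h2_bd: "0 \<le> h2 r" "h2 r \<le> 1" for r
    unfolding h2_def using N_gt_1 by (auto intro!: one_plus_abs_powr_le_one)
  have h3_bd: "0 \<le> h3 r" "h3 r \<le> 1" for r
    using h2_eq[of r] h2_bd[of r] h_bd[of r] by (auto simp: h3_def)
  have [measurable]: "h \<in> borel_measurable borel" "h2 \<in> borel_measurable borel" "h3 \<in> borel_measurable borel"
    using h_cont h2_cont h3_cont by (auto intro: borel_measurable_continuous_onI)
  have [measurable]: "C n \<in> sets borel" for n by (simp add: C_def)
  have int_C: "integrable m (\<lambda>x. indicator (C n) x * f (dist x0 x / l n))"
    if [measurable]: "f \<in> borel_measurable borel" and "\<And>r. \<bar>f r\<bar> \<le> 1" for f :: "real \<Rightarrow> real" and n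
    by (rule integrable_bounded_support[of _ x0 "real (Suc n) * \<Lambda>" 1])
      (use that(2) in \<open>auto simp: C_def indicator_def\<close>)
  define J1 where "J1 = bubble_mass N q \<Lambda>"
  define J3 where "J3 = bubble_moment N q \<Lambda>"
  have J1: "J1 > 0" using J by (simp add: J1_def)
  have lim1: "(\<lambda>n. I h n / l n powr N) \<longlonglongrightarrow> \<kappa> * J1"
    using radial_limit[OF AVR \<Lambda> h_cont, of 1 x0] h_bd
    by (simp add: I_def C_def l_def \<kappa>_def J1_def bubble_mass_def h_def abs_of_pos less_imp_le del: of_nat_Suc)
  have lim3: "(\<lambda>n. I h3 n / l n powr N) \<longlonglongrightarrow> \<kappa> * J3"
    using radial_limit[OF AVR \<Lambda> h3_cont, of 1 x0] h3_bd
    by (simp add: I_def C_def l_def \<kappa>_def J3_def bubble_moment_def h3_def h_def del: of_nat_Suc)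
  have I2: "I h2 n = I h n + I h3 n" for n
  proof -
    have "I h2 n = (\<integral>x. indicator (C n) x * h (dist x0 x / l n) + indicator (C n) x * h3 (dist x0 x / l n) \<partial>m)"
      unfolding I_def by (intro Bochner_Integration.integral_cong) (auto simp: h2_eq distrib_left)
    also have "\<dots> = I h n + I h3 n"
      unfolding I_def using h_bd h_nonneg h3_bd
      by (intro Bochner_Integration.integral_add int_C) (auto simp: abs_of_pos)
    finally show ?thesis .
  qed
  have lim2: "(\<lambda>n. I h2 n / l n powr N) \<longlonglongrightarrow> \<kappa> * (J1 + J3)"
    using tendsto_add[OF lim1 lim3] by (simp add: I2 add_divide_distrib distrib_left)
  have I_pos: "I h n > 0" for n
  proof -
    define b where "b = (1 + \<Lambda> powr q) powr (- N)"
    have b: "b > 0" using \<Lambda> one_plus_abs_powr_pos[of \<Lambda> q] by (simp add: b_def)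
    have "0 < measure m (ball x0 (real (Suc n) * \<Lambda>))" using \<Lambda> by (intro measure_ball_pos) simp
    also have "\<dots> \<le> measure m (C n)" unfolding C_def by (intro measure_bounded_mono) auto
    finally have "0 < measure m (C n) * b" using b by simp
    also have "\<dots> = (\<integral>x. indicator (C n) x * b \<partial>m)" by simp
    also have "\<dots> \<le> I h n"
      unfolding I_def
    proof (rule integral_mono)
      show "integrable m (\<lambda>x. indicator (C n) x * b)"
        using emeasure_bounded[of "C n"] by (intro integrable_mult_left) (auto simp: C_def)
      show "integrable m (\<lambda>x. indicator (C n) x * h (dist x0 x / l n))"
        using h_bd h_nonneg by (intro int_C) (auto simp: abs_of_pos)
      show "indicator (C n) x * b \<le> indicator (C n) x * h (dist x0 x / l n)" for x
      proof (cases "x \<in> C n")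
        case True
        then have "dist x0 x / l n \<le> \<Lambda>" using l[of n] by (simp add: C_def l_def divide_le_eq mult.commute del: of_nat_Suc)
        then have "\<bar>dist x0 x / l n\<bar> powr q \<le> \<Lambda> powr q" using q l[of n] by (intro powr_mono2) auto
        then have "b \<le> h (dist x0 x / l n)"
          unfolding b_def h_def using N by (intro powr_mono2') (auto simp: add_pos_nonneg)
        then show ?thesis by (simp add: mult_left_mono)
      qed simp
    qed
    finally show ?thesis .
  qed
  define \<rho> where "\<rho> n x = indicator (C n) x * h (dist x0 x / l n) / I h n" for n x
  have [measurable]: "\<rho> n \<in> borel_measurable borel" for n unfolding \<rho>_def by measurable
  \<comment> \<open>The summand 1 places the closed ball \<open>C n\<close> inside an open one, as
    the transport estimate requires; it vanishes on division by \<open>l n\<close>.\<close>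
  define D where "D n = l n * \<Lambda> + 1" for n
  have D: "D n > 0" for n using l[of n] \<Lambda> by (simp add: D_def add_pos_pos)
  have \<rho>_nonneg: "\<rho> n x \<ge> 0" for n x using I_pos[of n] h_bd h_nonneg by (simp add: \<rho>_def)
  have \<rho>: "prob_dens (\<rho> n) (ball x0 (D n))" for n
    unfolding prob_dens_def
  proof (intro conjI allI impI)
    have "integrable m (\<rho> n)"
      unfolding \<rho>_def[abs_def] using h_bd h_nonneg by (intro integrable_divide int_C) (auto simp: abs_of_pos)
    then have "(\<integral>\<^sup>+x. ennreal (\<rho> n x) \<partial>m) = ennreal (\<integral>x. \<rho> n x \<partial>m)"
      using \<rho>_nonneg by (intro nn_integral_eq_integral) auto
    also have "(\<integral>x. \<rho> n x \<partial>m) = 1"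
      using I_pos[of n] by (simp add: \<rho>_def I_def)
    finally show "(\<integral>\<^sup>+x. ennreal (\<rho> n x) \<partial>m) = 1" by simp
    show "\<rho> n x = 0" if "x \<notin> ball x0 (D n)" for x
      using that by (auto simp: \<rho>_def D_def C_def l_def indicator_def)
  qed (use \<rho>_nonneg in auto)
  have S1: "(\<integral>x. \<rho> n x powr (1 - 1 / N) \<partial>m) = I h n powr (- (1 - 1 / N)) * I h2 n" for n
  proof -
    have "h r powr (1 - 1 / N) = h2 r" for r
    proof -
      have "- N * (1 - 1 / N) = - (N - 1)" using N by (simp add: field_simps)
      then show ?thesis unfolding h_def h2_def by (simp only: powr_powr)
    qed
    then have "\<rho> n x powr (1 - 1 / N) = I h n powr (- (1 - 1 / N)) * (indicator (C n) x * h2 (dist x0 x / l n))" for x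
      unfolding \<rho>_def using I_pos[of n] h_bd
      by (subst mult_divide_powr) (auto simp: indicator_def)
    then show ?thesis by (simp add: I_def)
  qed
  have Mom: "(\<integral>x. dist x0 x powr q * \<rho> n x \<partial>m) = l n powr q * (I h3 n / I h n)" for n
  proof -
    have "dist x0 x powr q * \<rho> n x = l n powr q / I h n * (indicator (C n) x * h3 (dist x0 x / l n))" for x
      using l[of n] by (simp add: \<rho>_def h3_def powr_divide)
    then show ?thesis by (simp add: I_def)
  qed
  obtain K where K: "\<And>D \<rho>1. D > 0 \<Longrightarrow> prob_dens \<rho>1 (ball x0 D) \<Longrightarrow>
      (\<integral>x. \<rho>1 x powr (1 - 1 / N) \<partial>m) \<le> K + D * ((e powr ps / Z) powr (1 - 1 / N) * measure m (ball x0 R) / R)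
        + (1 - 1 / N) * (ps / N * (1 / Z) powr (1 / ps) * (\<integral>x. lip u x powr p \<partial>m) powr (1 / p))
          * (\<integral>x. dist x0 x powr q * \<rho>1 x \<partial>m) powr (1 / q)"
    using transport_Sobolev_estimate(2)[OF p u u_nonneg out R e] unfolding ps_def q_def Z_def by blast
  define M where "M = (e powr ps / Z) powr (1 - 1 / N) * measure m (ball x0 R) / R"
  define G where "G = (1 - 1 / N) * (ps / N * (1 / Z) powr (1 / ps) * (\<integral>x. lip u x powr p \<partial>m) powr (1 / p))"
  \<comment> \<open>The estimate divided by \<open>l n\<close>, with every integral normalized by
    \<open>l n powr N\<close> so that the radial limits apply. The root 1 / q of the scaled moment
    contributes exactly one factor \<open>l n\<close>.\<close>
  have main: "(I h n / l n powr N) powr (- (1 - 1 / N)) * (I h2 n / l n powr N)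
      \<le> K * (1 / l n) + (\<Lambda> + 1 / l n) * M + G * ((I h3 n / l n powr N) / (I h n / l n powr N)) powr (1 / q)" for n
  proof -
    have "I h n powr (- (1 - 1 / N)) * I h2 n \<le> K + D n * M + G * (l n powr q * (I h3 n / I h n)) powr (1 / q)"
      using K[OF D \<rho>, of n] unfolding S1 Mom M_def G_def .
    also have "(l n powr q * (I h3 n / I h n)) powr (1 / q) = l n * (I h3 n / I h n) powr (1 / q)"
    proof -
      have "I h3 n \<ge> 0" unfolding I_def using h3_bd by (intro Bochner_Integration.integral_nonneg) auto
      then have "I h3 n / I h n \<ge> 0" using I_pos[of n] by simp
      then show ?thesis using l[of n] q by (simp only: powr_mult powr_ge_zero) (simp add: powr_powr)
    qed
    finally have "(I h n powr (- (1 - 1 / N)) * I h2 n) / l n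
      \<le> (K + D n * M + G * (l n * (I h3 n / I h n) powr (1 / q))) / l n"
      using l[of n] by (intro divide_right_mono) auto
    also have "\<dots> = K * (1 / l n) + (\<Lambda> + 1 / l n) * M + G * (I h3 n / I h n) powr (1 / q)"
      using l[of n] by (simp add: D_def field_simps)
    also have "I h3 n / I h n = (I h3 n / l n powr N) / (I h n / l n powr N)" using l[of n] by simp
    also have "(I h n powr (- (1 - 1 / N)) * I h2 n) / l n
       = (I h n / l n powr N) powr (- (1 - 1 / N)) * (I h2 n / l n powr N)"
    proof -
      have e1: "(I h n / l n powr N) powr (- (1 - 1 / N)) = I h n powr (- (1 - 1 / N)) * (l n powr N) powr (1 - 1 / N)"
        using I_pos[of n] l[of n] by (intro divide_powr_minus) auto
      have e2: "(l n powr N) powr (1 - 1 / N) / l n powr N = 1 / l n"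
        using powr_ratio_eq_1[OF l N, of n] l[of n] by (simp add: field_simps)
      have "(I h n / l n powr N) powr (- (1 - 1 / N)) * (I h2 n / l n powr N)
          = I h n powr (- (1 - 1 / N)) * I h2 n * ((l n powr N) powr (1 - 1 / N) / l n powr N)"
        unfolding e1 by simp
      then show ?thesis unfolding e2 by simp
    qed
    finally show ?thesis .
  qed
  have l_lim: "(\<lambda>n. 1 / l n) \<longlonglongrightarrow> 0"
    unfolding l_def by (rule LIMSEQ_Suc[OF lim_inverse_n'])
  have "(\<kappa> * J1) powr (- (1 - 1 / N)) * (\<kappa> * (J1 + J3))
    \<le> K * 0 + (\<Lambda> + 0) * M + G * ((\<kappa> * J3) / (\<kappa> * J1)) powr (1 / q)"
  proof (rule LIMSEQ_le)
    show "(\<lambda>n. (I h n / l n powr N) powr (- (1 - 1 / N)) * (I h2 n / l n powr N)) \<longlonglongrightarrow> (\<kappa> * J1) powr (- (1 - 1 / N)) * (\<kappa> * (J1 + J3))"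
      using \<kappa> J1 by (intro tendsto_mult tendsto_powr tendsto_const lim1 lim2) auto
    show "(\<lambda>n. K * (1 / l n) + (\<Lambda> + 1 / l n) * M + G * ((I h3 n / l n powr N) / (I h n / l n powr N)) powr (1 / q))
      \<longlonglongrightarrow> K * 0 + (\<Lambda> + 0) * M + G * ((\<kappa> * J3) / (\<kappa> * J1)) powr (1 / q)"
    proof (intro tendsto_add tendsto_mult tendsto_const l_lim tendsto_powr' tendsto_divide lim3 lim1)
      have "I h3 n \<ge> 0" for n unfolding I_def using h3_bd by (intro Bochner_Integration.integral_nonneg) auto
      then show "\<kappa> * J3 / (\<kappa> * J1) \<noteq> 0 \<or> 0 < 1 / q \<and> (\<forall>\<^sub>F n in sequentially. 0 \<le> I h3 n / l n powr N / (I h n / l n powr N))"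
        using q less_imp_le[OF I_pos] by (intro disjI2 conjI always_eventually allI divide_nonneg_nonneg) auto
    qed (use \<kappa> J1 in auto)
  qed (use main in auto)
  then show ?thesis using \<kappa> by (simp add: J1_def J3_def M_def G_def)
qed

end

lemma LIP_c_bounded_support:
  fixes u :: "'a::metric_space \<Rightarrow> real"
  assumes "u \<in> LIP_c"
  obtains L R where "L-lipschitz_on UNIV u" "R > 0" "\<And>x. x \<notin> ball x0 R \<Longrightarrow> u x = 0"
proof -
  obtain L where L: "L-lipschitz_on UNIV u" using assms by (auto simp: LIP_c_def LIP_def)
  have "bounded {x. u x \<noteq> 0}"
    using assms by (intro bounded_subset[OF compact_imp_bounded closure_subset]) (simp add: LIP_c_def)
  then obtain R where R: "\<And>x. u x \<noteq> 0 \<Longrightarrow> dist x0 x \<le> R"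
    unfolding bounded_any_center[of _ x0] by auto
  show ?thesis
  proof (rule that[OF L, of "max R 0 + 1"])
    show "u x = 0" if "x \<notin> ball x0 (max R 0 + 1)" for x using R[of x] that by fastforce
  qed simp
qed

lemma lipschitz_bounded_on_ball:
  fixes f :: "'a::metric_space \<Rightarrow> real"
  assumes "L-lipschitz_on UNIV f" "x \<in> ball x0 R"
  shows "\<bar>f x\<bar> \<le> \<bar>f x0\<bar> + L * R"
proof -
  have L: "L \<ge> 0" using assms(1) by (rule lipschitz_on_nonneg)
  have "\<bar>f x - f x0\<bar> \<le> L * dist x x0" using lipschitz_onD[OF assms(1), of x x0] by (simp add: dist_real_def)
  also have "\<dots> \<le> L * R" using L assms(2) by (intro mult_left_mono) (auto simp: dist_commute)
  finally show ?thesis by linarith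
qed

context cd0_space
begin

lemma integrable_abs_powr_bounded_support:
  fixes u :: "'a \<Rightarrow> real"
  assumes u: "L-lipschitz_on UNIV u" and out: "\<And>x. x \<notin> ball x0 R \<Longrightarrow> u x = 0" and s: "s > 0"
  shows "integrable m (\<lambda>x. \<bar>u x\<bar> powr s)"
proof (rule integrable_bounded_support)
  have [measurable]: "u \<in> borel_measurable borel"
    using u by (intro LIP_borel_measurable) (auto simp: LIP_def)
  show "(\<lambda>x. \<bar>u x\<bar> powr s) \<in> borel_measurable borel" by measurable
  show "\<bar>u x\<bar> powr s = 0" if "x \<notin> cball x0 R" for x using out[of x] that by auto
  show "\<bar>\<bar>u x\<bar> powr s\<bar> \<le> (\<bar>u x0\<bar> + L * R) powr s" for x
  proof (cases "x \<in> ball x0 R")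
    case True
    then show ?thesis using lipschitz_bounded_on_ball[OF u True] s by (auto intro: powr_mono2)
  qed (simp add: out)
qed

text \<open>For fixed \<Lambda> the boundary term is of the order of a positive power of e and
  disappears; then \<Lambda> is sent to infinity and the truncated radial integrals become Beta
  values. The norm of u sits in a denominator, so the case of vanishing norm is separate.\<close>

lemma Sobolev_bounded_support:
  fixes u :: "'a \<Rightarrow> real" and p :: real
  assumes AVR: "AVR m N > 0" and p: "1 < p" "p < N"
    and u: "L-lipschitz_on UNIV u" and u_nonneg: "\<And>x. 0 \<le> u x"
    and out: "\<And>x. x \<notin> ball x0 R \<Longrightarrow> u x = 0" and R: "R > 0"
  defines "ps \<equiv> p * N / (N - p)"
  shows "(\<integral>x. u x powr ps \<partial>m) powr (1 / ps)
     \<le> Eucl N p * AVR m N powr (- 1 / N) * (\<integral>x. lip u x powr p \<partial>m) powr (1 / p)"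
proof -
  define q where "q = p / (p - 1)"
  define \<kappa> where "\<kappa> = AVR m N * unit_ball_vol N * N"
  define J where "J = Beta (N / q) (N / p) / q"
  define T where "T = N * (p - 1) / (N - p)"
  define Z0 where "Z0 = (\<integral>x. u x powr ps \<partial>m)"
  define I where "I = (\<integral>x. lip u x powr p \<partial>m) powr (1 / p)"
  have N: "N > 0" using N_gt_1 by simp
  have \<kappa>: "\<kappa> > 0" using AVR unit_ball_vol_N_pos N by (simp add: \<kappa>_def)
  have ps: "ps > 0" using p by (simp add: ps_def)
  have J: "J > 0" unfolding J_def by (rule Beta_bubble_pos[OF p q_def])
  have T: "T > 0" using p by (simp add: T_def)
  have I: "I \<ge> 0" by (simp add: I_def)
  have Eucl: "Eucl N p * AVR m N powr (- 1 / N) = 1 / N * T powr (1 / q) * (\<kappa> * J) powr (- 1 / N)"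
    unfolding T_def \<kappa>_def J_def by (rule Eucl_eq_bubble[OF p q_def AVR])
  have Z0_nonneg: "Z0 \<ge> 0" by (simp add: Z0_def)
  have "Z0 powr (1 / ps) \<le> (1 / N * T powr (1 / q) * (\<kappa> * J) powr (- 1 / N)) * I"
  proof (cases "Z0 = 0")
    case True
    then show ?thesis using N I by simp
  next
    case False
    with Z0_nonneg have Z0: "Z0 > 0" by simp
    define G where "G = (1 - 1 / N) * (ps / N * (1 / Z0) powr (1 / ps) * I)"
    have finite: "(\<kappa> * bubble_mass N q \<Lambda>) powr (- (1 - 1 / N)) * (\<kappa> * (bubble_mass N q \<Lambda> + bubble_moment N q \<Lambda>))
        \<le> G * (bubble_moment N q \<Lambda> / bubble_mass N q \<Lambda>) powr (1 / q)"
      if \<Lambda>: "\<Lambda> > 0" "bubble_mass N q \<Lambda> > 0" for \<Lambda>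
    proof -
      let ?A = "(\<kappa> * bubble_mass N q \<Lambda>) powr (- (1 - 1 / N)) * (\<kappa> * (bubble_mass N q \<Lambda> + bubble_moment N q \<Lambda>))"
      let ?B = "(bubble_moment N q \<Lambda> / bubble_mass N q \<Lambda>) powr (1 / q)"
      \<comment> \<open>Since u + e dominates u, \<open>Z\<close> is at least \<open>Z0\<close>, and
        replacing \<open>Z\<close> by \<open>Z0\<close> makes the right-hand side depend on e only
        through the boundary term.\<close>
      have le: "?A \<le> \<Lambda> * ((e powr ps / Z0) powr (1 - 1 / N) * measure m (ball x0 R) / R) + G * ?B" if e: "e > 0" for e
      proof -
        define Z where "Z = (\<integral>x. indicator (ball x0 R) x * (u x + e) powr ps \<partial>m)"
        have "Z0 \<le> Z"
          unfolding Z0_def Z_def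
        proof (rule integral_mono)
          show "integrable m (\<lambda>x. u x powr ps)"
            using integrable_abs_powr_bounded_support[OF u out ps] u_nonneg by simp
          show "integrable m (\<lambda>x. indicator (ball x0 R) x * (u x + e) powr ps)"
          proof (rule integrable_bounded_support[where C = "(\<bar>u x0\<bar> + L * R + e) powr ps"])
            have [measurable]: "ball x0 R \<in> sets borel" by simp
            have [measurable]: "u \<in> borel_measurable borel"
              using u by (intro LIP_borel_measurable) (auto simp: LIP_def)
            show "(\<lambda>x. indicator (ball x0 R) x * (u x + e) powr ps) \<in> borel_measurable borel" by measurable
            show "indicator (ball x0 R) x * (u x + e) powr ps = 0" if "x \<notin> cball x0 R" for x
              using that by (auto simp: indicator_def)
            show "\<bar>indicator (ball x0 R) x * (u x + e) powr ps\<bar> \<le> (\<bar>u x0\<bar> + L * R + e) powr ps" for x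
              using lipschitz_bounded_on_ball[OF u, of x x0 R] u_nonneg[of x] e ps
              by (auto simp: indicator_def intro!: powr_mono2)
          qed
          show "u x powr ps \<le> indicator (ball x0 R) x * (u x + e) powr ps" for x
            using out[of x] u_nonneg[of x] e ps by (auto simp: indicator_def intro!: powr_mono2)
        qed
        then have Z: "Z > 0" "1 / Z \<le> 1 / Z0" "e powr ps / Z \<le> e powr ps / Z0"
          using Z0 by (auto intro!: divide_left_mono mult_pos_pos)
        have "?A \<le> \<Lambda> * ((e powr ps / Z) powr (1 - 1 / N) * measure m (ball x0 R) / R)
          + (1 - 1 / N) * (ps / N * (1 / Z) powr (1 / ps) * I) * ?B"
          unfolding Z_def I_def ps_def q_def \<kappa>_def
          by (rule Sobolev_finite_radius[OF AVR p u u_nonneg out R e \<Lambda>(1) \<Lambda>(2)[unfolded q_def]])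
        also have "\<dots> \<le> \<Lambda> * ((e powr ps / Z0) powr (1 - 1 / N) * measure m (ball x0 R) / R)
          + (1 - 1 / N) * (ps / N * (1 / Z0) powr (1 / ps) * I) * ?B"
        proof (rule add_mono)
          have "(e powr ps / Z) powr (1 - 1 / N) \<le> (e powr ps / Z0) powr (1 - 1 / N)"
            using Z N_gt_1 by (intro powr_mono2) auto
          then have "(e powr ps / Z) powr (1 - 1 / N) * measure m (ball x0 R) / R \<le> (e powr ps / Z0) powr (1 - 1 / N) * measure m (ball x0 R) / R"
            using R by (intro divide_right_mono mult_right_mono) auto
          then show "\<Lambda> * ((e powr ps / Z) powr (1 - 1 / N) * measure m (ball x0 R) / R)
              \<le> \<Lambda> * ((e powr ps / Z0) powr (1 - 1 / N) * measure m (ball x0 R) / R)"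
            using \<Lambda>(1) by (intro mult_left_mono) auto
          have "(1 / Z) powr (1 / ps) \<le> (1 / Z0) powr (1 / ps)"
            using Z ps by (intro powr_mono2) auto
          then have "ps / N * (1 / Z) powr (1 / ps) * I \<le> ps / N * (1 / Z0) powr (1 / ps) * I"
            using ps N I by (intro mult_right_mono mult_left_mono) auto
          then have "(1 - 1 / N) * (ps / N * (1 / Z) powr (1 / ps) * I) \<le> (1 - 1 / N) * (ps / N * (1 / Z0) powr (1 / ps) * I)"
            using N_gt_1 by (intro mult_left_mono) auto
          then show "(1 - 1 / N) * (ps / N * (1 / Z) powr (1 / ps) * I) * ?B \<le> (1 - 1 / N) * (ps / N * (1 / Z0) powr (1 / ps) * I) * ?B"
            by (rule mult_right_mono) simp
        qed
        finally show ?thesis by (simp add: G_def)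
      qed
      have "((\<lambda>e. \<Lambda> * ((e powr ps / Z0) powr (1 - 1 / N) * measure m (ball x0 R) / R) + G * ?B)
        \<longlongrightarrow> \<Lambda> * ((0 powr ps / Z0) powr (1 - 1 / N) * measure m (ball x0 R) / R) + G * ?B) (at_right 0)"
      proof (intro tendsto_add tendsto_mult tendsto_divide tendsto_const tendsto_powr' tendsto_ident_at)
        have "eventually (\<lambda>e::real. e \<ge> 0) (at_right 0)"
          using eventually_at_right_less[of "0::real"] by eventually_elim simp
        then show "(0::real) \<noteq> 0 \<or> 0 < ps \<and> (\<forall>\<^sub>F e in at_right 0. 0 \<le> (e::real))" using ps by simp
        show "0 powr ps / Z0 \<noteq> 0 \<or> 0 < 1 - 1 / N \<and> (\<forall>\<^sub>F e in at_right 0. 0 \<le> e powr ps / Z0)"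
          using N_gt_1 Z0 by (intro disjI2 conjI always_eventually) auto
      qed (use Z0 R in auto)
      moreover have "eventually (\<lambda>e. ?A \<le> \<Lambda> * ((e powr ps / Z0) powr (1 - 1 / N) * measure m (ball x0 R) / R) + G * ?B) (at_right 0)"
        using eventually_at_right_less[of "0::real"] by eventually_elim (rule le)
      ultimately have "?A \<le> \<Lambda> * ((0 powr ps / Z0) powr (1 - 1 / N) * measure m (ball x0 R) / R) + G * ?B"
        by (rule tendsto_lowerbound) simp
      then show ?thesis by simp
    qed
    have lim1: "(\<lambda>k. bubble_mass N q (real (Suc k))) \<longlonglongrightarrow> J"
      unfolding J_def by (rule bubble_mass_limit[OF p q_def])
    have lim3: "(\<lambda>k. bubble_moment N q (real (Suc k))) \<longlonglongrightarrow> J * T"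
      unfolding J_def T_def by (rule bubble_moment_limit[OF p q_def])
    have "(\<kappa> * J) powr (- (1 - 1 / N)) * (\<kappa> * (J + J * T)) \<le> G * ((J * T) / J) powr (1 / q)"
    proof (rule tendsto_le[OF sequentially_bot])
      show "(\<lambda>k. (\<kappa> * bubble_mass N q (real (Suc k))) powr (- (1 - 1 / N)) * (\<kappa> * (bubble_mass N q (real (Suc k)) + bubble_moment N q (real (Suc k)))))
         \<longlonglongrightarrow> (\<kappa> * J) powr (- (1 - 1 / N)) * (\<kappa> * (J + J * T))"
        using \<kappa> J by (intro tendsto_mult tendsto_powr tendsto_add tendsto_const lim1 lim3) auto
      show "(\<lambda>k. G * (bubble_moment N q (real (Suc k)) / bubble_mass N q (real (Suc k))) powr (1 / q))
         \<longlonglongrightarrow> G * ((J * T) / J) powr (1 / q)"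
        using J T by (intro tendsto_mult tendsto_powr tendsto_divide tendsto_const lim1 lim3) auto
      have "eventually (\<lambda>k. bubble_mass N q (real (Suc k)) > 0) sequentially"
        using order_tendstoD(1)[OF lim1 J] .
      then show "eventually (\<lambda>k. (\<kappa> * bubble_mass N q (real (Suc k))) powr (- (1 - 1 / N)) * (\<kappa> * (bubble_mass N q (real (Suc k)) + bubble_moment N q (real (Suc k))))
         \<le> G * (bubble_moment N q (real (Suc k)) / bubble_mass N q (real (Suc k))) powr (1 / q)) sequentially"
        by eventually_elim (rule finite; simp)
    qed
    \<comment> \<open>Mass plus moment is the mass times 1 + T, and 1 + T equals (1 - 1 / N)
      \<open>ps\<close>; the same factor is contained in G and cancels.\<close>
    also have "(\<kappa> * J) powr (- (1 - 1 / N)) * (\<kappa> * (J + J * T)) = (\<kappa> * J) powr (1 / N) * ((1 - 1 / N) * ps)"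
    proof -
      have "(\<kappa> * J) powr (- (1 - 1 / N)) * (\<kappa> * J) = (\<kappa> * J) powr (1 / N)"
        using powr_mult_base[of "\<kappa> * J" "- (1 - 1 / N)"] \<kappa> J by (simp add: mult.commute)
      moreover have "1 + T = (1 - 1 / N) * ps"
        unfolding T_def ps_def by (rule one_plus_bubble_ratio[OF p refl])
      moreover have "\<kappa> * (J + J * T) = (\<kappa> * J) * (1 + T)" by (simp add: algebra_simps)
      ultimately show ?thesis by (simp only: mult.assoc[symmetric])
    qed
    finally have "(\<kappa> * J) powr (1 / N) * ((1 - 1 / N) * ps) \<le> (1 / N * ((1 / Z0) powr (1 / ps) * I * T powr (1 / q))) * ((1 - 1 / N) * ps)"
      using J by (simp add: G_def mult_ac)
    then have "(\<kappa> * J) powr (1 / N) \<le> 1 / N * ((1 / Z0) powr (1 / ps) * I * T powr (1 / q))"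
      using N_gt_1 ps by (subst (asm) mult_le_cancel_right_pos) auto
    also have "(1 / Z0) powr (1 / ps) = 1 / Z0 powr (1 / ps)" using Z0 by (simp add: powr_divide)
    finally have "(\<kappa> * J) powr (1 / N) * Z0 powr (1 / ps)
        \<le> 1 / N * (1 / Z0 powr (1 / ps) * I * T powr (1 / q)) * Z0 powr (1 / ps)"
      by (rule mult_right_mono) simp
    also have "\<dots> = 1 / N * (I * T powr (1 / q))" using Z0 by simp
    finally have "(\<kappa> * J) powr (1 / N) * Z0 powr (1 / ps) \<le> 1 / N * (I * T powr (1 / q))" .
    then have "(\<kappa> * J) powr (- 1 / N) * ((\<kappa> * J) powr (1 / N) * Z0 powr (1 / ps)) \<le> (\<kappa> * J) powr (- 1 / N) * (1 / N * (I * T powr (1 / q)))"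
      by (rule mult_left_mono) simp
    moreover have "(\<kappa> * J) powr (- 1 / N) * (\<kappa> * J) powr (1 / N) = 1"
      using \<kappa> J by (simp add: powr_minus)
    ultimately show ?thesis by (simp add: mult.assoc[symmetric]) (simp add: mult_ac)
  qed
  then show ?thesis unfolding Eucl Z0_def I_def .
qed


text \<open>Competitors for the Cheeger energy have unbounded support and any sign, so |f| is
  multiplied by cutoffs. Their slopes tend to 0, and the resulting gradient error is a vanishing
  multiple of |f|, controlled because f is in L^p. The left side is an extended integral, as
  finiteness for the higher exponent is part of the conclusion.\<close>

lemma Sobolev_Lp_LIP:
  fixes f g :: "'a \<Rightarrow> real" and p :: real
  assumes AVR: "AVR m N > 0" and p: "1 < p" "p < N"
    and f: "f \<in> Lp m p" "f \<in> LIP" and g: "g \<in> Lp m p" "AE x in m. lip f x \<le> g x"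
  defines "ps \<equiv> p * N / (N - p)" and "K \<equiv> Eucl N p * AVR m N powr (- 1 / N)"
  shows "(\<integral>\<^sup>+x. ennreal (\<bar>f x\<bar> powr ps) \<partial>m) \<le> ennreal (K powr ps * (\<integral>x. \<bar>g x\<bar> powr p \<partial>m) powr (ps / p))"
proof -
  obtain x0 :: 'a where True by blast
  obtain L where L: "L-lipschitz_on UNIV f" using f(2) by (auto simp: LIP_def)
  have L0: "L \<ge> 0" using L by (rule lipschitz_on_nonneg)
  have ps: "ps > 0" using p by (simp add: ps_def)
  have K0: "K \<ge> 0"
    unfolding K_def Eucl_def using p by (intro mult_nonneg_nonneg) auto
  have [measurable]: "f \<in> borel_measurable borel" using f(2) by (rule LIP_borel_measurable)
  have [measurable]: "g \<in> borel_measurable borel" using g(1) by (simp add: Lp_def measurable_m)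
  define A where "A = (\<integral>x. \<bar>g x\<bar> powr p \<partial>m)"
  define F where "F = (\<integral>x. \<bar>f x\<bar> powr p \<partial>m)"
  have A0: "A \<ge> 0" by (simp add: A_def)
  \<comment> \<open>Equal to 1 up to distance Suc n from x0 and to 0 from twice that distance on,
    with slope 1 / Suc n.\<close>
  define c where "c n x = max 0 (min 1 (2 - dist x0 x / real (Suc n)))" for n x
  have c: "0 \<le> c n x" "c n x \<le> 1" for n x by (auto simp: c_def)
  have c_out: "c n x = 0" if "x \<notin> ball x0 (2 * real (Suc n))" for n x
  proof -
    have "dist x0 x / real (Suc n) \<ge> 2" using that by (simp add: le_divide_eq del: of_nat_Suc)
    then show ?thesis by (simp add: c_def)
  qed
  have c_lip: "(1 / real (Suc n))-lipschitz_on UNIV (c n)" for n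
  proof (rule lipschitz_onI)
    fix x y
    have "\<bar>c n x - c n y\<bar> \<le> \<bar>dist x0 x / real (Suc n) - dist x0 y / real (Suc n)\<bar>"
      by (auto simp: c_def)
    also have "\<dots> = \<bar>dist x0 x - dist x0 y\<bar> / real (Suc n)"
      by (simp add: diff_divide_distrib[symmetric] abs_divide del: of_nat_Suc)
    also have "\<dots> \<le> dist x y / real (Suc n)"
      using dist_triangle[of x0 x y] dist_triangle[of x0 y x]
      by (intro divide_right_mono) (auto simp: dist_commute)
    finally show "dist (c n x) (c n y) \<le> 1 / real (Suc n) * dist x y" by (simp add: dist_real_def)
  qed simp
  have c_lim: "(\<lambda>n. c n x) \<longlonglongrightarrow> 1" for x
  proof (rule tendsto_eventually)
    have "eventually (\<lambda>n. dist x0 x \<le> real (Suc n)) sequentially"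
      using filterlim_compose[OF filterlim_real_sequentially filterlim_Suc] by (simp add: filterlim_at_top)
    then show "eventually (\<lambda>n. c n x = 1) sequentially"
    proof eventually_elim
      case (elim n)
      then have "dist x0 x / real (Suc n) \<le> 1" by (simp del: of_nat_Suc)
      then show ?case by (simp add: c_def)
    qed
  qed
  define u where "u n x = \<bar>f x\<bar> * c n x" for n x
  have abs_lip: "L-lipschitz_on UNIV (\<lambda>x. \<bar>f x\<bar>)"
    using L by (auto simp: lipschitz_on_def dist_real_def intro: order_trans[OF abs_triangle_ineq3])
  have u_nonneg: "u n x \<ge> 0" for n x using c by (simp add: u_def)
  have u_out: "u n x = 0" if "x \<notin> ball x0 (2 * real (Suc n))" for n x using c_out[OF that] by (simp add: u_def)
  \<comment> \<open>f may be unbounded, so the product rule is used only when one of the points lies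
    in the ball carrying the cutoff, where |f| is bounded; otherwise both values are 0.\<close>
  have u_lip: "\<exists>M. M-lipschitz_on UNIV (u n)" for n
  proof -
    define B where "B = \<bar>f x0\<bar> + L * (2 * real (Suc n))"
    have B: "B \<ge> 0" using L0 by (simp add: B_def)
    have main: "\<bar>u n x - u n y\<bar> \<le> (L + B * (1 / real (Suc n))) * dist x y" if x: "x \<in> ball x0 (2 * real (Suc n))" for x y
    proof -
      have "u n x - u n y = (\<bar>f x\<bar> - \<bar>f y\<bar>) * c n y + \<bar>f x\<bar> * (c n x - c n y)"
        by (simp add: u_def algebra_simps)
      then have "\<bar>u n x - u n y\<bar> \<le> \<bar>\<bar>f x\<bar> - \<bar>f y\<bar>\<bar> * c n y + \<bar>f x\<bar> * \<bar>c n x - c n y\<bar>"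
        using c[of n y] by (metis abs_abs abs_mult abs_of_nonneg abs_triangle_ineq)
      also have "\<dots> \<le> (L * dist x y) * 1 + B * (1 / real (Suc n) * dist x y)"
      proof (intro add_mono mult_mono)
        show "\<bar>\<bar>f x\<bar> - \<bar>f y\<bar>\<bar> \<le> L * dist x y" using lipschitz_onD[OF abs_lip, of x y] by (simp add: dist_real_def)
        show "\<bar>c n x - c n y\<bar> \<le> 1 / real (Suc n) * dist x y" using lipschitz_onD[OF c_lip, of x y n] by (simp add: dist_real_def)
        show "\<bar>f x\<bar> \<le> B" unfolding B_def by (rule lipschitz_bounded_on_ball[OF L x])
      qed (use c L0 B in auto)
      also have "\<dots> = (L + B * (1 / real (Suc n))) * dist x y" by (simp add: algebra_simps)
      finally show ?thesis .
    qed
    have "(L + B * (1 / real (Suc n)))-lipschitz_on UNIV (u n)"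
    proof (rule lipschitz_onI)
      fix x y
      show "dist (u n x) (u n y) \<le> (L + B * (1 / real (Suc n))) * dist x y"
      proof (cases "x \<in> ball x0 (2 * real (Suc n)) \<or> y \<in> ball x0 (2 * real (Suc n))")
        case True
        then show ?thesis using main[of x y] main[of y x] by (auto simp: dist_real_def abs_minus_commute dist_commute)
      next
        case False
        then show ?thesis using u_out[of x n] u_out[of y n] L0 B by simp
      qed
    qed (use L0 B in simp)
    then show ?thesis ..
  qed
  have lip_u: "lip (u n) x \<le> lip f x + 1 / real (Suc n) * \<bar>f x\<bar>" for n x
  proof -
    have "lip (u n) x \<le> lip (\<lambda>x. \<bar>f x\<bar>) x + 1 / real (Suc n) * \<bar>\<bar>f x\<bar>\<bar>"
      unfolding u_def by (rule lip_mult_le[OF abs_lip c_lip c])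
    also have "lip (\<lambda>x. \<bar>f x\<bar>) x \<le> lip f x" by (rule lip_mono[OF L]) simp
    finally show ?thesis by simp
  qed
  \<comment> \<open>The cutoff error is weighted by \<open>Ke\<close>, which depends on e, but it
    vanishes as n grows with e fixed; afterwards e tends to 0.\<close>
  have bound: "(\<integral>\<^sup>+x. ennreal (\<bar>f x\<bar> powr ps) \<partial>m) \<le> ennreal ((K powr p * ((1 + e) * A)) powr (ps / p))" if e: "e > 0" for e
  proof -
    obtain Ke where Ke: "Ke > 0" "\<And>a b. 0 \<le> a \<Longrightarrow> 0 \<le> b \<Longrightarrow> (a + b) powr p \<le> (1 + e) * a powr p + Ke * b powr p"
      using powr_add_le[of p e] p e by auto
    define Q where "Q n = (K powr p * ((1 + e) * A + Ke * (1 / real (Suc n)) powr p * F)) powr (ps / p)" for n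
    have fin: "(\<integral>\<^sup>+x. ennreal (u n x powr ps) \<partial>m) \<le> ennreal (Q n)" for n
    proof -
      obtain M where M: "M-lipschitz_on UNIV (u n)" using u_lip by blast
      have R: "2 * real (Suc n) > 0" by simp
      define U where "U = (\<integral>x. u n x powr ps \<partial>m)"
      define I where "I = (\<integral>x. lip (u n) x powr p \<partial>m)"
      have "U powr (1 / ps) \<le> K * I powr (1 / p)"
        unfolding U_def I_def K_def ps_def
        by (rule Sobolev_bounded_support[OF AVR p M u_nonneg u_out R])
      then have "(U powr (1 / ps)) powr ps \<le> (K * I powr (1 / p)) powr ps"
        using ps by (intro powr_mono2) auto
      also have "(U powr (1 / ps)) powr ps = U" using ps by (simp add: powr_powr U_def)
      also have "(K * I powr (1 / p)) powr ps = (K powr p * I) powr (ps / p)"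
        using K0 p by (simp add: powr_mult powr_powr I_def)
      also have "\<dots> \<le> Q n"
        unfolding Q_def
      proof (intro powr_mono2 mult_left_mono)
        have int_f: "integrable m (\<lambda>x. \<bar>f x\<bar> powr p)" and int_g: "integrable m (\<lambda>x. \<bar>g x\<bar> powr p)"
          using f(1) g(1) by (auto simp: Lp_def)
        have "I \<le> (\<integral>x. (1 + e) * \<bar>g x\<bar> powr p + Ke * (1 / real (Suc n)) powr p * \<bar>f x\<bar> powr p \<partial>m)"
          unfolding I_def
        proof (rule integral_mono_AE')
          show "integrable m (\<lambda>x. (1 + e) * \<bar>g x\<bar> powr p + Ke * (1 / real (Suc n)) powr p * \<bar>f x\<bar> powr p)"
            using int_f int_g by (intro Bochner_Integration.integrable_add integrable_mult_right)
          show "AE x in m. lip (u n) x powr p \<le> (1 + e) * \<bar>g x\<bar> powr p + Ke * (1 / real (Suc n)) powr p * \<bar>f x\<bar> powr p"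
            using g(2)
          proof eventually_elim
            case (elim x)
            have "lip (u n) x powr p \<le> (\<bar>g x\<bar> + 1 / real (Suc n) * \<bar>f x\<bar>) powr p"
              using lip_u[of n x] elim p by (intro powr_mono2) auto
            also have "\<dots> \<le> (1 + e) * \<bar>g x\<bar> powr p + Ke * (1 / real (Suc n) * \<bar>f x\<bar>) powr p"
              by (rule Ke(2)) auto
            also have "(1 / real (Suc n) * \<bar>f x\<bar>) powr p = (1 / real (Suc n)) powr p * \<bar>f x\<bar> powr p"
              by (rule powr_mult) 
            finally show ?case by (simp only: mult.assoc)
          qed
        qed (use e Ke in \<open>auto intro!: add_nonneg_nonneg mult_nonneg_nonneg\<close>)
        also have "\<dots> = (1 + e) * A + Ke * (1 / real (Suc n)) powr p * F"
          using int_f int_g by (simp add: A_def F_def)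
        finally show "I \<le> (1 + e) * A + Ke * (1 / real (Suc n)) powr p * F" .
      qed (use ps p in \<open>auto simp: I_def\<close>)
      finally have "U \<le> Q n" .
      moreover have "(\<integral>\<^sup>+x. ennreal (u n x powr ps) \<partial>m) = ennreal U"
        unfolding U_def using integrable_abs_powr_bounded_support[OF M u_out ps] u_nonneg
        by (intro nn_integral_eq_integral) auto
      ultimately show ?thesis by (simp add: ennreal_leI)
    qed
    have [measurable]: "u n \<in> borel_measurable borel" for n
      using u_lip[of n] by (intro LIP_borel_measurable) (auto simp: LIP_def)
    have "(\<integral>\<^sup>+x. ennreal (\<bar>f x\<bar> powr ps) \<partial>m) = (\<integral>\<^sup>+x. liminf (\<lambda>n. ennreal (u n x powr ps)) \<partial>m)"
    proof (rule nn_integral_cong)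
      fix x
      have "(\<lambda>n. ennreal (u n x powr ps)) \<longlonglongrightarrow> ennreal ((\<bar>f x\<bar> * 1) powr ps)"
        unfolding u_def using ps c
        by (intro tendsto_ennrealI tendsto_powr' tendsto_mult c_lim tendsto_const) auto
      from lim_imp_Liminf[OF sequentially_bot this]
      show "ennreal (\<bar>f x\<bar> powr ps) = liminf (\<lambda>n. ennreal (u n x powr ps))" by simp
    qed
    also have "\<dots> \<le> liminf (\<lambda>n. \<integral>\<^sup>+x. ennreal (u n x powr ps) \<partial>m)"
      by (rule nn_integral_liminf) measurable
    also have "\<dots> \<le> liminf (\<lambda>n. ennreal (Q n))"
      using fin by (intro Liminf_mono always_eventually allI)
    also have "\<dots> = ennreal ((K powr p * ((1 + e) * A + Ke * 0 powr p * F)) powr (ps / p))"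
    proof (rule lim_imp_Liminf)
      show "(\<lambda>n. ennreal (Q n)) \<longlonglongrightarrow> ennreal ((K powr p * ((1 + e) * A + Ke * 0 powr p * F)) powr (ps / p))"
        unfolding Q_def
      proof (intro tendsto_ennrealI tendsto_powr' tendsto_mult tendsto_add tendsto_const LIMSEQ_Suc[OF lim_inverse_n'])
        show "(0::real) \<noteq> 0 \<or> 0 < p \<and> (\<forall>\<^sub>F n in sequentially. 0 \<le> 1 / real (Suc n))" using p by simp
        show "K powr p * ((1 + e) * A + Ke * 0 powr p * F) \<noteq> 0 \<or>
            0 < ps / p \<and> (\<forall>\<^sub>F n in sequentially. 0 \<le> K powr p * ((1 + e) * A + Ke * (1 / real (Suc n)) powr p * F))"
          using p ps e Ke A0 by (intro disjI2 conjI always_eventually allI mult_nonneg_nonneg add_nonneg_nonneg) (auto simp: F_def)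
      qed (use K0 p in auto)
    qed simp
    finally show ?thesis using p by simp
  qed
  have "((\<lambda>e. ennreal ((K powr p * ((1 + e) * A)) powr (ps / p))) \<longlongrightarrow> ennreal ((K powr p * ((1 + 0) * A)) powr (ps / p))) (at_right 0)"
  proof (intro tendsto_ennrealI tendsto_powr' tendsto_mult tendsto_add tendsto_const tendsto_ident_at)
    have "eventually (\<lambda>e. 0 \<le> K powr p * ((1 + e) * A)) (at_right 0)"
      using eventually_at_right_less[of "0::real"] by eventually_elim (use A0 in auto)
    then show "K powr p * ((1 + 0) * A) \<noteq> 0 \<or> 0 < ps / p \<and> (\<forall>\<^sub>F e in at_right 0. 0 \<le> K powr p * ((1 + e) * A))"
      using ps p by simp
  qed (use K0 p in auto)
  moreover have "eventually (\<lambda>e. (\<integral>\<^sup>+x. ennreal (\<bar>f x\<bar> powr ps) \<partial>m) \<le> ennreal ((K powr p * ((1 + e) * A)) powr (ps / p))) (at_right 0)"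
    using eventually_at_right_less[of "0::real"] by eventually_elim (rule bound)
  ultimately have "(\<integral>\<^sup>+x. ennreal (\<bar>f x\<bar> powr ps) \<partial>m) \<le> ennreal ((K powr p * ((1 + 0) * A)) powr (ps / p))"
    by (rule tendsto_lowerbound) simp
  also have "(K powr p * ((1 + 0) * A)) powr (ps / p) = K powr ps * A powr (ps / p)"
    using p A0 by (simp add: powr_mult powr_powr)
  finally show ?thesis by (simp add: A_def)
qed

text \<open>Convergence in L^p says nothing about the higher exponent, so an almost everywhere
  convergent subsequence is taken and Fatou applied on the left. On the right the dominating
  functions converge in L^p and nothing is lost.\<close>

lemma Sobolev_weak_upper_gradient:
  fixes u G :: "'a \<Rightarrow> real" and p :: real
  assumes AVR: "AVR m N > 0" and p: "1 < p" "p < N"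
    and u: "u \<in> Lp m p" and G: "weak_upper_gradient m p u G"
  defines "ps \<equiv> p * N / (N - p)" and "K \<equiv> Eucl N p * AVR m N powr (- 1 / N)"
  shows "(\<integral>\<^sup>+x. ennreal (\<bar>u x\<bar> powr ps) \<partial>m) \<le> ennreal (K powr ps * (\<integral>x. \<bar>G x\<bar> powr p \<partial>m) powr (ps / p))"
proof -
  have ps: "ps > 0" using p by (simp add: ps_def)
  have p0: "p > 0" using p by simp
  obtain fs gs where fs: "\<And>n. fs n \<in> Lp m p \<inter> LIP" "Lp_tendsto m p fs u"
    and gs: "\<And>n. gs n \<in> Lp m p" "\<And>n. AE x in m. lip (fs n) x \<le> gs n x" "Lp_tendsto m p gs G"
    using G unfolding weak_upper_gradient_def by blast
  have G_Lp: "G \<in> Lp m p" using G by (simp add: weak_upper_gradient_def)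
  have fs_u: "(\<lambda>x. fs n x - u x) \<in> Lp m p" for n using fs(1) u p0 by (intro Lp_diff) auto
  have "(\<lambda>n. \<integral>x. norm (\<bar>fs n x - u x\<bar> powr p) \<partial>m) \<longlonglongrightarrow> 0"
  proof -
    have "(\<lambda>n. ennreal (\<integral>x. \<bar>fs n x - u x\<bar> powr p \<partial>m)) \<longlonglongrightarrow> ennreal 0"
      using fs(2) nn_integral_powr_eq[OF fs_u] by (simp add: Lp_tendsto_def)
    then show ?thesis by (subst (asm) tendsto_ennreal_iff) auto
  qed
  then obtain r where r: "strict_mono r" "AE x in m. (\<lambda>n. \<bar>fs (r n) x - u x\<bar> powr p) \<longlonglongrightarrow> 0"
    using tendsto_L1_AE_subseq[of m "\<lambda>n x. \<bar>fs n x - u x\<bar> powr p"] fs_u by (auto simp: Lp_def)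
  have [measurable]: "fs n \<in> borel_measurable m" for n using fs(1) by (auto simp: Lp_def)
  have "(\<integral>\<^sup>+x. ennreal (\<bar>u x\<bar> powr ps) \<partial>m) = (\<integral>\<^sup>+x. liminf (\<lambda>n. ennreal (\<bar>fs (r n) x\<bar> powr ps)) \<partial>m)"
  proof (rule nn_integral_cong_AE)
    show "AE x in m. ennreal (\<bar>u x\<bar> powr ps) = liminf (\<lambda>n. ennreal (\<bar>fs (r n) x\<bar> powr ps))"
      using r(2)
    proof eventually_elim
      case (elim x)
      then have "(\<lambda>n. (\<bar>fs (r n) x - u x\<bar> powr p) powr (1 / p)) \<longlonglongrightarrow> 0 powr (1 / p)"
        using p by (intro tendsto_powr' tendsto_const) auto
      then have "(\<lambda>n. \<bar>fs (r n) x - u x\<bar>) \<longlonglongrightarrow> 0" using p by (simp add: powr_powr)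
      then have "(\<lambda>n. fs (r n) x) \<longlonglongrightarrow> u x" by (simp add: tendsto_rabs_zero_iff LIM_zero_iff)
      then have "(\<lambda>n. ennreal (\<bar>fs (r n) x\<bar> powr ps)) \<longlonglongrightarrow> ennreal (\<bar>u x\<bar> powr ps)"
        using ps by (intro tendsto_ennrealI tendsto_powr' tendsto_rabs tendsto_const) auto
      from lim_imp_Liminf[OF sequentially_bot this] show ?case by simp
    qed
  qed
  also have "\<dots> \<le> liminf (\<lambda>n. \<integral>\<^sup>+x. ennreal (\<bar>fs (r n) x\<bar> powr ps) \<partial>m)"
    by (rule nn_integral_liminf) measurable
  also have "\<dots> \<le> liminf (\<lambda>n. ennreal (K powr ps * (\<integral>x. \<bar>gs (r n) x\<bar> powr p \<partial>m) powr (ps / p)))"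
    unfolding K_def ps_def using fs(1)
    by (intro Liminf_mono always_eventually allI Sobolev_Lp_LIP[OF AVR p _ _ gs(1) gs(2)]) auto
  also have "\<dots> = ennreal (K powr ps * (\<integral>x. \<bar>G x\<bar> powr p \<partial>m) powr (ps / p))"
  proof (rule lim_imp_Liminf)
    have "(\<lambda>n. \<integral>x. \<bar>gs (r n) x\<bar> powr p \<partial>m) \<longlonglongrightarrow> (\<integral>x. \<bar>G x\<bar> powr p \<partial>m)"
      using LIMSEQ_subseq_LIMSEQ[OF Lp_tendsto_integral[OF gs(1) G_Lp p0 gs(3)] r(1)] by (simp add: comp_def)
    then show "(\<lambda>n. ennreal (K powr ps * (\<integral>x. \<bar>gs (r n) x\<bar> powr p \<partial>m) powr (ps / p)))
        \<longlonglongrightarrow> ennreal (K powr ps * (\<integral>x. \<bar>G x\<bar> powr p \<partial>m) powr (ps / p))"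
      using ps p by (intro tendsto_ennrealI tendsto_mult tendsto_const tendsto_powr') auto
  qed simp
  finally show ?thesis .
qed

section \<open>Sharpness\<close>


text \<open>Rests on compactness of closed balls, a consequence of Bishop-Gromov.\<close>

lemma LIP_c_of_bounded_support:
  fixes u :: "'a \<Rightarrow> real"
  assumes "L-lipschitz_on UNIV u" "\<And>x. x \<notin> cball x0 R \<Longrightarrow> u x = 0"
  shows "u \<in> LIP_c"
proof -
  have "closure {x. u x \<noteq> 0} \<subseteq> cball x0 R"
    using assms(2) by (intro closure_minimal) (blast, simp)
  then have "closure {x. u x \<noteq> 0} = cball x0 R \<inter> closure {x. u x \<noteq> 0}" by blast
  moreover have "compact (cball x0 R \<inter> closure {x. u x \<noteq> 0})"
    by (intro compact_Int_closed compact_cball) simp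
  ultimately show ?thesis using assms(1) by (auto simp: LIP_c_def LIP_def)
qed

text \<open>The test functions are bubbles of the scaled distance to x0, lowered so as to vanish
  beyond \<Lambda>. Only that the distance is 1-Lipschitz is used for their gradients: an upper
  bound of the right-hand side is what is wanted, and the radial limit evaluates both sides. The
  scale goes to infinity before \<Lambda>.\<close>

lemma Sobolev_sharp:
  fixes p C :: real
  assumes AVR: "AVR m N > 0" and p: "1 < p" "p < N" and C: "C \<ge> 0"
  defines "ps \<equiv> p * N / (N - p)"
  assumes ineq: "\<And>u :: 'a \<Rightarrow> real. u \<in> LIP_c \<Longrightarrow>
    (\<integral>x. \<bar>u x\<bar> powr ps \<partial>m) powr (1 / ps) \<le> C * (\<integral>x. lip u x powr p \<partial>m) powr (1 / p)"
  shows "Eucl N p * AVR m N powr (- 1 / N) \<le> C"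
proof -
  obtain x0 :: 'a where True by blast
  define q where "q = p / (p - 1)"
  define \<kappa> where "\<kappa> = AVR m N * unit_ball_vol N * N"
  define J where "J = Beta (N / q) (N / p) / q"
  define T where "T = N * (p - 1) / (N - p)"
  define s where "s = (N - p) / p"
  have N: "N > 0" using N_gt_1 by simp
  have \<kappa>: "\<kappa> > 0" using AVR unit_ball_vol_N_pos N by (simp add: \<kappa>_def)
  have ps: "ps > 0" using p by (simp add: ps_def)
  have s: "s > 0" using p by (simp add: s_def)
  have J: "J > 0" unfolding J_def by (rule Beta_bubble_pos[OF p q_def])
  have T: "T > 0" using p by (simp add: T_def)
  have q: "q > 1" "1 / p + 1 / q = 1" "(q - 1) * p = q"
    using exponent_facts[OF p q_def] by auto
  have s_p: "(s + 1) * p = N" and s_ps: "s * ps = N" and sq: "s * q = N / T" and ps_inv: "1 / ps = 1 / p - 1 / N"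
    using p N by (auto simp: s_def ps_def q_def T_def field_simps)
  have Eucl: "Eucl N p * AVR m N powr (- 1 / N) = 1 / N * T powr (1 / q) * (\<kappa> * J) powr (- 1 / N)"
    unfolding T_def \<kappa>_def J_def by (rule Eucl_eq_bubble[OF p q_def AVR])
  define v where "v r = (1 + \<bar>r\<bar> powr q) powr (- s)" for r :: real
  define v' where "v' r = - s * (1 + \<bar>r\<bar> powr q) powr (- s - 1) * (q * \<bar>r\<bar> powr (q - 1) * sgn r)" for r :: real
  define h3 where "h3 r = \<bar>r\<bar> powr q * (1 + \<bar>r\<bar> powr q) powr (- N)" for r :: real
  have v_cont: "continuous_on UNIV v" unfolding v_def using q by (intro continuous_on_one_plus_abs_powr) simp
  have h3_cont: "continuous_on UNIV h3" unfolding h3_def using q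
    by (intro continuous_on_mult continuous_on_abs_powr continuous_on_one_plus_abs_powr) auto
  have v_bd: "0 \<le> v r" "v r \<le> 1" for r
    unfolding v_def using s by (auto intro!: one_plus_abs_powr_le_one)
  have h3_bd: "0 \<le> h3 r" "h3 r \<le> 1" for r
  proof -
    have "h3 r \<le> (1 + \<bar>r\<bar> powr q) * (1 + \<bar>r\<bar> powr q) powr (- N)"
      unfolding h3_def by (intro mult_right_mono) auto
    also have "\<dots> = (1 + \<bar>r\<bar> powr q) powr (1 - N)"
      using powr_mult_base[of "1 + \<bar>r\<bar> powr q" "- N"] by simp
    also have "\<dots> \<le> 1" using N_gt_1 by (intro one_plus_abs_powr_le_one) simp
    finally show "h3 r \<le> 1" .
  qed (simp add: h3_def)
  have v_deriv: "(v has_real_derivative v' r) (at r)" for r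
  proof -
    have "((\<lambda>r. 1 + \<bar>r\<bar> powr q) has_real_derivative q * \<bar>r\<bar> powr (q - 1) * sgn r) (at r)"
      using DERIV_add[OF DERIV_const has_real_derivative_abs_powr[OF q(1)], of 1 r] by simp
    from DERIV_chain2[OF has_real_derivative_powr[OF one_plus_abs_powr_pos] this, of "- s"]
    show ?thesis by (simp add: v_def[abs_def] v'_def)
  qed
  have v'_bd: "\<bar>v' r\<bar> \<le> s * q" for r
  proof -
    have "\<bar>r\<bar> powr (q - 1) \<le> 1 + \<bar>r\<bar> powr q"
    proof (cases "\<bar>r\<bar> \<le> 1")
      case True
      then have "\<bar>r\<bar> powr (q - 1) \<le> 1 powr (q - 1)" using q by (intro powr_mono2) auto
      then show ?thesis by (simp add: add_increasing2)
    next
      case False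
      then have "\<bar>r\<bar> powr (q - 1) \<le> \<bar>r\<bar> powr q" by (intro powr_mono) auto
      then show ?thesis by simp
    qed
    then have "(1 + \<bar>r\<bar> powr q) powr (- s - 1) * \<bar>r\<bar> powr (q - 1) \<le> (1 + \<bar>r\<bar> powr q) powr (- s - 1) * (1 + \<bar>r\<bar> powr q)"
      by (intro mult_left_mono) auto
    also have "\<dots> = (1 + \<bar>r\<bar> powr q) powr (- s)"
      using powr_mult_base[of "1 + \<bar>r\<bar> powr q" "- s - 1"] by (simp add: mult.commute)
    also have "\<dots> \<le> 1" using s by (intro one_plus_abs_powr_le_one) simp
    finally have le: "(1 + \<bar>r\<bar> powr q) powr (- s - 1) * \<bar>r\<bar> powr (q - 1) \<le> 1" .
    have "\<bar>v' r\<bar> = s * q * ((1 + \<bar>r\<bar> powr q) powr (- s - 1) * \<bar>r\<bar> powr (q - 1)) * \<bar>sgn r\<bar>"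
      using s q by (simp add: v'_def abs_mult)
    also have "\<dots> \<le> s * q * 1 * 1"
      using s q le by (intro mult_mono) (auto simp: sgn_if)
    finally show ?thesis by simp
  qed
  have v'_p: "\<bar>v' r\<bar> powr p \<le> (s * q) powr p * h3 r" for r
  proof -
    have "\<bar>v' r\<bar> \<le> s * q * ((1 + \<bar>r\<bar> powr q) powr (- s - 1) * \<bar>r\<bar> powr (q - 1))"
      using s q by (simp add: v'_def abs_mult sgn_if)
    then have "\<bar>v' r\<bar> powr p \<le> (s * q * ((1 + \<bar>r\<bar> powr q) powr (- s - 1) * \<bar>r\<bar> powr (q - 1))) powr p"
      using p by (intro powr_mono2) auto
    also have "\<dots> = (s * q) powr p * (((1 + \<bar>r\<bar> powr q) powr (- s - 1)) powr p * (\<bar>r\<bar> powr (q - 1)) powr p)"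
      by (simp only: powr_mult)
    also have "((1 + \<bar>r\<bar> powr q) powr (- s - 1)) powr p = (1 + \<bar>r\<bar> powr q) powr (- N)"
    proof -
      have "(- s - 1) * p = - N" using s_p by (simp add: algebra_simps)
      then show ?thesis by (simp only: powr_powr)
    qed
    also have "(\<bar>r\<bar> powr (q - 1)) powr p = \<bar>r\<bar> powr q" unfolding powr_powr q(3) ..
    finally show ?thesis by (simp add: h3_def mult.commute)
  qed
  have v_ps: "v r powr ps = (1 + \<bar>r\<bar> powr q) powr (- N)" for r
    using s_ps by (simp add: v_def powr_powr)
  \<comment> \<open>Subtracting the boundary value keeps the truncation Lipschitz, which a sharp cut
    would not; the loss of mass disappears since v tends to 0 at infinity.\<close>
  define P where "P \<Lambda> r = max 0 (v r - v \<Lambda>) powr ps" for \<Lambda> r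
  have P_cont: "continuous_on UNIV (P \<Lambda>)" for \<Lambda>
    unfolding P_def using ps
    by (intro continuous_on_powr' continuous_on_max continuous_on_diff continuous_on_const v_cont) auto
  have P_bd: "0 \<le> P \<Lambda> r" "P \<Lambda> r \<le> v r powr ps" "P \<Lambda> r \<le> 1" for \<Lambda> r
  proof -
    show le: "P \<Lambda> r \<le> v r powr ps" unfolding P_def using ps v_bd[of r] v_bd[of \<Lambda>] by (intro powr_mono2) auto
    have "v r powr ps \<le> 1 powr ps" using ps v_bd[of r] by (intro powr_mono2) auto
    with le show "P \<Lambda> r \<le> 1" by simp
  qed (simp add: P_def)
  define Pint where "Pint \<Lambda> = (\<integral>r. indicator {0..\<Lambda>} r * (r powr (N - 1) * P \<Lambda> r) \<partial>lborel)" for \<Lambda>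
  have radial: "(\<kappa> * Pint \<Lambda>) powr (1 / ps) \<le> C * (s * q) * (\<kappa> * bubble_moment N q \<Lambda>) powr (1 / p)" if \<Lambda>: "\<Lambda> > 0" for \<Lambda>
  proof -
    define l where "l n = real (Suc n)" for n
    have l: "l n > 0" for n by (simp add: l_def)
    define B where "B n = cball x0 (l n * \<Lambda>)" for n
    define I where "I f n = (\<integral>x. indicator (B n) x * f (dist x0 x / l n) \<partial>m)" for f :: "real \<Rightarrow> real" and n
    have limP: "(\<lambda>n. I (P \<Lambda>) n / l n powr N) \<longlonglongrightarrow> \<kappa> * Pint \<Lambda>"
      unfolding I_def B_def l_def \<kappa>_def Pint_def
      by (rule radial_limit[OF AVR \<Lambda> P_cont, of _ 1]) (use P_bd in simp)
    have lim3: "(\<lambda>n. I h3 n / l n powr N) \<longlonglongrightarrow> \<kappa> * bubble_moment N q \<Lambda>"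
      using radial_limit[OF AVR \<Lambda> h3_cont, of 1 x0] h3_bd
      by (simp add: I_def B_def l_def \<kappa>_def bubble_moment_def h3_def del: of_nat_Suc)
    have I_nonneg: "I (P \<Lambda>) n \<ge> 0" "I h3 n \<ge> 0" for n
      unfolding I_def using P_bd h3_bd by (auto intro!: Bochner_Integration.integral_nonneg)
    have le: "(I (P \<Lambda>) n / l n powr N) powr (1 / ps) \<le> C * (s * q) * (I h3 n / l n powr N) powr (1 / p)" for n
    proof -
      define u where "u x = max 0 (v (dist x0 x / l n) - v \<Lambda>)" for x
      have d_lip: "(1 / l n)-lipschitz_on UNIV (\<lambda>x. dist x0 x / l n)"
      proof (rule lipschitz_onI)
        fix x y
        have "\<bar>dist x0 x - dist x0 y\<bar> \<le> dist x y"
          using dist_triangle[of x0 x y] dist_triangle[of x0 y x] by (auto simp: dist_commute)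
        then show "dist (dist x0 x / l n) (dist x0 y / l n) \<le> 1 / l n * dist x y"
          using l[of n] by (simp add: dist_real_def diff_divide_distrib[symmetric] abs_divide divide_right_mono)
      qed (use l[of n] in simp)
      have w_lip: "(s * q * (1 / l n))-lipschitz_on UNIV (\<lambda>x. v (dist x0 x / l n))"
        by (rule lipschitz_on_compose_bounded_derivative[OF d_lip convex_UNIV])
          (use v_deriv v'_bd in auto)
      have u_lip: "(s * q * (1 / l n))-lipschitz_on UNIV u"
      proof (rule lipschitz_onI)
        fix x y
        have "dist (u x) (u y) \<le> dist (v (dist x0 x / l n)) (v (dist x0 y / l n))"
          unfolding u_def dist_real_def by linarith
        also have "\<dots> \<le> s * q * (1 / l n) * dist x y" by (rule lipschitz_onD[OF w_lip]) auto
        finally show "dist (u x) (u y) \<le> s * q * (1 / l n) * dist x y" .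
      qed (use lipschitz_on_nonneg[OF w_lip] in simp)
      have u_out: "u x = 0" if "x \<notin> B n" for x
      proof -
        have "\<Lambda> \<le> dist x0 x / l n" using that l[of n] by (simp add: B_def le_divide_eq mult.commute)
        then have "\<bar>\<Lambda>\<bar> powr q \<le> \<bar>dist x0 x / l n\<bar> powr q" using \<Lambda> q l[of n] by (intro powr_mono2) auto
        then have "v (dist x0 x / l n) \<le> v \<Lambda>"
          unfolding v_def using s by (intro powr_mono2') auto
        then show ?thesis by (simp add: u_def)
      qed
      have "u \<in> LIP_c" using LIP_c_of_bounded_support[OF u_lip, of x0 "l n * \<Lambda>"] u_out by (simp add: B_def)
      then have S: "(\<integral>x. \<bar>u x\<bar> powr ps \<partial>m) powr (1 / ps) \<le> C * (\<integral>x. lip u x powr p \<partial>m) powr (1 / p)"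
        by (rule ineq)
      have E: "(\<integral>x. \<bar>u x\<bar> powr ps \<partial>m) = I (P \<Lambda>) n"
        unfolding I_def
      proof (intro Bochner_Integration.integral_cong refl)
        fix x
        have "\<bar>u x\<bar> powr ps = P \<Lambda> (dist x0 x / l n)" by (simp add: u_def P_def)
        then show "\<bar>u x\<bar> powr ps = indicator (B n) x * P \<Lambda> (dist x0 x / l n)"
          using u_out[of x] ps by (cases "x \<in> B n") auto
      qed
      have G: "(\<integral>x. lip u x powr p \<partial>m) powr (1 / p) \<le> (s * q / l n) * I h3 n powr (1 / p)"
      proof -
        have "(\<integral>x. lip u x powr p \<partial>m) \<le> (\<integral>x. (s * q / l n) powr p * (indicator (B n) x * h3 (dist x0 x / l n)) \<partial>m)"
        proof (rule integral_mono_AE')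
          have [measurable]: "h3 \<in> borel_measurable borel" "B n \<in> sets borel"
            using h3_cont by (auto intro: borel_measurable_continuous_onI simp: B_def)
          have "integrable m (\<lambda>x. indicator (B n) x * h3 (dist x0 x / l n))"
            by (rule integrable_bounded_support[of _ x0 "l n * \<Lambda>" 1])
              (use h3_bd in \<open>auto simp: B_def indicator_def\<close>)
          then show "integrable m (\<lambda>x. (s * q / l n) powr p * (indicator (B n) x * h3 (dist x0 x / l n)))"
            by (rule integrable_mult_right)
          show "AE x in m. lip u x powr p \<le> (s * q / l n) powr p * (indicator (B n) x * h3 (dist x0 x / l n))"
          proof (rule AE_I2)
            fix x
            show "lip u x powr p \<le> (s * q / l n) powr p * (indicator (B n) x * h3 (dist x0 x / l n))"
            proof (cases "x \<in> B n")
              case True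
              have "lip u x \<le> lip (\<lambda>x. v (dist x0 x / l n)) x"
                by (rule lip_mono[OF w_lip]) (unfold u_def, linarith)
              also have "\<dots> \<le> \<bar>v' (dist x0 x / l n)\<bar> * lip (\<lambda>x. dist x0 x / l n) x"
                by (rule lip_chain_le[OF d_lip v_deriv])
              also have "\<dots> \<le> \<bar>v' (dist x0 x / l n)\<bar> * (1 / l n)"
                by (intro mult_left_mono lip_le_lipschitz[OF d_lip]) simp
              finally have "lip u x powr p \<le> (\<bar>v' (dist x0 x / l n)\<bar> * (1 / l n)) powr p"
                using p by (intro powr_mono2) auto
              also have "\<dots> = \<bar>v' (dist x0 x / l n)\<bar> powr p * (1 / l n) powr p" by (rule powr_mult)
              also have "\<dots> \<le> ((s * q) powr p * h3 (dist x0 x / l n)) * (1 / l n) powr p"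
                by (intro mult_right_mono v'_p) simp
              also have "\<dots> = (s * q * (1 / l n)) powr p * h3 (dist x0 x / l n)"
                by (simp only: powr_mult mult_ac)
              finally show ?thesis using True by simp
            next
              case False
              then have "lip u x = 0"
                using lip_eq_0_outside[of x0 "l n * \<Lambda>" u x] u_out by (simp add: B_def)
              then show ?thesis using False by simp
            qed
          qed
        qed (use h3_bd in auto)
        also have "\<dots> = (s * q / l n) powr p * I h3 n" by (simp add: I_def)
        finally have "(\<integral>x. lip u x powr p \<partial>m) powr (1 / p) \<le> ((s * q / l n) powr p * I h3 n) powr (1 / p)"
          using p by (intro powr_mono2) auto
        also have "\<dots> = ((s * q / l n) powr p) powr (1 / p) * I h3 n powr (1 / p)" by (rule powr_mult)
        also have "((s * q / l n) powr p) powr (1 / p) = s * q / l n"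
          using p s q l[of n] by (simp add: powr_powr)
        finally show ?thesis .
      qed
      have main: "I (P \<Lambda>) n powr (1 / ps) \<le> C * ((s * q / l n) * I h3 n powr (1 / p))"
        using order_trans[OF S[unfolded E] mult_left_mono[OF G C]] .
      have scale: "(x / l n powr N) powr a = x powr a * l n powr (- N * a)" if "x \<ge> 0" for x a
        using l[of n] that by (simp add: powr_divide powr_powr powr_minus field_simps)
      \<comment> \<open>Scale invariance of the inequality: 1 / \<open>ps\<close> = 1 / p - 1 / N
        compensates the factor 1 / \<open>l n\<close> of the gradient.\<close>
      have l_eq: "1 / l n * l n powr (- N * (1 / ps)) = l n powr (- N * (1 / p))"
      proof -
        have "- N * (1 / p) = - 1 + - N * (1 / ps)" using N by (simp add: ps_inv right_diff_distrib)
        then have "l n powr (- N * (1 / p)) = l n powr (- 1) * l n powr (- N * (1 / ps))" by (simp only: powr_add)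
        then show ?thesis using l[of n] by (simp add: powr_minus divide_inverse)
      qed
      have "(I (P \<Lambda>) n / l n powr N) powr (1 / ps) = I (P \<Lambda>) n powr (1 / ps) * l n powr (- N * (1 / ps))"
        by (rule scale[OF I_nonneg(1)])
      also have "\<dots> \<le> C * ((s * q / l n) * I h3 n powr (1 / p)) * l n powr (- N * (1 / ps))"
        using main by (rule mult_right_mono) simp
      also have "\<dots> = C * (s * q) * (I h3 n powr (1 / p) * (1 / l n * l n powr (- N * (1 / ps))))"
        by simp
      also have "\<dots> = C * (s * q) * (I h3 n / l n powr N) powr (1 / p)"
        unfolding l_eq scale[OF I_nonneg(2)] ..
      finally show ?thesis .
    qed
    show ?thesis
    proof (rule LIMSEQ_le)
      show "(\<lambda>n. (I (P \<Lambda>) n / l n powr N) powr (1 / ps)) \<longlonglongrightarrow> (\<kappa> * Pint \<Lambda>) powr (1 / ps)"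
        using ps I_nonneg by (intro tendsto_powr' limP tendsto_const disjI2 conjI always_eventually allI) auto
      show "(\<lambda>n. C * (s * q) * (I h3 n / l n powr N) powr (1 / p)) \<longlonglongrightarrow> C * (s * q) * (\<kappa> * bubble_moment N q \<Lambda>) powr (1 / p)"
        using p I_nonneg by (intro tendsto_mult tendsto_powr' lim3 tendsto_const disjI2 conjI always_eventually allI) auto
    qed (use le in blast)
  qed
  have lim_mom: "(\<lambda>k. bubble_moment N q (real (Suc k))) \<longlonglongrightarrow> J * T"
    unfolding J_def T_def by (rule bubble_moment_limit[OF p q_def])
  have v_lim: "(\<lambda>k. v (real (Suc k))) \<longlonglongrightarrow> 0"
  proof -
    have "filterlim (\<lambda>k. real (Suc k) powr q) at_top sequentially"
      using q by (intro filterlim_compose[OF real_powr_at_top] filterlim_compose[OF filterlim_real_sequentially filterlim_Suc]) simp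
    then have "filterlim (\<lambda>k. 1 + \<bar>real (Suc k)\<bar> powr q) at_top sequentially"
      by (intro filterlim_tendsto_add_at_top[OF tendsto_const]) simp
    then show ?thesis unfolding v_def using s by (intro tendsto_neg_powr) auto
  qed
  have lim_P: "(\<lambda>k. Pint (real (Suc k))) \<longlonglongrightarrow> J"
  proof -
    let ?h = "\<lambda>r. indicator {0..} r * (r powr (N - 1) * v r powr ps)"
    have int: "integrable lborel ?h"
      unfolding v_ps by (rule bubble_mass_integrable[OF p q_def])
    have J_eq: "J = (\<integral>r. ?h r \<partial>lborel)"
      unfolding v_ps J_def using bubble_mass_half_line[OF p q_def] by simp
    show ?thesis
      unfolding J_eq Pint_def
    proof (rule integral_dominated_convergence[where w = ?h])
      have [measurable]: "P \<Lambda> \<in> borel_measurable borel" "v \<in> borel_measurable borel" for \<Lambda>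
        using P_cont v_cont by (auto intro: borel_measurable_continuous_onI)
      show "?h \<in> borel_measurable lborel" by measurable
      show "(\<lambda>r. indicator {0..real (Suc k)} r * (r powr (N - 1) * P (real (Suc k)) r)) \<in> borel_measurable lborel" for k
        by measurable
      show "AE r in lborel. norm (indicator {0..real (Suc k)} r * (r powr (N - 1) * P (real (Suc k)) r)) \<le> ?h r" for k
        using P_bd by (intro AE_I2) (auto simp: indicator_def intro!: mult_left_mono)
      show "AE r in lborel. (\<lambda>k. indicator {0..real (Suc k)} r * (r powr (N - 1) * P (real (Suc k)) r)) \<longlonglongrightarrow> ?h r"
      proof (rule AE_I2)
        fix r :: real
        have "eventually (\<lambda>k. r \<le> real (Suc k)) sequentially"
          using filterlim_compose[OF filterlim_real_sequentially filterlim_Suc] by (simp add: filterlim_at_top)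
        then have "eventually (\<lambda>k. (indicator {0..} r :: real) = indicator {0..real (Suc k)} r) sequentially"
          by eventually_elim (auto simp: indicator_def)
        then have ind: "(\<lambda>k. indicator {0..real (Suc k)} r :: real) \<longlonglongrightarrow> indicator {0..} r"
          by (intro tendsto_eventually) (auto elim: eventually_mono)
        have "(\<lambda>k. P (real (Suc k)) r) \<longlonglongrightarrow> max 0 (v r - 0) powr ps"
          unfolding P_def using ps by (intro tendsto_powr' tendsto_max tendsto_diff tendsto_const v_lim) auto
        then show "(\<lambda>k. indicator {0..real (Suc k)} r * (r powr (N - 1) * P (real (Suc k)) r)) \<longlonglongrightarrow> ?h r"
          using v_bd[of r] by (intro tendsto_mult ind tendsto_const) simp
      qed
    qed (use int in simp)
  qed
  have "(\<kappa> * J) powr (1 / ps) \<le> C * (s * q) * (\<kappa> * (J * T)) powr (1 / p)"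
  proof (rule LIMSEQ_le)
    show "(\<lambda>k. (\<kappa> * Pint (real (Suc k))) powr (1 / ps)) \<longlonglongrightarrow> (\<kappa> * J) powr (1 / ps)"
      using \<kappa> J by (intro tendsto_powr tendsto_mult tendsto_const lim_P) auto
    show "(\<lambda>k. C * (s * q) * (\<kappa> * bubble_moment N q (real (Suc k))) powr (1 / p)) \<longlonglongrightarrow> C * (s * q) * (\<kappa> * (J * T)) powr (1 / p)"
      using \<kappa> J T by (intro tendsto_powr tendsto_mult tendsto_const lim_mom) auto
    show "\<exists>n. \<forall>k\<ge>n. (\<kappa> * Pint (real (Suc k))) powr (1 / ps) \<le> C * (s * q) * (\<kappa> * bubble_moment N q (real (Suc k))) powr (1 / p)"
      by (intro exI[of _ 0] allI impI radial) simp
  qed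
  also have "(\<kappa> * (J * T)) powr (1 / p) = (\<kappa> * J) powr (1 / p) * T powr (1 / p)"
    by (simp only: mult.assoc[symmetric] powr_mult)
  finally have 1: "(\<kappa> * J) powr (1 / ps) \<le> C * (s * q) * ((\<kappa> * J) powr (1 / p) * T powr (1 / p))" .
  have e1: "(\<kappa> * J) powr (- 1 / N) = (\<kappa> * J) powr (1 / ps) * (\<kappa> * J) powr (- (1 / p))"
    unfolding powr_add[symmetric] by (simp add: ps_inv)
  have e2: "(\<kappa> * J) powr (1 / p) * (\<kappa> * J) powr (- (1 / p)) = 1"
    unfolding powr_add[symmetric] using \<kappa> J by simp
  have e3: "T powr (1 / p) * T powr (1 / q) = T"
    unfolding powr_add[symmetric] q(2) using T by simp
  \<comment> \<open>Multiplying by the remaining factors of the optimal constant makes the powers of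
    \<kappa> J cancel, and those of T combine to T. What is left besides C is s q T / N, which is
    1.\<close>
  have "1 / N * T powr (1 / q) * (\<kappa> * J) powr (- 1 / N)
     \<le> 1 / N * T powr (1 / q) * (C * (s * q) * ((\<kappa> * J) powr (1 / p) * T powr (1 / p)) * (\<kappa> * J) powr (- (1 / p)))"
    unfolding e1 using 1 N by (intro mult_left_mono mult_right_mono) auto
  also have "\<dots> = C * (s * q) / N * (T powr (1 / p) * T powr (1 / q)) * ((\<kappa> * J) powr (1 / p) * (\<kappa> * J) powr (- (1 / p)))"
    by (simp add: mult_ac)
  also have "\<dots> = C" unfolding e2 e3 sq using T N by simp
  finally show ?thesis unfolding Eucl .
qed


section \<open>Compactly supported functions and their minimal weak upper gradients\<close>

lemma LIP_c_Lp: "u \<in> LIP_c \<Longrightarrow> s > 0 \<Longrightarrow> u \<in> Lp m s"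
proof -
  fix u :: "'a \<Rightarrow> real" and s :: real assume u: "u \<in> LIP_c" and s: "s > 0"
  obtain x0 :: 'a where True by blast
  obtain L R where LR: "L-lipschitz_on UNIV u" "\<And>x. x \<notin> ball x0 R \<Longrightarrow> u x = 0"
    using LIP_c_bounded_support[OF u, of x0] by blast
  have "u \<in> borel_measurable m"
    unfolding measurable_m using LR(1) by (intro LIP_borel_measurable) (auto simp: LIP_def)
  then show "u \<in> Lp m s"
    using integrable_abs_powr_bounded_support[OF LR s] by (simp add: Lp_def)
qed

text \<open>The constant sequence u is a competitor, so the energy is finite and the choice in
  \<open>minimal_wug\<close> picks an actual minimal gradient. The same competitor yields the
  comparison with \<open>lip u\<close>, the direction needed for sharpness.\<close>

lemma minimal_wug_LIP_c:
  assumes u: "u \<in> LIP_c" and p: "p > 1"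
  shows "weak_upper_gradient m p u (minimal_wug m p u)"
    and "(\<integral>x. \<bar>minimal_wug m p u x\<bar> powr p \<partial>m) \<le> (\<integral>x. lip u x powr p \<partial>m)"
proof -
  obtain x0 :: 'a where True by blast
  obtain L R where LR: "L-lipschitz_on UNIV u" "R > 0" "\<And>x. x \<notin> ball x0 R \<Longrightarrow> u x = 0"
    using LIP_c_bounded_support[OF u, of x0] by blast
  have out: "u x = 0" if "x \<notin> cball x0 R" for x using LR(3)[of x] that by auto
  have u_Lp: "u \<in> Lp m p" using u p by (intro LIP_c_Lp) auto
  have lip_int: "integrable m (\<lambda>x. lip u x powr p)"
    using p by (intro lip_powr_integrable[OF LR(1) out]) auto
  have le: "Cheeger_energy m p u \<le> ennreal (\<integral>x. lip u x powr p \<partial>m)"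
  proof -
    have "(\<integral>\<^sup>+x. ennreal (lip u x powr p) \<partial>m) = ennreal (\<integral>x. lip u x powr p \<partial>m)"
      using lip_int by (intro nn_integral_eq_integral) auto
    moreover have "u \<in> Lp m p \<inter> LIP" using u u_Lp by (simp add: LIP_c_def)
    ultimately show ?thesis using Cheeger_energy_le_self[of u m p] by simp
  qed
  then have fin: "Cheeger_energy m p u < \<infinity>" by (rule order.strict_trans1) simp
  have min: "is_minimal_wug m p u (minimal_wug m p u)"
    unfolding minimal_wug_def by (rule someI_ex[OF minimal_wug_exists[OF sets_m p u_Lp fin]])
  then show "weak_upper_gradient m p u (minimal_wug m p u)" by (simp add: is_minimal_wug_def)
  then have G: "minimal_wug m p u \<in> Lp m p" "\<And>x. 0 \<le> minimal_wug m p u x"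
    unfolding weak_upper_gradient_def by (blast, blast)
  have "Cheeger_energy m p u = ennreal (\<integral>x. \<bar>minimal_wug m p u x\<bar> powr p \<partial>m)"
    using min nn_integral_powr_eq[OF G(1)] G(2) by (simp add: is_minimal_wug_def)
  with le show "(\<integral>x. \<bar>minimal_wug m p u x\<bar> powr p \<partial>m) \<le> (\<integral>x. lip u x powr p \<partial>m)"
    by (simp add: ennreal_le_iff)
qed

lemma Sobolev_minimal_wug:
  assumes AVR: "AVR m N > 0" and p: "1 < p" "p < N" and u: "u \<in> LIP_c"
  shows "Lp_norm m (p * N / (N - p)) u
    \<le> Eucl N p * AVR m N powr (- 1 / N) * Lp_norm m p (minimal_wug m p u)"
proof -
  define ps where "ps = p * N / (N - p)"
  define K where "K = Eucl N p * AVR m N powr (- 1 / N)"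
  define A where "A = (\<integral>x. \<bar>minimal_wug m p u x\<bar> powr p \<partial>m)"
  have ps: "ps > 0" using p by (simp add: ps_def)
  have K: "K \<ge> 0" unfolding K_def Eucl_def using p by (intro mult_nonneg_nonneg) auto
  have A: "A \<ge> 0" by (simp add: A_def)
  have u_Lp: "u \<in> Lp m p" "u \<in> Lp m ps" using u p ps by (auto intro: LIP_c_Lp)
  have "ennreal (\<integral>x. \<bar>u x\<bar> powr ps \<partial>m) \<le> ennreal (K powr ps * A powr (ps / p))"
    using Sobolev_weak_upper_gradient[OF AVR p u_Lp(1) minimal_wug_LIP_c(1)[OF u p(1)]]
    unfolding ps_def[symmetric] K_def[symmetric] A_def[symmetric] nn_integral_powr_eq[OF u_Lp(2)] .
  then have "(\<integral>x. \<bar>u x\<bar> powr ps \<partial>m) \<le> K powr ps * A powr (ps / p)" by (simp add: ennreal_le_iff)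
  then have "(\<integral>x. \<bar>u x\<bar> powr ps \<partial>m) powr (1 / ps) \<le> (K powr ps * A powr (ps / p)) powr (1 / ps)"
    using ps by (intro powr_mono2) auto
  also have "\<dots> = K * A powr (1 / p)"
    using ps K by (simp add: powr_mult powr_powr)
  finally show ?thesis by (simp add: Lp_norm_def ps_def K_def A_def)
qed

text \<open>A negative C is first replaced by 0, since replacing the gradient norm by the larger
  norm of \<open>lip u\<close> requires a nonnegative factor.\<close>

lemma Sobolev_minimal_wug_sharp:
  assumes AVR: "AVR m N > 0" and p: "1 < p" "p < N"
    and ineq: "\<forall>u\<in>LIP_c. Lp_norm m (p * N / (N - p)) u \<le> C * Lp_norm m p (minimal_wug m p u)"
  shows "Eucl N p * AVR m N powr (- 1 / N) \<le> max 0 C"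
proof (rule Sobolev_sharp[OF AVR p])
  fix u :: "'a \<Rightarrow> real" assume u: "u \<in> LIP_c"
  have "Lp_norm m (p * N / (N - p)) u \<le> C * Lp_norm m p (minimal_wug m p u)" using ineq u by blast
  also have "\<dots> \<le> max 0 C * Lp_norm m p (minimal_wug m p u)"
    by (intro mult_right_mono) (auto simp: Lp_norm_def)
  also have "\<dots> \<le> max 0 C * (\<integral>x. lip u x powr p \<partial>m) powr (1 / p)"
    unfolding Lp_norm_def using minimal_wug_LIP_c(2)[OF u p(1)] p
    by (intro mult_left_mono powr_mono2) auto
  finally show "(\<integral>x. \<bar>u x\<bar> powr (p * N / (N - p)) \<partial>m) powr (1 / (p * N / (N - p)))
      \<le> max 0 C * (\<integral>x. lip u x powr p \<partial>m) powr (1 / p)"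
    by (simp add: Lp_norm_def)
qed simp

end

theorem theorem1p13:
  fixes m :: "'a::polish_space measure" and N p p_star :: real
  assumes "metric_measure_space m"
    and "1 < N"
    and "CD0 m N"
    and "AVR m N > 0"
    and "1 < p" and "p < N"
    and "p_star = p * N / (N - p)"
  shows "(\<forall>u\<in>LIP_c. Lp_norm m p_star u
            \<le> Eucl N p * AVR m N powr (- 1 / N) * Lp_norm m p (minimal_wug m p u)) \<and>
         (\<forall>C < Eucl N p * AVR m N powr (- 1 / N).
            \<not> (\<forall>u\<in>LIP_c. Lp_norm m p_star u \<le> C * Lp_norm m p (minimal_wug m p u)))"
proof -
  interpret cd0_space m N using assms by unfold_locales
  \<comment> \<open>Strict positivity lets the bound by \<open>max 0 C\<close> contradict C below
    the constant also when C is negative.\<close>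
  have pos: "Eucl N p * AVR m N powr (- 1 / N) > 0"
    unfolding Eucl_eq_bubble[OF assms(5,6) refl assms(4)]
    using assms Beta_bubble_pos[OF assms(5,6) refl] less_imp_neq[OF unit_ball_vol_N_pos, symmetric]
    by (intro mult_pos_pos) auto
  show ?thesis
  proof (intro conjI ballI allI impI notI)
    fix u :: "'a \<Rightarrow> real" assume "u \<in> LIP_c"
    then show "Lp_norm m p_star u \<le> Eucl N p * AVR m N powr (- 1 / N) * Lp_norm m p (minimal_wug m p u)"
      unfolding assms(7) by (rule Sobolev_minimal_wug[OF assms(4-6)])
  next
    fix C assume "C < Eucl N p * AVR m N powr (- 1 / N)"
      and "\<forall>u\<in>LIP_c. Lp_norm m p_star u \<le> C * Lp_norm m p (minimal_wug m p u)"
    with Sobolev_minimal_wug_sharp[OF assms(4-6), of C] pos show False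
      unfolding assms(7) by simp
  qed
qed

end
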